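(* Let $k\ge 0$ be an integer and regard $n$ as an indeterminate. Then, as identities of rational functions in $n$: (1) for $\mathcal P=\mathcal P_o^+$ (the case of $O_n^+$), $$\det(G_{kn})=n^{a_k}\prod_{\sigma}\frac{P_{r(\sigma)/2}(n)}{P_{r(\sigma)/2-1}(n)},$$ the product being over all epi $\sigma\in\mathcal P^+(k)$ with $r(\sigma)$ even; (2) for $\mathcal P=\mathcal P_b^+$ (the case of $B_n^+$), $$\det(G_{kn})=n^{a_k}\prod_{\sigma}\frac{Q_{r(\sigma)/2}(n)}{Q_{r(\sigma)/2-1}(n)},$$ the product being over all epi $\sigma\in\mathcal P^+(k)$ with $r(\sigma)$ even; (3) for $\mathcal P=\mathcal P_s^+$ (the case of $S_n^+$), $$\det(G_{kn})=n^{a_k}\prod_{\sigma\in\mathcal P^+(k)}\frac{R_{r(\sigma)}(n)}{R_{r(\sigma)-1}(n)}.$$ Here, by convention, $P_{-1}=Q_{-1}=R_{-1}=1$, so that epi with $r(\sigma)=0$ contribute a factor $1$.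
   Context: For $k,l\ge0$, a partition in $\mathcal P_s(k,l)$ is a set partition of the union of an upper row of $k$ points and a lower row of $l$ points. Consider the following families: $\mathcal P_o^+(k,l)$ = noncrossing pairings (all blocks of size 2); $\mathcal P_b^+(k,l)$ = noncrossing partitions all of whose blocks have size 1 or 2; $\mathcal P_s^+(k,l)$ = all noncrossing partitions. (Noncrossing means: drawable in the strip between the two rows without crossings.) For such a family $\mathcal P$ put $\mathcal P(k)=\mathcal P(0,k)$. For $\pi,\sigma\in\mathcal P(k)$ let $\pi\vee\sigma$ be their join in the lattice of all set partitions of the $k$ points, and let $|\cdot|$ be the number of blocks. Gram matrix: $G_{kn}=(n^{|\pi\vee\sigma|})_{\pi,\sigma\in\mathcal P(k)}$ (the determinant of an empty matrix is $1$). Exponent: $a_k=\sum_{\pi\in\mathcal P(k)}(2|\pi|-k)$. Epi: for $0\le r\le k$, $\mathcal P^r(k)$ is the set of $\sigma\in\mathcal P(r,k)$ such that each upper point is connected to lower points only (so no two upper points lie in the same block), and to at least one lower point. Set $\mathcal P^+(k)=\bigcup_{r=0}^k\mathcal P^r(k)$, and for $\sigma\in\mathcal P^r(k)$ put $r(\sigma)=r$. Polynomials: $P_0=1$, $P_1=n$, $P_{r+1}=nP_r-P_{r-1}$ for $r\ge1$; $Q_0=1$, $Q_1=n-1$, $Q_{r+1}=(n-1)Q_r-Q_{r-1}$ for $r\ge1$; $R_0=1$, $R_2=n-1$, $R_{2l+2}=(n-2)R_{2l}-R_{2l-2}$ for $l\ge1$; $R_1=1$, $R_3=n-2$, $R_{2l+3}=(n-2)R_{2l+1}-R_{2l-1}$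 for $l\ge1$. *)

theory Defs
  imports
    "HOL-Library.Disjoint_Sets"
    "HOL-Computational_Algebra.Polynomial"
    "HOL-Computational_Algebra.Fraction_Field"
    "Jordan_Normal_Form.Determinant"
begin

section \<open>Noncrossing partitions on two rows\<close>

text \<open>The upper points are \<open>Inl 0, \<dots>, Inl (k - 1)\<close> and the lower points are
  \<open>Inr 0, \<dots>, Inr (l - 1)\<close>, both numbered from left to right.\<close>

type_synonym point = "nat + nat"

definition points :: "nat \<Rightarrow> nat \<Rightarrow> point set" where
  "points k l = Inl ` {..<k} \<union> Inr ` {..<l}"

text \<open>Position along the boundary of the strip: the upper row is traversed from right to left,
  then the lower row from left to right. Blocks can be drawn in the strip without crossings iff
  they do not cross as blocks of points on a circle, in this order.\<close>

fun pos :: "point \<Rightarrow> int" where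
  "pos (Inl i) = - int i - 1"
| "pos (Inr j) = int j"

definition noncrossing :: "point set set \<Rightarrow> bool" where
  "noncrossing \<pi> \<longleftrightarrow>
     \<not> (\<exists>B\<in>\<pi>. \<exists>C\<in>\<pi>. B \<noteq> C \<and>
          (\<exists>a\<in>B. \<exists>b\<in>C. \<exists>c\<in>B. \<exists>d\<in>C. pos a < pos b \<and> pos b < pos c \<and> pos c < pos d))"

type_synonym family = "nat \<Rightarrow> nat \<Rightarrow> point set set set"

definition Ps_plus :: family where
  "Ps_plus k l = {\<pi>. partition_on (points k l) \<pi> \<and> noncrossing \<pi>}"

definition Pb_plus :: family where
  "Pb_plus k l = {\<pi> \<in> Ps_plus k l. \<forall>B\<in>\<pi>. card B = 1 \<or> card B = 2}"

definition Po_plus :: family where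
  "Po_plus k l = {\<pi> \<in> Ps_plus k l. \<forall>B\<in>\<pi>. card B = 2}"


section \<open>Gram matrices\<close>

text \<open>\<open>refines A \<pi> \<tau>\<close> says that every block of \<open>\<pi>\<close> is contained in a block of \<open>\<tau>\<close>.\<close>

definition is_join :: "'a set \<Rightarrow> 'a set set \<Rightarrow> 'a set set \<Rightarrow> 'a set set \<Rightarrow> bool" where
  "is_join A \<pi> \<sigma> \<tau> \<longleftrightarrow>
     refines A \<pi> \<tau> \<and> refines A \<sigma> \<tau> \<and>
     (\<forall>\<rho>. refines A \<pi> \<rho> \<and> refines A \<sigma> \<rho> \<longrightarrow> refines A \<tau> \<rho>)"

definition part_join :: "'a set \<Rightarrow> 'a set set \<Rightarrow> 'a set set \<Rightarrow> 'a set set" where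
  "part_join A \<pi> \<sigma> = (THE \<tau>. is_join A \<pi> \<sigma> \<tau>)"

lemma is_join_unique: "is_join A \<pi> \<sigma> \<tau> \<Longrightarrow> is_join A \<pi> \<sigma> \<tau>' \<Longrightarrow> \<tau> = \<tau>'"
  unfolding is_join_def by (rule refines_asym[of A]) simp_all

lemma is_join_exists:
  assumes "partition_on A \<pi>" and "partition_on A \<sigma>"
  shows "\<exists>\<tau>. is_join A \<pi> \<sigma> \<tau>"
proof -
  define r where "r = (\<Union>B\<in>\<pi> \<union> \<sigma>. B \<times> B)"
  have A: "A = \<Union>\<pi>" "A = \<Union>\<sigma>"
    using assms by (auto dest: partition_onD1)
  have rA: "r \<subseteq> A \<times> A"
    unfolding r_def using A by auto
  have "sym r" unfolding r_def sym_def by blast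
  then have sym: "sym (r\<^sup>+)" by (rule sym_trancl)
  have sub: "r\<^sup>+ \<subseteq> A \<times> A" using rA by (rule trancl_subset_Sigma)
  have refl: "(x, x) \<in> r\<^sup>+" if x: "x \<in> A" for x
  proof -
    obtain B where "B \<in> \<pi>" "x \<in> B" using x A(1) by auto
    then have "(x, x) \<in> r" unfolding r_def by auto
    then show ?thesis ..
  qed
  have eq: "equiv A (r\<^sup>+)"
    using sub sym refl by (auto simp: equiv_def refl_on_def)
  have part: "partition_on A (A // r\<^sup>+)"
    using eq by (rule partition_on_quotient)
  have up: "refines A \<rho> (A // r\<^sup>+)" if \<rho>: "\<rho> \<subseteq> \<pi> \<union> \<sigma>" "partition_on A \<rho>" for \<rho>
    unfolding refines_def
  proof (intro conjI ballI)
    fix B assume B: "B \<in> \<rho>"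
    then obtain x where x: "x \<in> B" using \<rho>(2) partition_onD3 by fastforce
    then have "x \<in> A" using B \<rho>(2) partition_onD1 by fastforce
    then have Q: "r\<^sup>+ `` {x} \<in> A // r\<^sup>+" by (rule quotientI)
    have "(x, y) \<in> r" if "y \<in> B" for y
      using B \<rho>(1) x that unfolding r_def by auto
    then have "B \<subseteq> r\<^sup>+ `` {x}" by auto
    with Q show "\<exists>Y\<in>A // r\<^sup>+. B \<subseteq> Y" by (rule bexI[rotated])
  qed (use \<rho> part in auto)
  have least: "refines A (A // r\<^sup>+) \<rho>" if \<rho>: "refines A \<pi> \<rho>" "refines A \<sigma> \<rho>" for \<rho>
    unfolding refines_def
  proof (intro conjI ballI)
    show "partition_on A (A // r\<^sup>+)" by (rule part)
    show part\<rho>: "partition_on A \<rho>" using \<rho>(1) by (simp add: refines_def)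
    fix X assume "X \<in> A // r\<^sup>+"
    then obtain x where x: "x \<in> A" "X = r\<^sup>+ `` {x}" by (rule quotientE)
    obtain Y where Y: "Y \<in> \<rho>" "x \<in> Y" using x(1) part\<rho> partition_onD1 by fastforce
    have Y_closed: "b \<in> Y" if ab: "(a, b) \<in> r" "a \<in> Y" for a b
    proof -
      obtain B where B: "B \<in> \<pi> \<union> \<sigma>" "a \<in> B" "b \<in> B" using ab(1) unfolding r_def by auto
      obtain Z where Z: "Z \<in> \<rho>" "B \<subseteq> Z" using B(1) \<rho> unfolding refines_def by blast
      then have "Z = Y" using Y ab(2) B(2) partition_onD2[OF part\<rho>] by (auto simp: disjoint_def)
      then show ?thesis using Z B by blast
    qed
    have "y \<in> Y" if "(x, y) \<in> r\<^sup>+" for y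
      using that
    proof (induction rule: trancl_induct)
      case (base y)
      then show ?case using Y(2) by (rule Y_closed)
    next
      case (step y z)
      show ?case using step.hyps(2) step.IH by (rule Y_closed)
    qed
    then show "\<exists>Y\<in>\<rho>. X \<subseteq> Y" using Y x(2) by blast
  qed
  show ?thesis
    unfolding is_join_def using up[of \<pi>] up[of \<sigma>] assms least by auto
qed

lemma is_join_part_join:
  assumes "partition_on A \<pi>" and "partition_on A \<sigma>"
  shows "is_join A \<pi> \<sigma> (part_join A \<pi> \<sigma>)"
proof -
  obtain \<tau> where \<tau>: "is_join A \<pi> \<sigma> \<tau>"
    using is_join_exists[OF assms] ..
  show ?thesis
    unfolding part_join_def by (rule theI, rule \<tau>, rule is_join_unique, assumption, rule \<tau>)
qed

text \<open>\<open>\<pi>s\<close> is an enumeration of \<open>\<P>(0,k)\<close>. The determinant does not depend on its order,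
  since rows and columns are permuted simultaneously.\<close>

definition gram :: "nat \<Rightarrow> 'a::comm_ring_1 \<Rightarrow> point set set list \<Rightarrow> 'a mat" where
  "gram k n \<pi>s = mat (length \<pi>s) (length \<pi>s)
     (\<lambda>(i, j). n ^ card (part_join (points 0 k) (\<pi>s ! i) (\<pi>s ! j)))"

definition enumerates :: "'a list \<Rightarrow> 'a set \<Rightarrow> bool" where
  "enumerates xs S \<longleftrightarrow> distinct xs \<and> set xs = S"

lemma finite_Ps_plus: "finite (Ps_plus k l)"
  by (rule finite_subset[OF _ finitely_many_partition_on[of "points k l"]])
    (auto simp: Ps_plus_def points_def)

lemma finite_Pb_plus: "finite (Pb_plus k l)"
  unfolding Pb_plus_def by (simp add: finite_Ps_plus)

lemma finite_Po_plus: "finite (Po_plus k l)"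
  unfolding Po_plus_def by (simp add: finite_Ps_plus)

definition expo :: "family \<Rightarrow> nat \<Rightarrow> int" where
  "expo P k = (\<Sum>\<pi>\<in>P 0 k. 2 * int (card \<pi>) - int k)"


section \<open>Epi\<close>

definition epi_rank :: "family \<Rightarrow> nat \<Rightarrow> nat \<Rightarrow> point set set set" where
  "epi_rank P r k = {\<sigma> \<in> P r k. \<forall>B\<in>\<sigma>. \<forall>i. Inl i \<in> B \<longrightarrow>
     (\<forall>i'. Inl i' \<in> B \<longrightarrow> i' = i) \<and> (\<exists>j. Inr j \<in> B)}"

definition epis :: "family \<Rightarrow> nat \<Rightarrow> point set set set" where
  "epis P k = (\<Union>r\<le>k. epi_rank P r k)"

text \<open>The number \<open>r\<close> is recovered from a partition of \<open>points r k\<close> as the number of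
  upper points.\<close>

definition num_upper :: "point set set \<Rightarrow> nat" where
  "num_upper \<sigma> = card {i. Inl i \<in> \<Union>\<sigma>}"

lemma num_upper_eq: "partition_on (points r k) \<sigma> \<Longrightarrow> num_upper \<sigma> = r"
proof -
  assume "partition_on (points r k) \<sigma>"
  then have "\<Union>\<sigma> = points r k" by (rule partition_onD1[symmetric])
  then have "{i. Inl i \<in> \<Union>\<sigma>} = {..<r}" by (auto simp: points_def)
  then show ?thesis by (simp add: num_upper_def)
qed


section \<open>The polynomials\<close>

fun polyP :: "nat \<Rightarrow> 'a::comm_ring_1 \<Rightarrow> 'a" where
  "polyP 0 n = 1"
| "polyP (Suc 0) n = n"
| "polyP (Suc (Suc r)) n = n * polyP (Suc r) n - polyP r n"

fun polyQ :: "nat \<Rightarrow> 'a::comm_ring_1 \<Rightarrow> 'a" where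
  "polyQ 0 n = 1"
| "polyQ (Suc 0) n = n - 1"
| "polyQ (Suc (Suc r)) n = (n - 1) * polyQ (Suc r) n - polyQ r n"

text \<open>The even and odd recursions for \<open>R\<close> have the same form and differ only in their
  initial values.\<close>

fun polyR :: "nat \<Rightarrow> 'a::comm_ring_1 \<Rightarrow> 'a" where
  "polyR 0 n = 1"
| "polyR (Suc 0) n = 1"
| "polyR (Suc (Suc 0)) n = n - 1"
| "polyR (Suc (Suc (Suc 0))) n = n - 2"
| "polyR (Suc (Suc (Suc (Suc m)))) n = (n - 2) * polyR (Suc (Suc m)) n - polyR m n"

text \<open>\<open>pred_poly p r\<close> is \<open>p\<close> with index \<open>r - 1\<close>, where index \<open>-1\<close> gives \<open>1\<close>.\<close>

definition pred_poly :: "(nat \<Rightarrow> 'a::comm_ring_1 \<Rightarrow> 'a) \<Rightarrow> nat \<Rightarrow> 'a \<Rightarrow> 'a" where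
  "pred_poly p r n = (if r = 0 then 1 else p (r - 1) n)"

text \<open>The indeterminate, as an element of the field of rational functions over the rationals.\<close>

definition indet :: "rat poly fract" where
  "indet = Fract [:0, 1:] 1"

end

theory Submission
  imports Defs "HOL-Computational_Algebra.Polynomial_Factorial"
begin

text \<open>The Gram matrix is factored as \<open>T W T\<^sup>t\<close> with \<open>T\<close> unitriangular and \<open>W\<close> diagonal, and the diagonal is
  then counted.

  A noncrossing partition of \<open>k\<close> points is read from left to right as a word, and words are turned
  into lattice paths from height \<open>0\<close> to height \<open>0\<close>: a pair becomes a rise and a matching descent, a
  singleton becomes a flat step, and in the case of all noncrossing partitions every point is first
  doubled, so that a block becomes the pairs of strands along its boundary. To each partition \<open>\<pi>\<close>
  belongs a vector indexed by lattice paths. Its entry at a path \<open>p\<close> is \<open>0\<close> unless the two steps of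
  \<open>p\<close> at every pair of \<open>\<pi>\<close> are opposite to each other and every singleton is flat in \<open>p\<close>, and otherwise it is a product of
  coefficients, one for each pair whose left step is not a rise in \<open>p\<close>. The path of \<open>\<pi>\<close> itself is
  the largest one in the support, for a suitable order, so the matrix \<open>T\<close> of these vectors is
  unitriangular. The path \<open>p\<close> has the weight \<open>w(p)\<close>, the product of \<open>\<nu>\<^sub>h\<close> over its rises from height
  \<open>h\<close> and of \<open>n\<close> over its flat steps. If
  \<open>\<nu>\<^sub>h + 1/\<nu>\<^bsub>h-1\<^esub>\<close> is the value of a closed loop (minus \<open>1\<close> if flat steps occur), then the vectors
  obey the rules for composing planar diagrams: a closed loop can be replaced by its value, and a
  zigzag can be straightened. These recurrences are solved by ratios of consecutive polynomials
  \<open>P\<close>, \<open>Q\<close> and (up to a power of \<open>n\<close>) \<open>R\<close>.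

  That the weighted inner product of the vectors of \<open>\<pi>\<close> and \<open>\<sigma>\<close> is \<open>n\<close> to the number of blocks of
  \<open>\<pi> \<or> \<sigma>\<close> follows by comparison with a second model. The composition rules determine every inner product: it
  is \<open>x ^ m\<close> for the loop value \<open>x\<close> and an exponent \<open>m\<close> that depends on the two words only
  (\<open>form_eq_power\<close>). The same rules hold in the second model, whose vectors are the indicator functions
  of those colourings of the points with two colours that are constant on blocks. There the inner product
  counts the colourings that are constant on the blocks of \<open>\<pi>\<close> and of \<open>\<sigma>\<close>, that is, of \<open>\<pi> \<or> \<sigma>\<close>, so
  it is \<open>2\<close> to the number of blocks of the join. Hence \<open>m\<close> is that number.

  So the determinant is the product of the weights of all closed paths. The exponents of \<open>n\<close> add up
  to \<open>a\<^sub>k\<close>, because \<open>2|\<pi>| - k\<close> is the number of singletons minus the number of points in the interior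
  of a block. The factor \<open>\<nu>\<^bsub>r-1\<^esub>\<close> occurs once for each closed path with a marked rise to height \<open>r\<close>, and
  such paths are as many as the paths from height \<open>2r\<close> down to \<open>0\<close> (\<open>num_rises_closed\<close>). Those paths
  encode the epi of rank \<open>2r\<close> or, since points are doubled, of rank \<open>r\<close> in the case of all noncrossing
  partitions: an epi is read in the same way, starting with one open block for each upper point
  (\<open>bij_betw_words\<close>).\<close>

section \<open>Step words and their contractions\<close>

datatype step = Up | Down | Flat

text \<open>The local pieces out of which closed words are built: a rise directly followed by its descent,
  and a single flat step.\<close>

datatype piece = Arc | Pt

fun shape :: "piece \<Rightarrow> step list" where
  "shape Arc = [Up, Down]"
| "shape Pt = [Flat]"

inductive built :: "bool \<Rightarrow> step list \<Rightarrow> bool" for fl where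
  built_Nil: "built fl []"
| built_insert: "built fl (u @ v) \<Longrightarrow> (p = Pt \<longrightarrow> fl) \<Longrightarrow> built fl (u @ shape p @ v)"

fun path :: "bool \<Rightarrow> nat \<Rightarrow> step list \<Rightarrow> bool" where
  "path fl h [] \<longleftrightarrow> h = 0"
| "path fl h (Up # w) \<longleftrightarrow> path fl (Suc h) w"
| "path fl h (Down # w) \<longleftrightarrow> h \<noteq> 0 \<and> path fl (h - 1) w"
| "path fl h (Flat # w) \<longleftrightarrow> fl \<and> path fl h w"

text \<open>The \<open>h\<close> rises in front are partners for the descents of \<open>w\<close> below its initial height. When \<open>w\<close> is
  read, a rise joins them, a flat step is an inserted piece, and a descent completes the last of them to an
  inserted arc.\<close>

lemma path_imp_built: "path fl h w \<Longrightarrow> built fl (replicate h Up @ w)"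
proof (induction fl h w rule: path.induct)
  case (1 fl h)
  then show ?case by (simp add: built_Nil)
next
  case (2 fl h w)
  then have "built fl (replicate (Suc h) Up @ w)" by simp
  then show ?case by (simp add: replicate_app_Cons_same)
next
  case (3 fl h w)
  then obtain h' where h: "h = Suc h'" by (cases h) auto
  have "built fl (replicate h' Up @ w)" using 3 h by simp
  from built_insert[OF this, of Arc] show ?case
    by (simp add: h replicate_app_Cons_same)
next
  case (4 fl h w)
  then have fl: fl and "built fl (replicate h Up @ w)" by auto
  from built_insert[OF this(2), of Pt] fl show ?case by simp
qed

text \<open>\<open>contracts fl e p i w w' m\<close>: joining the mirror image of the piece \<open>p\<close> to the diagram of \<open>w\<close>,
  starting at position \<open>i\<close>, gives the diagram of \<open>w'\<close> together with a factor \<open>x ^ m\<close>. The rules are the moves of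
  planar diagrams: a closed loop, which may have different values at different positions and
  contributes \<open>x ^ e i\<close>; a zigzag, which is straightened; a leg ending in a point; and two pieces at
  distant places, which do not interact.\<close>

inductive contracts :: "bool \<Rightarrow> (nat \<Rightarrow> nat) \<Rightarrow> piece \<Rightarrow> nat \<Rightarrow> step list \<Rightarrow> step list \<Rightarrow> nat \<Rightarrow> bool"
  for fl e where
  loop: "length u = i \<Longrightarrow> contracts fl e Arc i (u @ shape Arc @ v) (u @ v) (e i)"
| dot: "fl \<Longrightarrow> length u = i \<Longrightarrow> contracts fl e Pt i (u @ shape Pt @ v) (u @ v) 1"
| zigzag_right: "length u = i \<Longrightarrow> contracts fl e Arc (Suc i) (u @ shape Arc @ v) (u @ v) 0"
| zigzag_left: "length u = Suc i \<Longrightarrow> contracts fl e Arc i (u @ shape Arc @ v) (u @ v) 0"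
| arc_dot_left: "fl \<Longrightarrow> length u = i \<Longrightarrow> contracts fl e Pt i (u @ v) w m \<Longrightarrow>
    contracts fl e Arc i (u @ shape Pt @ v) w m"
| arc_dot_right: "fl \<Longrightarrow> length u = Suc i \<Longrightarrow> contracts fl e Pt i (u @ v) w m \<Longrightarrow>
    contracts fl e Arc i (u @ shape Pt @ v) w m"
| dot_arc_left: "fl \<Longrightarrow> length u = i \<Longrightarrow>
    contracts fl e Pt i (u @ shape Arc @ v) (u @ shape Pt @ v) 0"
| dot_arc_right: "fl \<Longrightarrow> length u = i \<Longrightarrow>
    contracts fl e Pt (Suc i) (u @ shape Arc @ v) (u @ shape Pt @ v) 0"
| far_right: "contracts fl e p i (u @ v) (u' @ v') m \<Longrightarrow> length u = length u' \<Longrightarrow> length u \<le> i \<Longrightarrow>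
    contracts fl e p (i + length (shape p')) (u @ shape p' @ v) (u' @ shape p' @ v') m"
| far_left: "contracts fl e p i (u @ v) (u' @ v') m \<Longrightarrow> length u = length u' + length (shape p) \<Longrightarrow>
    i \<le> length u' \<Longrightarrow> contracts fl e p i (u @ shape p' @ v) (u' @ shape p' @ v') m"

text \<open>The word contains some last inserted piece. If the contraction overlaps it, one of the local moves
  applies; otherwise it is carried out in the word without that piece, which is then put back.\<close>

lemma contracts_exists:
  assumes "built fl w" and "p = Pt \<longrightarrow> fl" and "i + length (shape p) \<le> length w"
  shows "\<exists>w' m. contracts fl e p i w w' m \<and> built fl w' \<and>
    length w = length w' + length (shape p)"
  using assms
proof (induction "length w" arbitrary: w p i rule: less_induct)
  case less
  from less.prems(1) show ?case
  proof cases
    case built_Nil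
    then show ?thesis using less.prems(3) by (cases p) auto
  next
    case (built_insert u v p')
    note w = built_insert
    have shorter: "length (u @ v) < length w" using w by (cases p') auto
    note IH = less.hyps[OF shorter w(2)]
    consider (left) "i + length (shape p) \<le> length u" | (right) "length u + length (shape p') \<le> i"
      | (mid) "length u < i + length (shape p)" "i < length u + length (shape p')"
      by linarith
    then show ?thesis
    proof cases
      case left
      then obtain w' m where w': "contracts fl e p i (u @ v) w' m" "built fl w'"
        "length (u @ v) = length w' + length (shape p)"
        using IH[of p i] less.prems by auto
      define j where "j = length u - length (shape p)"
      have "contracts fl e p i (u @ v) (take j w' @ drop j w') m" using w' by simp
      moreover have "length (take j w') = j" using w'(3) left by (simp add: j_def)
      ultimately have "contracts fl e p i w (take j w' @ shape p' @ drop j w') m"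
        unfolding w(1) using left by (intro far_left) (auto simp: j_def)
      moreover have "built fl (take j w' @ shape p' @ drop j w')"
        using w'(2) w(3) by (intro built.built_insert) auto
      moreover have "length w = length (take j w' @ shape p' @ drop j w') + length (shape p)"
        using w w'(3) left by (simp add: j_def)
      ultimately show ?thesis by blast
    next
      case right
      then have "i - length (shape p') + length (shape p) \<le> length (u @ v)"
        using less.prems(3) w(1) by simp
      then obtain w' m where w': "contracts fl e p (i - length (shape p')) (u @ v) w' m" "built fl w'"
        "length (u @ v) = length w' + length (shape p)"
        using IH[of p "i - length (shape p')"] less.prems(2) by blast
      define j where "j = length u"
      have "contracts fl e p (i - length (shape p')) (u @ v) (take j w' @ drop j w') m" using w' by simp
      moreover have "length (take j w') = j" using w'(3) right less.prems(3) w(1) by (simp add: j_def)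
      ultimately have "contracts fl e p (i - length (shape p') + length (shape p')) w
          (take j w' @ shape p' @ drop j w') m"
        unfolding w(1) using right by (intro far_right) (auto simp: j_def)
      then have "contracts fl e p i w (take j w' @ shape p' @ drop j w') m"
        using right by simp
      moreover have "built fl (take j w' @ shape p' @ drop j w')"
        using w'(2) w(3) by (intro built.built_insert) auto
      moreover have "length w = length (take j w' @ shape p' @ drop j w') + length (shape p)"
        using w w'(3) right by (simp add: j_def)
      ultimately show ?thesis by blast
    next
      case mid
      show ?thesis
      proof (cases p; cases p')
        assume p: "p = Arc" "p' = Arc"
        then consider "i = length u" | "i = Suc (length u)" | "length u = Suc i"
          using mid by fastforce
        then show ?thesis
        proof cases
          case 1
          from loop[OF this[symmetric], of fl e v] show ?thesis using w p by auto
        next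
          case 2
          from zigzag_right[OF refl, of fl e u v] show ?thesis using w p 2 by auto
        next
          case 3
          from zigzag_left[OF this, of fl e v] show ?thesis using w p by auto
        qed
      next
        assume p: "p = Arc" "p' = Pt"
        then have fl: fl using w(3) by simp
        obtain w' m where w': "contracts fl e Pt i (u @ v) w' m" "built fl w'"
          "length (u @ v) = length w' + length (shape Pt)"
          using IH[of Pt i] less.prems w(1) p fl by auto
        from p mid consider "i = length u" | "length u = Suc i" by fastforce
        then have "contracts fl e Arc i w w' m"
          using arc_dot_left[OF fl _ w'(1)] arc_dot_right[OF fl _ w'(1)] w(1) p by cases auto
        then show ?thesis using w' w(1) p by auto
      next
        assume p: "p = Pt" "p' = Arc"
        then have fl: fl using less.prems by simp
        have b: "built fl (u @ shape Pt @ v)"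
          using w(2) fl by (intro built.built_insert) auto
        from p mid consider "i = length u" | "i = Suc (length u)" by fastforce
        then have "contracts fl e Pt i w (u @ shape Pt @ v) 0"
          using dot_arc_left[OF fl, of u i e v] dot_arc_right[OF fl, of u _ e v] w(1) p by cases auto
        then show ?thesis using b w(1) p by auto
      next
        assume p: "p = Pt" "p' = Pt"
        then have fl: fl using less.prems by simp
        have "i = length u" using p mid by auto
        then show ?thesis using dot[OF fl, of u i e v] w p by auto
      qed
    qed
  qed
qed

text \<open>\<open>pairs fl e u w m\<close>: the diagram of \<open>w\<close> closed up by the mirror image of the diagram of \<open>u\<close> is
  reduced to the empty diagram, with the total factor \<open>x ^ m\<close>.\<close>

inductive pairs :: "bool \<Rightarrow> (nat \<Rightarrow> nat) \<Rightarrow> step list \<Rightarrow> step list \<Rightarrow> nat \<Rightarrow> bool"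
  for fl e where
  pairs_Nil: "pairs fl e [] [] 0"
| pairs_insert: "contracts fl e p (length u) w w' m \<Longrightarrow> pairs fl e (u @ v) w' m' \<Longrightarrow>
    (p = Pt \<longrightarrow> fl) \<Longrightarrow> pairs fl e (u @ shape p @ v) w (m + m')"

lemma pairs_exists:
  assumes "built fl u" and "built fl w" and "length u = length w"
  shows "\<exists>m. pairs fl e u w m"
  using assms
proof (induction arbitrary: w rule: built.induct)
  case built_Nil
  then show ?case using pairs_Nil by auto
next
  case (built_insert u v p)
  obtain w' m where w': "contracts fl e p (length u) w w' m" "built fl w'"
    "length w = length w' + length (shape p)"
    using contracts_exists[of fl w p "length u" e] built_insert by auto
  moreover obtain m' where "pairs fl e (u @ v) w' m'"
    using built_insert.IH[of w'] w' built_insert.prems by auto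
  ultimately show ?case using pairs_insert built_insert.hyps by blast
qed

lemma contracts_length:
  "contracts fl e p i w w' m \<Longrightarrow> length w = length w' + length (shape p)"
  by (induction rule: contracts.induct) auto

lemma pairs_length: "pairs fl e u w m \<Longrightarrow> length u = length w"
  by (induction rule: pairs.induct) (auto dest: contracts_length)

section \<open>Models of the diagram calculus\<close>

definition tuples :: "'a set \<Rightarrow> nat \<Rightarrow> 'a list set" where
  "tuples A k = {zs. set zs \<subseteq> A \<and> length zs = k}"

lemma finite_tuples: "finite A \<Longrightarrow> finite (tuples A k)"
  unfolding tuples_def by (rule finite_lists_length_eq)

lemma tuples_0 [simp]: "tuples A 0 = {[]}"
  by (auto simp: tuples_def)

lemma sum_tuples_split:
  assumes "finite A"
  shows "(\<Sum>zs\<in>tuples A (i + l + j). F zs) =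
    (\<Sum>zs\<in>tuples A (i + j). \<Sum>bs\<in>tuples A l. F (take i zs @ bs @ drop i zs))"
proof -
  have "(\<Sum>zs\<in>tuples A (i + j). \<Sum>bs\<in>tuples A l. F (take i zs @ bs @ drop i zs)) =
    (\<Sum>(zs, bs)\<in>tuples A (i + j) \<times> tuples A l. F (take i zs @ bs @ drop i zs))"
    by (rule sum.cartesian_product)
  also have "\<dots> = (\<Sum>zs\<in>tuples A (i + l + j). F zs)"
    by (rule sum.reindex_bij_witness[where
        i = "\<lambda>zs. (take i zs @ drop (i + l) zs, take l (drop i zs))" and
        j = "\<lambda>(zs, bs). take i zs @ bs @ drop i zs"])
      (auto simp: tuples_def dest: in_set_takeD in_set_dropD simp flip: append_assoc take_add)
  finally show ?thesis ..
qed

text \<open>A model assigns to every word of steps a function on tuples of labels, by reading both from left to right. The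
  reading has a state \<open>s\<close>, moved by the labels: the height reached in the path model, a colour or
  nothing in the colour models. The two ends of a pair carry opposite labels, with the coefficient
  \<open>c s a\<close> for the label \<open>a\<close> at the left end; a flat step carries the coefficient \<open>f s a\<close>; and tuples are
  weighted by the product of \<open>om s a\<close> over their entries. The last seven assumptions are the moves of
  \<open>contracts\<close> in terms of these local data. They are demanded only for the states in \<open>reach i\<close>, which
  occur after \<open>i\<close> labels of a tuple of nonzero weight.\<close>

locale pairing_model =
  fixes A :: "'a set" and opp :: "'a \<Rightarrow> 'a" and move :: "'s \<Rightarrow> 'a \<Rightarrow> 's" and s0 :: 's
    and c om f :: "'s \<Rightarrow> 'a \<Rightarrow> 'r::idom"
    and x :: 'r and e :: "nat \<Rightarrow> nat" and fl :: bool and reach :: "nat \<Rightarrow> 's set"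
  assumes finite_A: "finite A"
    and opp_in: "a \<in> A \<Longrightarrow> opp a \<in> A" and opp_opp: "opp (opp a) = a"
    and reach_0: "s0 \<in> reach 0"
    and reach_Suc: "s \<in> reach i \<Longrightarrow> a \<in> A \<Longrightarrow> om s a \<noteq> 0 \<Longrightarrow> move s a \<in> reach (Suc i)"
    and retrace: "c s a \<noteq> 0 \<Longrightarrow> move (move s a) (opp a) = s"
    and stay: "f s a \<noteq> 0 \<Longrightarrow> move s a = s"
    and loop_value: "s \<in> reach i \<Longrightarrow>
      (\<Sum>a\<in>A. c s a * c s a * om s a * om (move s a) (opp a)) = x ^ e i"
    and zigzag_value: "s \<in> reach i \<Longrightarrow> a \<in> A \<Longrightarrow> om s a \<noteq> 0 \<Longrightarrow>
      c s a * c (move s a) (opp a) * om s a * om (move s a) (opp a) = 1"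
    and dot_value: "fl \<Longrightarrow> s \<in> reach i \<Longrightarrow> (\<Sum>a\<in>A. f s a * f s a * om s a) = x"
    and arc_dot_left_value: "fl \<Longrightarrow> s \<in> reach i \<Longrightarrow> a \<in> A \<Longrightarrow>
      c s (opp a) * om s (opp a) * om (move s (opp a)) a * f s (opp a) = f s a * om s a"
    and arc_dot_right_value: "fl \<Longrightarrow> s \<in> reach i \<Longrightarrow> a \<in> A \<Longrightarrow>
      c s a * om s a * om (move s a) (opp a) * f (move s a) (opp a) = f s a * om s a"
    and dot_arc_left_value: "fl \<Longrightarrow> s \<in> reach i \<Longrightarrow> a \<in> A \<Longrightarrow>
      f s (opp a) * om s (opp a) * c s (opp a) = f s a"
    and dot_arc_right_value: "fl \<Longrightarrow> s \<in> reach i \<Longrightarrow> a \<in> A \<Longrightarrow> om s a \<noteq> 0 \<Longrightarrow>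
      f (move s a) (opp a) * om (move s a) (opp a) * c s a = f s a"
begin

text \<open>The list \<open>st\<close> is a stack of the labels that are due at the right ends of the pairs still open.\<close>

fun vec :: "'s \<Rightarrow> 'a list \<Rightarrow> step list \<Rightarrow> 'a list \<Rightarrow> 'r" where
  "vec s st [] [] = (if st = [] then 1 else 0)"
| "vec s st (Up # w) (a # zs) = c s a * vec (move s a) (opp a # st) w zs"
| "vec s (b # st) (Down # w) (a # zs) = (if a = b then vec (move s a) st w zs else 0)"
| "vec s [] (Down # w) (a # zs) = 0"
| "vec s st (Flat # w) (a # zs) = f s a * vec (move s a) st w zs"
| "vec s st (l # w) [] = 0"
| "vec s st [] (a # zs) = 0"

lemma vec_Down_Nil [simp]: "vec s [] (Down # w) zs = 0"
  by (cases zs) auto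

lemma vec_no_values: "vec s st w [] = (if w = [] \<and> st = [] then 1 else 0)"
  by (cases w) auto

fun om_list :: "'s \<Rightarrow> 'a list \<Rightarrow> 'r" where
  "om_list s [] = 1"
| "om_list s (a # zs) = om s a * om_list (move s a) zs"

text \<open>The condition that the state returns to \<open>s0\<close> restricts the sum over all label tuples to closed
  ones.\<close>

definition weight :: "'a list \<Rightarrow> 'r" where
  "weight zs = om_list s0 zs * (if foldl move s0 zs = s0 then 1 else 0)"

fun coef :: "piece \<Rightarrow> 's \<Rightarrow> 'a list \<Rightarrow> 'r" where
  "coef Arc s [a, b] = (if b = opp a then c s a else 0)"
| "coef Pt s [a] = f s a"
| "coef p s bs = 0"

lemma om_list_append: "om_list s (xs @ ys) = om_list s xs * om_list (foldl move s xs) ys"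
  by (induction xs arbitrary: s) (auto simp: mult.assoc)

lemma coef_back: "coef p s bs \<noteq> 0 \<Longrightarrow> foldl move s bs = s"
  by (induction p s bs rule: coef.induct) (auto simp: retrace stay split: if_splits)

lemma coef_length: "coef p s bs \<noteq> 0 \<Longrightarrow> length bs = length (shape p)"
  by (induction p s bs rule: coef.induct) auto

text \<open>Vectors are built from local factors: a piece inserted into a word only sees the labels at its
  own positions and the state there, because it leaves the stack as it was and, unless its coefficient
  vanishes, also the state.\<close>

lemma vec_insert:
  assumes "length u = length xs" and "length bs = length (shape p)"
  shows "vec s st (u @ shape p @ v) (xs @ bs @ ys) =
    coef p (foldl move s xs) bs * vec s st (u @ v) (xs @ ys)"
  using assms
proof (induction u xs arbitrary: s st rule: list_induct2)
  case Nil
  show ?case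
  proof (cases p)
    case Arc
    then obtain a b where "bs = [a, b]" using Nil by (auto simp: length_Suc_conv)
    then show ?thesis using Arc retrace[of "foldl move s []" a] by (cases "c s a = 0") auto
  next
    case Pt
    then obtain a where "bs = [a]" using Nil by (auto simp: length_Suc_conv)
    then show ?thesis using Pt stay by (cases "f s a = 0") auto
  qed
next
  case (Cons l u a xs)
  then show ?case
    by (cases l; cases st) auto
qed

lemma vec_insert_cancel:
  assumes "weight (xs @ bs @ ys) \<noteq> 0" and "coef p (foldl move s0 xs) bs \<noteq> 0"
  shows "weight (xs @ ys) \<noteq> 0"
  using assms(1) coef_back[OF assms(2)]
  by (auto simp: weight_def om_list_append split: if_splits)

lemma weight_insert:
  assumes "coef p (foldl move s0 xs) bs \<noteq> 0"
  shows "weight (xs @ bs @ ys) = om_list (foldl move s0 xs) bs * weight (xs @ ys)"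
  using coef_back[OF assms] by (simp add: weight_def om_list_append)

lemma reach_foldl:
  "s \<in> reach i \<Longrightarrow> set xs \<subseteq> A \<Longrightarrow> om_list s xs \<noteq> 0 \<Longrightarrow> foldl move s xs \<in> reach (i + length xs)"
proof (induction xs arbitrary: s i)
  case (Cons a xs)
  then have "move s a \<in> reach (Suc i)" using reach_Suc[of s i a] by auto
  from Cons.IH[OF this] Cons.prems show ?case by auto
qed simp

lemma reach_prefix:
  assumes "set (xs @ ys) \<subseteq> A" and "weight (xs @ ys) \<noteq> 0"
  shows "foldl move s0 xs \<in> reach (length xs)"
  using reach_foldl[OF reach_0, of xs] assms by (auto simp: weight_def om_list_append)

text \<open>The adjoint, for the weighted inner product, of inserting the piece \<open>p\<close> between \<open>xs\<close> and \<open>ys\<close>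
  (see \<open>form_insert\<close>).\<close>

definition contraction :: "piece \<Rightarrow> step list \<Rightarrow> 'a list \<Rightarrow> 'a list \<Rightarrow> 'r" where
  "contraction p w xs ys = (\<Sum>bs\<in>tuples A (length (shape p)).
     coef p (foldl move s0 xs) bs * om_list (foldl move s0 xs) bs * vec s0 [] w (xs @ bs @ ys))"

lemma contraction_Arc:
  "contraction Arc w xs ys = (\<Sum>a\<in>A. c (foldl move s0 xs) a * (om (foldl move s0 xs) a *
     om (move (foldl move s0 xs) a) (opp a)) * vec s0 [] w (xs @ a # opp a # ys))"
proof -
  have "contraction Arc w xs ys = (\<Sum>bs\<in>(\<lambda>a. [a, opp a]) ` A.
     coef Arc (foldl move s0 xs) bs * om_list (foldl move s0 xs) bs * vec s0 [] w (xs @ bs @ ys))"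
    unfolding contraction_def
  proof (rule sum.mono_neutral_right)
    show "\<forall>bs\<in>tuples A (length (shape Arc)) - (\<lambda>a. [a, opp a]) ` A.
       coef Arc (foldl move s0 xs) bs * om_list (foldl move s0 xs) bs * vec s0 [] w (xs @ bs @ ys) = 0"
    proof
      fix bs assume bs: "bs \<in> tuples A (length (shape Arc)) - (\<lambda>a. [a, opp a]) ` A"
      then obtain a b where "bs = [a, b]" "a \<in> A" "b \<in> A"
        by (auto simp: tuples_def length_Suc_conv)
      then show "coef Arc (foldl move s0 xs) bs * om_list (foldl move s0 xs) bs * vec s0 [] w (xs @ bs @ ys) = 0"
        using bs by auto
    qed
  qed (use finite_tuples[OF finite_A, of 2] opp_in in \<open>auto simp: tuples_def numeral_2_eq_2\<close>)
  also have "\<dots> = (\<Sum>a\<in>A. c (foldl move s0 xs) a * (om (foldl move s0 xs) a *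
     om (move (foldl move s0 xs) a) (opp a)) * vec s0 [] w (xs @ a # opp a # ys))"
    by (subst sum.reindex) (auto simp: inj_on_def)
  finally show ?thesis .
qed

lemma contraction_Pt:
  "contraction Pt w xs ys =
    (\<Sum>a\<in>A. f (foldl move s0 xs) a * om (foldl move s0 xs) a * vec s0 [] w (xs @ a # ys))"
proof -
  have "tuples A (length (shape Pt)) = (\<lambda>a. [a]) ` A"
    by (auto simp: tuples_def length_Suc_conv)
  then show ?thesis
    unfolding contraction_def by (simp add: sum.reindex inj_on_def)
qed

text \<open>In each local move the label sum collapses: the overlap of the contracted piece with the piece in
  the word forces a label, or leaves exactly the sum evaluated by one of the assumptions of the model. In the two
  distant cases the coefficient of the other piece factors out; if it is nonzero, removing the labels of that
  piece changes neither the state nor whether the weight vanishes.\<close>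

lemma contracts_sound:
  assumes "contracts fl e p i w w' m" and "length xs = i" and "length w' = length (xs @ ys)"
    and "set (xs @ ys) \<subseteq> A" and "weight (xs @ ys) \<noteq> 0"
  shows "contraction p w xs ys = x ^ m * vec s0 [] w' (xs @ ys)"
  using assms
proof (induction arbitrary: xs ys rule: contracts.induct)
  case (loop u i v)
  let ?s = "foldl move s0 xs"
  have s: "?s \<in> reach i" using reach_prefix[of xs ys] loop by auto
  have v: "vec s0 [] (u @ shape Arc @ v) (xs @ a # opp a # ys) = c ?s a * vec s0 [] (u @ v) (xs @ ys)" for a
    using vec_insert[of u xs "[a, opp a]" Arc s0 "[]" v ys] loop by simp
  have "contraction Arc (u @ shape Arc @ v) xs ys =
    (\<Sum>a\<in>A. c ?s a * c ?s a * om ?s a * om (move ?s a) (opp a)) * vec s0 [] (u @ v) (xs @ ys)"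
    unfolding contraction_Arc v sum_distrib_right by (intro sum.cong) (auto simp: algebra_simps)
  then show ?case by (simp only: loop_value[OF s])
next
  case (dot u i v)
  let ?s = "foldl move s0 xs"
  have s: "?s \<in> reach i" using reach_prefix[of xs ys] dot by auto
  have v: "vec s0 [] (u @ shape Pt @ v) (xs @ a # ys) = f ?s a * vec s0 [] (u @ v) (xs @ ys)" for a
    using vec_insert[of u xs "[a]" Pt s0 "[]" v ys] dot by simp
  have "contraction Pt (u @ shape Pt @ v) xs ys =
    (\<Sum>a\<in>A. f ?s a * f ?s a * om ?s a) * vec s0 [] (u @ v) (xs @ ys)"
    unfolding contraction_Pt v sum_distrib_right by (intro sum.cong) (auto simp: algebra_simps)
  then show ?case by (simp only: dot_value[OF dot(1) s] power_one_right)
next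
  case (zigzag_right u i v)
  then obtain xs' y where xs: "xs = xs' @ [y]" by (cases xs rule: rev_cases) auto
  let ?s = "foldl move s0 xs'"
  have s: "?s \<in> reach i" using reach_prefix[of xs' "y # ys"] zigzag_right xs by auto
  have y: "y \<in> A" "om ?s y \<noteq> 0" using zigzag_right xs by (auto simp: weight_def om_list_append)
  have v: "vec s0 [] (u @ shape Arc @ v) (xs @ a # opp a # ys) =
      (if a = opp y then c ?s y * vec s0 [] (u @ v) (xs' @ opp a # ys) else 0)" for a
    using vec_insert[of u xs' "[y, a]" Arc s0 "[]" v "opp a # ys"] zigzag_right xs by simp
  have "contraction Arc (u @ shape Arc @ v) xs ys =
    (\<Sum>a\<in>A. if a = opp y then c (move ?s y) (opp y) * (om (move ?s y) (opp y) *
       om (move (move ?s y) (opp y)) y) * (c ?s y * vec s0 [] (u @ v) (xs' @ y # ys)) else 0)"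
    unfolding contraction_Arc v by (intro sum.cong) (auto simp: xs opp_opp)
  also have "\<dots> = c (move ?s y) (opp y) * (om (move ?s y) (opp y) *
       om (move (move ?s y) (opp y)) y) * (c ?s y * vec s0 [] (u @ v) (xs' @ y # ys))"
    using finite_A opp_in[OF y(1)] by simp
  also have "\<dots> = (c ?s y * c (move ?s y) (opp y) * om ?s y * om (move ?s y) (opp y)) *
      vec s0 [] (u @ v) (xs' @ y # ys)"
    by (cases "c ?s y = 0") (auto simp: retrace algebra_simps)
  also have "\<dots> = vec s0 [] (u @ v) (xs' @ y # ys)"
    by (simp only: zigzag_value[OF s y] mult_1)
  finally show ?case by (simp add: xs)
next
  case (zigzag_left u i v)
  then obtain y ys' where ys: "ys = y # ys'" by (cases ys) auto
  let ?s = "foldl move s0 xs"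
  have s: "?s \<in> reach i" using reach_prefix[of xs ys] zigzag_left by auto
  have y: "y \<in> A" "om ?s y \<noteq> 0" using zigzag_left ys by (auto simp: weight_def om_list_append)
  have v: "vec s0 [] (u @ shape Arc @ v) (xs @ a # opp a # ys) =
      (if y = a then c (move ?s a) (opp a) * vec s0 [] (u @ v) (xs @ a # ys') else 0)" for a
    using vec_insert[of u "xs @ [a]" "[opp a, y]" Arc s0 "[]" v ys'] zigzag_left ys
    by (simp add: opp_opp)
  have "contraction Arc (u @ shape Arc @ v) xs ys =
    (\<Sum>a\<in>A. if y = a then (c ?s y * c (move ?s y) (opp y) * om ?s y * om (move ?s y) (opp y)) *
      vec s0 [] (u @ v) (xs @ y # ys') else 0)"
    unfolding contraction_Arc v by (intro sum.cong) (auto simp: algebra_simps)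
  also have "\<dots> = (c ?s y * c (move ?s y) (opp y) * om ?s y * om (move ?s y) (opp y)) *
      vec s0 [] (u @ v) (xs @ y # ys')"
    using finite_A y(1) by simp
  also have "\<dots> = vec s0 [] (u @ v) (xs @ y # ys')"
    by (simp only: zigzag_value[OF s y] mult_1)
  finally show ?case by (simp add: ys)
next
  case (arc_dot_left u i v w m)
  let ?s = "foldl move s0 xs"
  have s: "?s \<in> reach i" using reach_prefix[of xs ys] arc_dot_left by auto
  have v: "vec s0 [] (u @ shape Pt @ v) (xs @ a # opp a # ys) =
      f ?s a * vec s0 [] (u @ v) (xs @ opp a # ys)" for a
    using vec_insert[of u xs "[a]" Pt s0 "[]" v "opp a # ys"] arc_dot_left by simp
  have "contraction Arc (u @ shape Pt @ v) xs ys =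
    (\<Sum>a\<in>A. (\<lambda>b. c ?s (opp b) * om ?s (opp b) * om (move ?s (opp b)) b * f ?s (opp b) *
       vec s0 [] (u @ v) (xs @ b # ys)) (opp a))"
    unfolding contraction_Arc v by (intro sum.cong) (auto simp: opp_opp algebra_simps)
  also have "\<dots> = (\<Sum>b\<in>A. c ?s (opp b) * om ?s (opp b) * om (move ?s (opp b)) b * f ?s (opp b) *
       vec s0 [] (u @ v) (xs @ b # ys))"
    by (rule sum.reindex_bij_witness[of _ opp opp]) (auto simp: opp_opp opp_in)
  also have "\<dots> = contraction Pt (u @ v) xs ys"
    unfolding contraction_Pt using arc_dot_left_value[OF arc_dot_left(1) s]
    by (intro sum.cong) auto
  also have "\<dots> = x ^ m * vec s0 [] w (xs @ ys)"
    using arc_dot_left by auto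
  finally show ?case .
next
  case (arc_dot_right u i v w m)
  let ?s = "foldl move s0 xs"
  have s: "?s \<in> reach i" using reach_prefix[of xs ys] arc_dot_right by auto
  have v: "vec s0 [] (u @ shape Pt @ v) (xs @ a # opp a # ys) =
      f (move ?s a) (opp a) * vec s0 [] (u @ v) (xs @ a # ys)" for a
    using vec_insert[of u "xs @ [a]" "[opp a]" Pt s0 "[]" v "ys"] arc_dot_right by simp
  have "contraction Arc (u @ shape Pt @ v) xs ys =
    (\<Sum>a\<in>A. c ?s a * om ?s a * om (move ?s a) (opp a) * f (move ?s a) (opp a) *
       vec s0 [] (u @ v) (xs @ a # ys))"
    unfolding contraction_Arc v by (intro sum.cong) (auto simp: algebra_simps)
  also have "\<dots> = contraction Pt (u @ v) xs ys"
    unfolding contraction_Pt using arc_dot_right_value[OF arc_dot_right(1) s]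
    by (intro sum.cong) auto
  also have "\<dots> = x ^ m * vec s0 [] w (xs @ ys)"
    using arc_dot_right by auto
  finally show ?case .
next
  case (dot_arc_left u i v)
  then obtain y ys' where ys: "ys = y # ys'" by (cases ys) auto
  let ?s = "foldl move s0 xs"
  have s: "?s \<in> reach i" using reach_prefix[of xs ys] dot_arc_left by auto
  have y: "y \<in> A" using dot_arc_left ys by auto
  have v: "vec s0 [] (u @ shape Arc @ v) (xs @ a # ys) =
      (if a = opp y then c ?s a * vec s0 [] (u @ v) (xs @ ys') else 0)" for a
    using vec_insert[of u xs "[a, y]" Arc s0 "[]" v ys'] dot_arc_left ys opp_opp by auto
  have "contraction Pt (u @ shape Arc @ v) xs ys =
    (\<Sum>a\<in>A. if a = opp y then (f ?s (opp y) * om ?s (opp y) * c ?s (opp y)) *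
      vec s0 [] (u @ v) (xs @ ys') else 0)"
    unfolding contraction_Pt v by (intro sum.cong) (auto simp: algebra_simps)
  also have "\<dots> = (f ?s (opp y) * om ?s (opp y) * c ?s (opp y)) * vec s0 [] (u @ v) (xs @ ys')"
    using finite_A opp_in[OF y] by simp
  also have "\<dots> = f ?s y * vec s0 [] (u @ v) (xs @ ys')"
    by (simp only: dot_arc_left_value[OF dot_arc_left(1) s y])
  also have "\<dots> = vec s0 [] (u @ shape Pt @ v) (xs @ ys)"
    using vec_insert[of u xs "[y]" Pt s0 "[]" v ys'] dot_arc_left ys by simp
  finally show ?case by simp
next
  case (dot_arc_right u i v)
  then obtain xs' y where xs: "xs = xs' @ [y]" by (cases xs rule: rev_cases) auto
  let ?s = "foldl move s0 xs'"
  have s: "?s \<in> reach i" using reach_prefix[of xs' "y # ys"] dot_arc_right xs by auto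
  have y: "y \<in> A" "om ?s y \<noteq> 0" using dot_arc_right xs by (auto simp: weight_def om_list_append)
  have v: "vec s0 [] (u @ shape Arc @ v) (xs @ a # ys) =
      (if a = opp y then c ?s y * vec s0 [] (u @ v) (xs' @ ys) else 0)" for a
    using vec_insert[of u xs' "[y, a]" Arc s0 "[]" v "ys"] dot_arc_right xs by simp
  have "contraction Pt (u @ shape Arc @ v) xs ys =
    (\<Sum>a\<in>A. if a = opp y then (f (move ?s y) (opp y) * om (move ?s y) (opp y) * c ?s y) *
       vec s0 [] (u @ v) (xs' @ ys) else 0)"
    unfolding contraction_Pt v by (intro sum.cong) (auto simp: xs)
  also have "\<dots> = (f (move ?s y) (opp y) * om (move ?s y) (opp y) * c ?s y) *
       vec s0 [] (u @ v) (xs' @ ys)"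
    using finite_A opp_in[OF y(1)] by simp
  also have "\<dots> = f ?s y * vec s0 [] (u @ v) (xs' @ ys)"
    by (simp only: dot_arc_right_value[OF dot_arc_right(1) s y])
  also have "\<dots> = vec s0 [] (u @ shape Pt @ v) (xs @ ys)"
    using vec_insert[of u xs' "[y]" Pt s0 "[]" v ys] dot_arc_right xs by simp
  finally show ?case by simp
next
  case (far_right p i u v u' v' m p')
  define xs1 cs xs2 where "xs1 = take (length u) xs" and "cs = take (length (shape p')) (drop (length u) xs)"
    and "xs2 = drop (length (shape p')) (drop (length u) xs)"
  have xs: "xs = xs1 @ cs @ xs2" unfolding xs1_def cs_def xs2_def by (simp only: append_take_drop_id)
  have l: "length xs1 = length u" "length cs = length (shape p')" "length xs2 = i - length u"
    using far_right by (auto simp: xs1_def cs_def xs2_def)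
  let ?s = "foldl move s0 xs1"
  have v: "vec s0 [] (u @ shape p' @ v) (xs @ bs @ ys) =
      coef p' ?s cs * vec s0 [] (u @ v) ((xs1 @ xs2) @ bs @ ys)" for bs
    using vec_insert[of u xs1 cs p' s0 "[]" v "xs2 @ bs @ ys"] l xs by simp
  have v': "vec s0 [] (u' @ shape p' @ v') (xs @ ys) =
      coef p' ?s cs * vec s0 [] (u' @ v') ((xs1 @ xs2) @ ys)"
    using vec_insert[of u' xs1 cs p' s0 "[]" v' "xs2 @ ys"] l xs far_right by simp
  show ?case
  proof (cases "coef p' ?s cs = 0")
    case True
    then show ?thesis unfolding contraction_def v v' by simp
  next
    case False
    have st: "foldl move s0 xs = foldl move s0 (xs1 @ xs2)"
      using coef_back[OF False] by (simp add: xs)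
    have "weight ((xs1 @ xs2) @ ys) \<noteq> 0"
      using vec_insert_cancel[OF _ False, of "xs2 @ ys"] far_right.prems xs by simp
    then have "contraction p (u @ v) (xs1 @ xs2) ys = x ^ m * vec s0 [] (u' @ v') ((xs1 @ xs2) @ ys)"
      using far_right l by (intro far_right.IH) (auto simp: xs)
    moreover have "contraction p (u @ shape p' @ v) xs ys =
        coef p' ?s cs * contraction p (u @ v) (xs1 @ xs2) ys"
      unfolding contraction_def v st sum_distrib_left by (simp add: algebra_simps)
    ultimately show ?thesis unfolding v' by simp
  qed
next
  case (far_left p i u v u' v' m p')
  define j where "j = length u' - i"
  define ys1 cs ys2 where "ys1 = take j ys" and "cs = take (length (shape p')) (drop j ys)"
    and "ys2 = drop (length (shape p')) (drop j ys)"
  have ys: "ys = ys1 @ cs @ ys2" unfolding ys1_def cs_def ys2_def by (simp only: append_take_drop_id)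
  have l: "length ys1 = j" "length cs = length (shape p')" "length ys2 = length v'"
    using far_left by (auto simp: ys1_def cs_def ys2_def j_def)
  let ?s = "foldl move s0 (xs @ ys1)"
  have v: "coef p (foldl move s0 xs) bs * om_list (foldl move s0 xs) bs *
      vec s0 [] (u @ shape p' @ v) (xs @ bs @ ys) =
      coef p' ?s cs * (coef p (foldl move s0 xs) bs * om_list (foldl move s0 xs) bs *
      vec s0 [] (u @ v) (xs @ bs @ ys1 @ ys2))"
    for bs
  proof (cases "coef p (foldl move s0 xs) bs = 0")
    case False
    then have "foldl move s0 (xs @ bs @ ys1) = ?s" using coef_back by simp
    then show ?thesis
      using vec_insert[of u "xs @ bs @ ys1" cs p' s0 "[]" v ys2] l ys far_left coef_length[OF False]
      by (simp add: j_def)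
  qed auto
  have v': "vec s0 [] (u' @ shape p' @ v') (xs @ ys) =
      coef p' ?s cs * vec s0 [] (u' @ v') (xs @ ys1 @ ys2)"
    using vec_insert[of u' "xs @ ys1" cs p' s0 "[]" v' "ys2"] l ys far_left by (simp add: j_def)
  have e: "contraction p (u @ shape p' @ v) xs ys =
        coef p' ?s cs * contraction p (u @ v) xs (ys1 @ ys2)"
    unfolding contraction_def v sum_distrib_left ..
  show ?case
  proof (cases "coef p' ?s cs = 0")
    case True
    then show ?thesis unfolding e v' by simp
  next
    case False
    have "weight (xs @ ys1 @ ys2) \<noteq> 0"
      using vec_insert_cancel[OF _ False, of "ys2"] far_left.prems ys by simp
    then have "contraction p (u @ v) xs (ys1 @ ys2) = x ^ m * vec s0 [] (u' @ v') (xs @ ys1 @ ys2)"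
      using far_left l by (intro far_left.IH) (auto simp: ys j_def)
    then show ?thesis unfolding e v' by simp
  qed
qed

definition form :: "step list \<Rightarrow> step list \<Rightarrow> 'r" where
  "form u w = (\<Sum>zs\<in>tuples A (length u). weight zs * vec s0 [] u zs * vec s0 [] w zs)"

lemma form_insert:
  "form (u @ shape p @ v) w =
    (\<Sum>zs\<in>tuples A (length (u @ v)). weight zs * vec s0 [] (u @ v) zs *
       contraction p w (take (length u) zs) (drop (length u) zs))"
proof -
  let ?i = "length u" and ?l = "length (shape p)"
  have "form (u @ shape p @ v) w = (\<Sum>zs\<in>tuples A (?i + ?l + length v).
      weight zs * vec s0 [] (u @ shape p @ v) zs * vec s0 [] w zs)"
    by (simp add: form_def add.assoc)
  also have "\<dots> = (\<Sum>zs\<in>tuples A (?i + length v). \<Sum>bs\<in>tuples A ?l.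
      weight (take ?i zs @ bs @ drop ?i zs) *
      vec s0 [] (u @ shape p @ v) (take ?i zs @ bs @ drop ?i zs) *
      vec s0 [] w (take ?i zs @ bs @ drop ?i zs))"
    by (rule sum_tuples_split[OF finite_A])
  also have "\<dots> = (\<Sum>zs\<in>tuples A (?i + length v). weight zs * vec s0 [] (u @ v) zs *
       contraction p w (take ?i zs) (drop ?i zs))"
    unfolding contraction_def sum_distrib_left
  proof (intro sum.cong refl)
    fix zs bs assume *: "zs \<in> tuples A (?i + length v)" "bs \<in> tuples A ?l"
    let ?s = "foldl move s0 (take ?i zs)"
    have v: "vec s0 [] (u @ shape p @ v) (take ?i zs @ bs @ drop ?i zs) =
        coef p ?s bs * vec s0 [] (u @ v) zs"
      using vec_insert[of u "take ?i zs" bs p s0 "[]" v "drop ?i zs"] * by (simp add: tuples_def)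
    show "weight (take ?i zs @ bs @ drop ?i zs) *
      vec s0 [] (u @ shape p @ v) (take ?i zs @ bs @ drop ?i zs) *
      vec s0 [] w (take ?i zs @ bs @ drop ?i zs) =
      weight zs * vec s0 [] (u @ v) zs * (coef p ?s bs * om_list ?s bs *
         vec s0 [] w (take ?i zs @ bs @ drop ?i zs))"
      unfolding v using weight_insert[of p "take ?i zs" bs "drop ?i zs"]
      by (cases "coef p ?s bs = 0") (simp_all only: append_take_drop_id mult_ac mult_zero_left mult_zero_right simp_thms)
  qed
  finally show ?thesis by simp
qed

text \<open>Since \<open>m\<close> does not depend on the model, an inner product in a model with \<open>x = 2\<close> reveals it for all
  models.\<close>

theorem form_eq_power: "pairs fl e u w m \<Longrightarrow> form u w = x ^ m"
proof (induction rule: pairs.induct)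
  case pairs_Nil
  show ?case by (simp add: form_def weight_def)
next
  case (pairs_insert p u w w' m v m')
  have l: "length (u @ v) = length w'" by (rule pairs_length[OF pairs_insert(2)])
  have "form (u @ shape p @ v) w = (\<Sum>zs\<in>tuples A (length (u @ v)). weight zs * vec s0 [] (u @ v) zs *
       (x ^ m * vec s0 [] w' zs))"
    unfolding form_insert
  proof (intro sum.cong refl)
    fix zs assume zs: "zs \<in> tuples A (length (u @ v))"
    show "weight zs * vec s0 [] (u @ v) zs * contraction p w (take (length u) zs) (drop (length u) zs) =
      weight zs * vec s0 [] (u @ v) zs * (x ^ m * vec s0 [] w' zs)"
    proof (cases "weight zs = 0")
      case False
      have "length (take (length u) zs) = length u" "set zs \<subseteq> A" "length w' = length zs"
        using zs l by (auto simp: tuples_def)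
      with False have "contraction p w (take (length u) zs) (drop (length u) zs) =
          x ^ m * vec s0 [] w' (take (length u) zs @ drop (length u) zs)"
        by (intro contracts_sound[OF pairs_insert(1)]) (simp_all only: append_take_drop_id simp_thms)
      then show ?thesis by (simp only: append_take_drop_id)
    qed simp
  qed
  also have "\<dots> = x ^ m * form (u @ v) w'"
    by (simp only: form_def sum_distrib_left mult_ac)
  finally show ?case using pairs_insert by (simp add: power_add)
qed

end


section \<open>The path model\<close>

fun opp_step :: "step \<Rightarrow> step" where
  "opp_step Up = Down" | "opp_step Down = Up" | "opp_step Flat = Flat"

fun move_step :: "nat \<Rightarrow> step \<Rightarrow> nat" where
  "move_step h Up = Suc h" | "move_step h Down = h - 1" | "move_step h Flat = h"

definition steps :: "bool \<Rightarrow> step set" where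
  "steps fl = (if fl then {Up, Down, Flat} else {Up, Down})"

definition paths :: "bool \<Rightarrow> nat \<Rightarrow> nat \<Rightarrow> step list set" where
  "paths fl k h = {w. length w = k \<and> path fl h w}"

lemma path_steps: "path fl h p \<Longrightarrow> set p \<subseteq> steps fl"
  by (induction fl h p rule: path.induct) (auto simp: steps_def)

text \<open>Reads a word as a binary number in which the rises are the digits \<open>1\<close>.\<close>

fun up_code :: "step list \<Rightarrow> nat" where
  "up_code [] = 0"
| "up_code (a # w) = (if a = Up then 2 ^ length w else 0) + up_code w"

lemma up_code_less: "up_code w < 2 ^ length w"
  by (induction w) auto

text \<open>Here the labels are steps themselves and the state is the height. The recurrence for the weights \<open>\<nu> h\<close>
  of rises says that a loop inserted at height \<open>h\<close> has the value \<open>x ^ e i\<close>: its left step is a rise,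
  a descent or a flat step, which gives the three summands. The sets \<open>reach\<close> allow the loop value to
  depend on the parity of the height.\<close>

locale path_model =
  fixes \<nu> :: "nat \<Rightarrow> 'r::field" and x :: 'r and e :: "nat \<Rightarrow> nat" and fl :: bool
    and reach :: "nat \<Rightarrow> nat set"
  assumes x_nz: "x \<noteq> 0" and \<nu>_nz: "\<nu> h \<noteq> 0"
    and reach_zero: "0 \<in> reach 0"
    and reach_up: "h \<in> reach i \<Longrightarrow> Suc h \<in> reach (Suc i)"
    and reach_down: "h \<in> reach i \<Longrightarrow> h \<noteq> 0 \<Longrightarrow> h - 1 \<in> reach (Suc i)"
    and reach_flat: "fl \<Longrightarrow> h \<in> reach i \<Longrightarrow> h \<in> reach (Suc i)"
    and recurrence: "h \<in> reach i \<Longrightarrow>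
      \<nu> h + (if h = 0 then 0 else 1 / \<nu> (h - 1)) + (if fl then 1 else 0) = x ^ e i"
begin

text \<open>The coefficient of a pair whose left step is a descent from height \<open>h\<close> must be \<open>1 / \<nu> (h - 1)\<close>
  in order that a zigzag along the edge between \<open>h - 1\<close> and \<open>h\<close> has the value \<open>1\<close>. At height \<open>0\<close> it vanishes, which
  keeps the path from becoming negative.\<close>

fun turn :: "nat \<Rightarrow> step \<Rightarrow> 'r" where
  "turn h Up = 1" | "turn h Down = (if h = 0 then 0 else 1 / \<nu> (h - 1))" | "turn h Flat = 1 / x"

fun step_weight :: "nat \<Rightarrow> step \<Rightarrow> 'r" where
  "step_weight h Up = \<nu> h" | "step_weight h Down = (if h = 0 then 0 else 1)" | "step_weight h Flat = x"

fun is_flat :: "nat \<Rightarrow> step \<Rightarrow> 'r" where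
  "is_flat h Up = 0" | "is_flat h Down = 0" | "is_flat h Flat = 1"

sublocale pairing_model "steps fl" opp_step move_step 0 turn step_weight is_flat x e fl reach
proof
  show "finite (steps fl)" by (simp add: steps_def)
  show "opp_step a \<in> steps fl" if "a \<in> steps fl" for a
    using that by (cases a) (auto simp: steps_def split: if_splits)
  show "opp_step (opp_step a) = a" for a by (cases a) auto
  show "0 \<in> reach 0" by (rule reach_zero)
  show "move_step s a \<in> reach (Suc i)" if "s \<in> reach i" "a \<in> steps fl" "step_weight s a \<noteq> 0" for s i a
    using that reach_up reach_down reach_flat
    by (cases a) (auto simp: steps_def split: if_splits)
  show "move_step (move_step s a) (opp_step a) = s" if "turn s a \<noteq> 0" for s a
    using that by (cases a) (auto split: if_splits)
  show "move_step s a = s" if "is_flat s a \<noteq> 0" for s a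
    using that by (cases a) auto
  show "(\<Sum>a\<in>steps fl. turn s a * turn s a * step_weight s a * step_weight (move_step s a) (opp_step a)) = x ^ e i"
    if "s \<in> reach i" for s i
    using recurrence[OF that] x_nz \<nu>_nz by (auto simp: steps_def field_simps)
  show "turn s a * turn (move_step s a) (opp_step a) * step_weight s a *
      step_weight (move_step s a) (opp_step a) = 1"
    if "s \<in> reach i" "a \<in> steps fl" "step_weight s a \<noteq> 0" for s i a
    using that x_nz \<nu>_nz by (cases a) (auto split: if_splits)
  show "(\<Sum>a\<in>steps fl. is_flat s a * is_flat s a * step_weight s a) = x" if fl for s
    using that by (auto simp: steps_def)
  show "turn s (opp_step a) * step_weight s (opp_step a) * step_weight (move_step s (opp_step a)) a *
      is_flat s (opp_step a) = is_flat s a * step_weight s a" for s a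
    using x_nz by (cases a) auto
  show "turn s a * step_weight s a * step_weight (move_step s a) (opp_step a) *
      is_flat (move_step s a) (opp_step a) = is_flat s a * step_weight s a" for s a
    using x_nz by (cases a) auto
  show "is_flat s (opp_step a) * step_weight s (opp_step a) * turn s (opp_step a) = is_flat s a" for s a
    using x_nz by (cases a) auto
  show "is_flat (move_step s a) (opp_step a) * step_weight (move_step s a) (opp_step a) * turn s a =
      is_flat s a" for s a
    using x_nz by (cases a) auto
qed

text \<open>As long as \<open>p\<close> agrees with \<open>w\<close>, the stack contains only descents. So descents and flat steps of \<open>w\<close>
  force the same step in \<open>p\<close>, and the first disagreement is at a rise of \<open>w\<close>.\<close>

lemma vec_unitriangular:
  "length w = length p \<Longrightarrow> vec h (replicate j Down) w p \<noteq> 0 \<Longrightarrow> p = w \<or> up_code p < up_code w"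
proof (induction w p arbitrary: h j rule: list_induct2)
  case (Cons l w a p)
  show ?case
  proof (cases l)
    case Up
    show ?thesis
    proof (cases "a = Up")
      case True
      then have "vec (Suc h) (replicate (Suc j) Down) w p \<noteq> 0" using Cons.prems Up by simp
      from Cons.IH[OF this] show ?thesis using True Up Cons.hyps by auto
    next
      case False
      then show ?thesis using up_code_less[of p] Up Cons.hyps by auto
    qed
  next
    case Down
    then obtain j' where "j = Suc j'" "a = Down" "vec (h - 1) (replicate j' Down) w p \<noteq> 0"
      using Cons.prems by (cases j) (auto split: if_splits)
    then show ?thesis using Cons.IH[of "h - 1" j'] Down by auto
  next
    case Flat
    then have "a = Flat" "vec h (replicate j Down) w p \<noteq> 0"
      using Cons.prems by (cases a; auto)+
    then show ?thesis using Cons.IH[of h j] Flat by auto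
  qed
qed simp

lemma vec_diagonal: "path fl j w \<Longrightarrow> vec h (replicate j Down) w w = 1"
proof (induction w arbitrary: h j)
  case (Cons l w)
  show ?case
  proof (cases l)
    case Up
    then show ?thesis using Cons.IH[of "Suc j" "Suc h"] Cons.prems by simp
  next
    case Down
    then obtain j' where "j = Suc j'" using Cons.prems by (cases j) auto
    then show ?thesis using Down Cons.IH[of j' "h - 1"] Cons.prems by simp
  next
    case Flat
    then show ?thesis using Cons.IH[of j h] Cons.prems by auto
  qed
qed simp

lemma path_iff_closed:
  "set p \<subseteq> steps fl \<Longrightarrow> om_list h p \<noteq> 0 \<and> foldl move_step h p = 0 \<longleftrightarrow> path fl h p"
proof (induction p arbitrary: h)
  case (Cons a p)
  then show ?case
    using \<nu>_nz x_nz by (cases a; cases fl) (auto simp: steps_def)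
qed simp

lemma form_as_path_sum:
  assumes "length u = k"
  shows "form u w = (\<Sum>p\<in>paths fl k 0. om_list 0 p * vec 0 [] u p * vec 0 [] w p)"
proof -
  have "form u w = (\<Sum>p\<in>paths fl k 0. weight p * vec 0 [] u p * vec 0 [] w p)"
    unfolding form_def assms
  proof (rule sum.mono_neutral_right)
    show "finite (tuples (steps fl) k)" by (rule finite_tuples[OF finite_A])
    show "paths fl k 0 \<subseteq> tuples (steps fl) k"
      using path_steps by (auto simp: paths_def tuples_def)
    show "\<forall>p\<in>tuples (steps fl) k - paths fl k 0. weight p * vec 0 [] u p * vec 0 [] w p = 0"
      using path_iff_closed[of _ 0] by (auto simp: paths_def tuples_def weight_def)
  qed
  also have "\<dots> = (\<Sum>p\<in>paths fl k 0. om_list 0 p * vec 0 [] u p * vec 0 [] w p)"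
  proof (rule sum.cong[OF refl])
    fix p assume "p \<in> paths fl k 0"
    then have "foldl move_step 0 p = 0"
      using path_iff_closed[of p 0] path_steps[of fl 0 p] by (simp add: paths_def)
    then show "weight p * vec 0 [] u p * vec 0 [] w p = om_list 0 p * vec 0 [] u p * vec 0 [] w p"
      by (simp add: weight_def)
  qed
  finally show ?thesis .
qed

end

section \<open>The Gram matrix in the path model\<close>

text \<open>A permutation \<open>\<pi>\<close> that contributes to the Leibniz formula satisfies \<open>c (\<pi> i) \<le> c i\<close> for all \<open>i\<close>,
  strictly unless \<open>\<pi> i = i\<close>. The sums of both sides agree, so it is the identity.\<close>

lemma det_unitriangular_wrt:
  fixes M :: "'a::comm_ring_1 mat" and c :: "nat \<Rightarrow> nat"
  assumes M: "M \<in> carrier_mat n n" and diag: "\<And>i. i < n \<Longrightarrow> M $$ (i, i) = 1"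
    and off: "\<And>i j. i < n \<Longrightarrow> j < n \<Longrightarrow> i \<noteq> j \<Longrightarrow> M $$ (i, j) \<noteq> 0 \<Longrightarrow> c j < c i"
  shows "det M = 1"
proof -
  have "(\<Prod>i = 0..<n. M $$ (i, \<pi> i)) = 0" if \<pi>: "\<pi> permutes {0..<n}" "\<pi> \<noteq> id" for \<pi>
  proof (rule ccontr)
    assume "(\<Prod>i = 0..<n. M $$ (i, \<pi> i)) \<noteq> 0"
    then have nz: "M $$ (i, \<pi> i) \<noteq> 0" if "i < n" for i
      using that by (metis atLeastLessThan_iff finite_atLeastLessThan prod_zero zero_le)
    have lt: "\<pi> i < n" if "i < n" for i using permutes_in_image[OF \<pi>(1), of i] that by auto
    have less: "c (\<pi> i) < c i" if "i < n" "\<pi> i \<noteq> i" for i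
      using off[OF that(1) lt[OF that(1)]] nz[OF that(1)] that(2) by auto
    obtain i where i: "\<pi> i \<noteq> i" using \<pi>(2) by (metis eq_id_iff)
    then have "i < n" using permutes_not_in[OF \<pi>(1), of i] by fastforce
    have "(\<Sum>i = 0..<n. c (\<pi> i)) < (\<Sum>i = 0..<n. c i)"
    proof (rule sum_strict_mono_ex1)
      show "\<forall>j\<in>{0..<n}. c (\<pi> j) \<le> c j"
      proof
        fix j assume "j \<in> {0..<n}"
        then show "c (\<pi> j) \<le> c j" using less[of j] by (cases "\<pi> j = j") auto
      qed
      show "\<exists>j\<in>{0..<n}. c (\<pi> j) < c j" using less[OF \<open>i < n\<close> i] \<open>i < n\<close> by auto
    qed simp
    moreover have "(\<Sum>i = 0..<n. c (\<pi> i)) = (\<Sum>i = 0..<n. c i)"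
      using sum.permute[OF \<pi>(1), of c] by (simp add: comp_def)
    ultimately show False by simp
  qed
  then have "det M = (\<Sum>\<pi>\<in>{id}. signof \<pi> * (\<Prod>i = 0..<n. M $$ (i, \<pi> i)))"
    unfolding det_def'[OF M]
    by (intro sum.mono_neutral_right) (auto simp: finite_permutations permutes_id)
  also have "\<dots> = 1" using diag by simp
  finally show ?thesis .
qed

text \<open>The factorisation \<open>T W T\<^sup>t\<close> of the Gram matrix.\<close>

lemma (in path_model) det_form:
  assumes ws: "distinct ws" "set ws = paths fl k 0"
  shows "det (mat (length ws) (length ws) (\<lambda>(i, j). form (ws ! i) (ws ! j))) =
    (\<Prod>p\<in>paths fl k 0. om_list 0 p)"
proof -
  define n where "n = length ws"
  define T where "T = mat n n (\<lambda>(i, j). vec 0 [] (ws ! i) (ws ! j))"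
  define D where "D = mat n n (\<lambda>(i, j). if i = j then om_list 0 (ws ! i) else 0)"
  have T: "T \<in> carrier_mat n n" and D: "D \<in> carrier_mat n n" by (auto simp: T_def D_def)
  have wsi: "length (ws ! i) = k" "path fl 0 (ws ! i)" if "i < n" for i
    using nth_mem[of i ws] that ws(2) by (auto simp: paths_def n_def)
  have bij: "bij_betw ((!) ws) {0..<n} (paths fl k 0)"
    by (rule bij_betw_nth) (auto simp: ws n_def)
  have sum_ws: "(\<Sum>p\<in>paths fl k 0. F p) = (\<Sum>l = 0..<n. F (ws ! l))" for F :: "step list \<Rightarrow> 'r"
    by (rule sum.reindex_bij_betw[OF bij, symmetric])
  have prod_ws: "(\<Prod>p\<in>paths fl k 0. F p) = (\<Prod>l = 0..<n. F (ws ! l))" for F :: "step list \<Rightarrow> 'r"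
    by (rule prod.reindex_bij_betw[OF bij, symmetric])
  have DT: "(D * transpose_mat T) $$ (l, j) = om_list 0 (ws ! l) * vec 0 [] (ws ! j) (ws ! l)"
    if "l < n" "j < n" for l j
  proof -
    have "(D * transpose_mat T) $$ (l, j) = (\<Sum>m = 0..<n. (if l = m then om_list 0 (ws ! l) else 0) * vec 0 [] (ws ! j) (ws ! m))"
      using that by (simp add: D_def T_def scalar_prod_def)
    also have "\<dots> = (\<Sum>m = 0..<n. if l = m then om_list 0 (ws ! l) * vec 0 [] (ws ! j) (ws ! m) else 0)"
      by (intro sum.cong) auto
    finally show ?thesis using that by simp
  qed
  have "mat n n (\<lambda>(i, j). form (ws ! i) (ws ! j)) = T * (D * transpose_mat T)"
  proof (rule eq_matI)
    fix i j assume ij: "i < dim_row (T * (D * transpose_mat T))" "j < dim_col (T * (D * transpose_mat T))"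
    then have ij: "i < n" "j < n" using T D by auto
    have "(T * X) $$ (i, j) = (\<Sum>l = 0..<n. T $$ (i, l) * X $$ (l, j))" if "X \<in> carrier_mat n n" for X
      using that ij T by (auto simp: scalar_prod_def)
    then have "(T * (D * transpose_mat T)) $$ (i, j) =
        (\<Sum>l = 0..<n. T $$ (i, l) * (D * transpose_mat T) $$ (l, j))"
      using T D by simp
    also have "\<dots> = (\<Sum>l = 0..<n. om_list 0 (ws ! l) * vec 0 [] (ws ! i) (ws ! l) * vec 0 [] (ws ! j) (ws ! l))"
      using ij DT by (intro sum.cong) (auto simp: T_def)
    also have "\<dots> = form (ws ! i) (ws ! j)"
      unfolding form_as_path_sum[OF wsi(1)[OF ij(1)]] sum_ws ..
    finally show "mat n n (\<lambda>(i, j). form (ws ! i) (ws ! j)) $$ (i, j) = (T * (D * transpose_mat T)) $$ (i, j)"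
      using ij by simp
  qed (use T D in auto)
  then have "det (mat n n (\<lambda>(i, j). form (ws ! i) (ws ! j))) = det T * (det D * det T)"
    using T D by (simp add: det_mult[of _ n] det_transpose[OF T])
  moreover have "det T = 1"
  proof (rule det_unitriangular_wrt[OF T])
    show "T $$ (i, i) = 1" if "i < n" for i
      using that vec_diagonal[OF wsi(2)[OF that], of 0] by (simp add: T_def)
    show "up_code (ws ! j) < up_code (ws ! i)" if "i < n" "j < n" "i \<noteq> j" "T $$ (i, j) \<noteq> 0" for i j
      using vec_unitriangular[of "ws ! i" "ws ! j" 0 0] that wsi nth_eq_iff_index_eq[OF ws(1)]
      by (auto simp: T_def n_def)
  qed
  moreover have "det D = (\<Prod>p\<in>paths fl k 0. om_list 0 p)"
  proof -
    have "upper_triangular D" by (auto simp: D_def)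
    from det_upper_triangular[OF this D] show ?thesis
      by (simp add: prod_ws prod_list_diag_prod D_def)
  qed
  ultimately show ?thesis by (simp add: n_def)
qed


section \<open>Counting rises\<close>

definition num_paths :: "bool \<Rightarrow> nat \<Rightarrow> nat \<Rightarrow> nat" where
  "num_paths fl k h = card (paths fl k h)"

fun rises :: "nat \<Rightarrow> nat \<Rightarrow> step list \<Rightarrow> nat" where
  "rises i h [] = 0"
| "rises i h (Up # w) = (if h = i then 1 else 0) + rises i (Suc h) w"
| "rises i h (Down # w) = rises i (h - 1) w"
| "rises i h (Flat # w) = rises i h w"

lemma finite_paths: "finite (paths fl k h)"
proof (rule finite_subset)
  show "paths fl k h \<subseteq> {w. set w \<subseteq> {Up, Down, Flat} \<and> length w = k}"
    using step.exhaust by (auto simp: paths_def)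
  show "finite {w. set w \<subseteq> {Up, Down, Flat} \<and> length w = k}"
    by (rule finite_lists_length_eq) simp
qed

lemma paths_0: "paths fl 0 h = (if h = 0 then {[]} else {})"
  by (auto simp: paths_def)

lemma paths_Suc:
  "paths fl (Suc k) h = (#) Up ` paths fl k (Suc h) \<union> (if fl then (#) Flat ` paths fl k h else {}) \<union>
    (if h = 0 then {} else (#) Down ` paths fl k (h - 1))"
proof (intro equalityI subsetI)
  fix w assume "w \<in> paths fl (Suc k) h"
  then obtain a w' where "w = a # w'" "length w' = k" "path fl h (a # w')"
    by (auto simp: paths_def length_Suc_conv)
  then show "w \<in> (#) Up ` paths fl k (Suc h) \<union> (if fl then (#) Flat ` paths fl k h else {}) \<union>
    (if h = 0 then {} else (#) Down ` paths fl k (h - 1))"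
    by (cases a) (auto simp: paths_def)
qed (auto simp: paths_def split: if_splits)

lemma sum_paths_Suc:
  "sum F (paths fl (Suc k) h) = (\<Sum>w\<in>paths fl k (Suc h). F (Up # w)) +
    (if fl then \<Sum>w\<in>paths fl k h. F (Flat # w) else 0) +
    (if h = 0 then 0 else \<Sum>w\<in>paths fl k (h - 1). F (Down # w))"
  unfolding paths_Suc
  by (subst sum.union_disjoint; (subst sum.union_disjoint)?)
    (auto simp: finite_paths sum.reindex inj_on_def)

lemma num_paths_0: "num_paths fl 0 h = (if h = 0 then 1 else 0)"
  by (simp add: num_paths_def paths_0)

lemma num_paths_Suc:
  "num_paths fl (Suc k) h = num_paths fl k (Suc h) + (if fl then num_paths fl k h else 0) +
    (if h = 0 then 0 else num_paths fl k (h - 1))"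
  using sum_paths_Suc[of "\<lambda>_. 1::nat" fl k h] by (simp add: num_paths_def)

lemma num_paths_eq_0: "k < h \<Longrightarrow> num_paths fl k h = 0"
proof (induction k arbitrary: h)
  case 0
  then show ?case by (simp add: num_paths_0)
next
  case (Suc k)
  then have "num_paths fl k (Suc h) = 0" "num_paths fl k h = 0" "num_paths fl k (h - 1) = 0" by simp_all
  then show ?case by (cases fl) (simp_all add: num_paths_Suc)
qed

definition num_rises :: "bool \<Rightarrow> nat \<Rightarrow> nat \<Rightarrow> nat \<Rightarrow> nat" where
  "num_rises fl i k h = (\<Sum>w\<in>paths fl k h. rises i h w)"

lemma num_rises_Suc:
  "num_rises fl i (Suc k) h = (if h = i then num_paths fl k (Suc h) else 0) +
    num_rises fl i k (Suc h) + (if fl then num_rises fl i k h else 0) +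
    (if h = 0 then 0 else num_rises fl i k (h - 1))"
  unfolding num_rises_def sum_paths_Suc by (simp add: sum.distrib num_paths_def)

text \<open>A path from height \<open>h\<close> to \<open>0\<close> with a marked rise from \<open>i\<close> consists of a path from \<open>h\<close> to \<open>i\<close>, the rise,
  and a path from \<open>i + 1\<close> to \<open>0\<close>. As in the Clebsch-Gordan rule, paths from \<open>h\<close> to \<open>i\<close> are as many as
  paths to \<open>0\<close> from the heights \<open>\<bar>h - i\<bar> + 2 * t\<close> with \<open>t \<le> min h i\<close>, and joining such a path to
  the second part, as in \<open>num_rises_closed\<close>, raises the initial height by \<open>i + 2\<close>. This closed form is
  confirmed by checking that both sides satisfy the same recursion in \<open>k\<close>.\<close>

lemma num_rises_eq:
  "num_rises fl i k h =
    (if i \<le> h then \<Sum>t\<le>i. num_paths fl k (h + 2 * t + 2)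
     else \<Sum>t\<le>h. num_paths fl k (2 * i - h + 2 * t + 2))"
proof (induction k arbitrary: h)
  case 0
  show ?case by (auto simp: num_rises_def paths_0 num_paths_0)
next
  case (Suc k)
  let ?N = "num_paths fl k" and ?F = "\<lambda>m::nat. if fl then m else 0"
  have F: "(\<Sum>t\<le>j. ?F (g t)) = ?F (\<Sum>t\<le>j. g t)" for g :: "nat \<Rightarrow> nat" and j by simp
  have N: "num_paths fl (Suc k) (Suc y) = ?N (Suc (Suc y)) + ?F (?N (Suc y)) + ?N y" for y
    by (simp add: num_paths_Suc)
  consider (above) "i < h" | (eq) "h = i" | (below) d where "i = h + Suc d"
    by (metis add_Suc_right less_imp_Suc_add linorder_neqE_nat)
  then show ?case
  proof cases
    case above
    then obtain h' where h: "h = Suc h'" "i \<le> h'" by (cases h) auto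
    show ?thesis
      unfolding num_rises_Suc Suc.IH using above h
      by (simp add: N sum.distrib F)
  next
    case eq
    show ?thesis
    proof (cases i)
      case 0
      then show ?thesis unfolding num_rises_Suc Suc.IH using eq by (simp add: N)
    next
      case (Suc i')
      have "(\<Sum>t\<le>i. ?N (i + 2 * t + 1)) = ?N (Suc i) + (\<Sum>t\<le>i'. ?N (i + 2 * t + 3))"
        unfolding Suc sum.atMost_Suc_shift by (simp add: eval_nat_numeral)
      then show ?thesis
        unfolding num_rises_Suc Suc.IH using eq Suc
        by (simp add: N sum.distrib F eval_nat_numeral)
    qed
  next
    case (below d)
    \<comment> \<open>The sum for \<open>h + 1\<close> has one term more and the sum for \<open>h - 1\<close> one term less than needed; it is
      the same term.\<close>
    have up: "num_rises fl i k (Suc h) = (\<Sum>t\<le>Suc h. ?N (h + 2 * d + 2 * t + 3))"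
      unfolding Suc.IH using below by (cases d) (simp_all add: algebra_simps eval_nat_numeral)
    have up': "\<dots> = (\<Sum>t\<le>h. ?N (h + 2 * d + 2 * t + 3)) + ?N (3 * h + 2 * d + 5)"
      by (simp add: algebra_simps)
    have down: "(\<Sum>t\<le>h. ?N (h + 2 * d + 2 * t + 5)) =
      (if h = 0 then 0 else num_rises fl i k (h - 1)) + ?N (3 * h + 2 * d + 5)"
    proof (cases h)
      case 0
      then show ?thesis by simp
    next
      case (Suc h')
      then have "num_rises fl i k (h - 1) = (\<Sum>t\<le>h'. ?N (h + 2 * d + 2 * t + 5))"
        unfolding Suc.IH using below by (simp add: algebra_simps eval_nat_numeral)
      then show ?thesis using Suc by (simp add: algebra_simps)
    qed
    have flat: "num_rises fl i k h = (\<Sum>t\<le>h. ?N (h + 2 * d + 2 * t + 4))"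
      unfolding Suc.IH using below by (simp add: algebra_simps eval_nat_numeral)
    have "(\<Sum>t\<le>h. num_paths fl (Suc k) (2 * i - h + 2 * t + 2)) =
      (\<Sum>t\<le>h. ?N (h + 2 * d + 2 * t + 5) + ?F (?N (h + 2 * d + 2 * t + 4)) + ?N (h + 2 * d + 2 * t + 3))"
    proof (rule sum.cong[OF refl])
      fix t
      have "2 * i - h + 2 * t + 2 = Suc (h + 2 * d + 2 * t + 3)" using below by simp
      then show "num_paths fl (Suc k) (2 * i - h + 2 * t + 2) =
        ?N (h + 2 * d + 2 * t + 5) + ?F (?N (h + 2 * d + 2 * t + 4)) + ?N (h + 2 * d + 2 * t + 3)"
        by (simp only: N) (simp add: eval_nat_numeral)
    qed
    also have "\<dots> = num_rises fl i (Suc k) h"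
      unfolding num_rises_Suc sum.distrib F down up up' flat using below by simp
    finally show ?thesis using below by simp
  qed
qed

text \<open>For closed paths this is a bijection: reverse the part before the marked rise, lift it by \<open>i + 2\<close>,
  and turn the rise into a descent. The result is a path from \<open>2 * i + 2\<close> to \<open>0\<close>, whose first
  step to height \<open>i + 1\<close> is the marked one.\<close>

corollary num_rises_closed: "num_rises fl i k 0 = num_paths fl k (2 * i + 2)"
  by (simp add: num_rises_eq)

text \<open>The exponent of \<open>n\<close> in the weight of a path, when \<open>\<nu> h\<close> contains the factor \<open>n powi \<epsilon> h\<close>.\<close>

fun tilt :: "(nat \<Rightarrow> int) \<Rightarrow> nat \<Rightarrow> step list \<Rightarrow> int" where
  "tilt \<epsilon> h [] = 0"
| "tilt \<epsilon> h (Up # w) = \<epsilon> h + tilt \<epsilon> (Suc h) w"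
| "tilt \<epsilon> h (Down # w) = tilt \<epsilon> (h - 1) w"
| "tilt \<epsilon> h (Flat # w) = 1 + tilt \<epsilon> h w"

lemma prod_powi: "(x::'a::field) \<noteq> 0 \<Longrightarrow> (\<Prod>a\<in>S. x powi g a) = x powi (\<Sum>a\<in>S. g a)"
  by (induction S rule: infinite_finite_induct) (simp_all add: power_int_add)

context path_model
begin

lemma om_list_factored:
  assumes \<nu>: "\<And>h. \<nu> h = \<rho> h * x powi \<epsilon> h"
  shows "path fl h w \<Longrightarrow> h + length w \<le> K \<Longrightarrow>
    om_list h w = x powi tilt \<epsilon> h w * (\<Prod>i<K. \<rho> i ^ rises i h w)"
proof (induction w arbitrary: h)
  case (Cons a w)
  show ?case
  proof (cases a)
    case Up
    then have IH: "om_list (Suc h) w = x powi tilt \<epsilon> (Suc h) w * (\<Prod>i<K. \<rho> i ^ rises i (Suc h) w)"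
      using Cons by (intro Cons.IH) auto
    have "(\<Prod>i<K. \<rho> i ^ rises i h (Up # w)) =
        (\<Prod>i<K. (if h = i then \<rho> i else 1) * \<rho> i ^ rises i (Suc h) w)"
      by (intro prod.cong) auto
    also have "\<dots> = \<rho> h * (\<Prod>i<K. \<rho> i ^ rises i (Suc h) w)"
      using Cons.prems by (simp add: prod.distrib)
    finally have P: "(\<Prod>i<K. \<rho> i ^ rises i h (Up # w)) = \<rho> h * (\<Prod>i<K. \<rho> i ^ rises i (Suc h) w)" .
    have "om_list h (a # w) = \<nu> h * om_list (Suc h) w" using Up by simp
    also have "\<dots> = x powi tilt \<epsilon> h (a # w) * (\<Prod>i<K. \<rho> i ^ rises i h (a # w))"
      unfolding IH Up P tilt.simps power_int_add[OF disjI1[OF x_nz]] \<nu>[of h] by (simp only: mult_ac)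
    finally show ?thesis .
  next
    case Down
    then have "om_list (h - 1) w = x powi tilt \<epsilon> (h - 1) w * (\<Prod>i<K. \<rho> i ^ rises i (h - 1) w)"
      using Cons by (intro Cons.IH) auto
    then show ?thesis using Down Cons.prems by simp
  next
    case Flat
    then have "om_list h w = x powi tilt \<epsilon> h w * (\<Prod>i<K. \<rho> i ^ rises i h w)"
      using Cons by (intro Cons.IH) auto
    then show ?thesis using Flat x_nz by (simp add: power_int_add algebra_simps)
  qed
qed simp

lemma prod_om_list:
  assumes \<nu>: "\<And>h. \<nu> h = \<rho> h * x powi \<epsilon> h"
  shows "(\<Prod>p\<in>paths fl k 0. om_list 0 p) =
    x powi (\<Sum>p\<in>paths fl k 0. tilt \<epsilon> 0 p) * (\<Prod>i<k. \<rho> i ^ num_paths fl k (2 * i + 2))"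
proof -
  have "(\<Prod>p\<in>paths fl k 0. om_list 0 p) =
    (\<Prod>p\<in>paths fl k 0. x powi tilt \<epsilon> 0 p * (\<Prod>i<k. \<rho> i ^ rises i 0 p))"
    using om_list_factored[OF \<nu>] by (intro prod.cong) (auto simp: paths_def)
  also have "\<dots> = x powi (\<Sum>p\<in>paths fl k 0. tilt \<epsilon> 0 p) *
      (\<Prod>i<k. \<Prod>p\<in>paths fl k 0. \<rho> i ^ rises i 0 p)"
    unfolding prod.distrib prod_powi[OF x_nz]
    by (subst prod.swap) (rule refl)
  finally show ?thesis
    by (simp only: power_sum[symmetric] num_rises_def[symmetric] num_rises_closed)
qed

end


section \<open>Noncrossing partitions as words\<close>

text \<open>A point is the least of several elements of its block (\<open>Op\<close>), the greatest (\<open>Cl\<close>), the only one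
  (\<open>Si\<close>), or in the middle (\<open>Mi\<close>). Noncrossing means that \<open>Cl\<close> and \<open>Mi\<close> always refer to the block
  opened last among those still open, so the word determines the partition.\<close>

datatype letter = Op | Cl | Si | Mi

text \<open>The height is the number of open blocks, so only \<open>Op\<close> and \<open>Cl\<close> change it.\<close>

fun lpath :: "letter set \<Rightarrow> nat \<Rightarrow> letter list \<Rightarrow> bool" where
  "lpath L h [] \<longleftrightarrow> h = 0"
| "lpath L h (Op # w) \<longleftrightarrow> Op \<in> L \<and> lpath L (Suc h) w"
| "lpath L h (Cl # w) \<longleftrightarrow> Cl \<in> L \<and> h \<noteq> 0 \<and> lpath L (h - 1) w"
| "lpath L h (Si # w) \<longleftrightarrow> Si \<in> L \<and> lpath L h w"
| "lpath L h (Mi # w) \<longleftrightarrow> Mi \<in> L \<and> h \<noteq> 0 \<and> lpath L h w"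

lemma lpath_restrict: "lpath L h w \<longleftrightarrow> lpath UNIV h w \<and> set w \<subseteq> L"
  by (induction L h w rule: lpath.induct) auto

text \<open>Recovers the partition from its word. The stack \<open>st\<close> lists the open blocks, each represented by a point in
  it, the last opened one first.\<close>

fun build :: "'a list \<Rightarrow> 'a list \<Rightarrow> letter list \<Rightarrow> 'a set set" where
  "build st (x # ls) (Op # w) = build (x # st) ls w"
| "build st (x # ls) (Si # w) = insert {x} (build st ls w)"
| "build (u # st) (x # ls) (Cl # w) = insert {u, x} (build st ls w)"
| "build (u # st) (x # ls) (Mi # w) =
    (\<lambda>B. if u \<in> B then insert x B else B) ` build (u # st) ls w"
| "build _ _ _ = {}"

definition lower :: "point set set \<Rightarrow> point \<Rightarrow> bool" where
  "lower \<sigma> y \<longleftrightarrow> (\<exists>B\<in>\<sigma>. y \<in> B \<and> (\<exists>z\<in>B. pos z < pos y))"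

definition upper :: "point set set \<Rightarrow> point \<Rightarrow> bool" where
  "upper \<sigma> y \<longleftrightarrow> (\<exists>B\<in>\<sigma>. y \<in> B \<and> (\<exists>z\<in>B. pos y < pos z))"

definition letter :: "point set set \<Rightarrow> point \<Rightarrow> letter" where
  "letter \<sigma> y =
    (if lower \<sigma> y then if upper \<sigma> y then Mi else Cl else if upper \<sigma> y then Op else Si)"

definition inc :: "point list \<Rightarrow> bool" where
  "inc xs \<longleftrightarrow> sorted_wrt (\<lambda>x y. pos x < pos y) xs"

text \<open>The points of \<open>st\<close> lie to the left of those of \<open>ls\<close>, the nearest one first, and each of them opens a
  block of its own that continues in \<open>ls\<close>. For \<open>st\<close> the upper and \<open>ls\<close> the lower row these are the epi;
  for empty \<open>st\<close> they are all noncrossing partitions of one row. The rows are lists of arbitrary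
  points because an induction over \<open>ls\<close> deletes points or moves them to \<open>st\<close>.\<close>

definition stacked :: "point list \<Rightarrow> point list \<Rightarrow> point set set \<Rightarrow> bool" where
  "stacked st ls \<sigma> \<longleftrightarrow> partition_on (set st \<union> set ls) \<sigma> \<and> noncrossing \<sigma> \<and>
    (\<forall>B\<in>\<sigma>. \<forall>u\<in>set st. u \<in> B \<longrightarrow> (\<forall>u'\<in>set st. u' \<in> B \<longrightarrow> u' = u) \<and> (\<exists>y\<in>set ls. y \<in> B))"

lemma pos_inject: "pos a = pos b \<Longrightarrow> a = b"
  by (cases a; cases b) auto

lemma noncrossingI:
  assumes "\<And>B C a b c d. B \<in> \<sigma> \<Longrightarrow> C \<in> \<sigma> \<Longrightarrow> B \<noteq> C \<Longrightarrow> a \<in> B \<Longrightarrow> b \<in> C \<Longrightarrow> c \<in> B \<Longrightarrow> d \<in> C \<Longrightarrow>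
    pos a < pos b \<Longrightarrow> pos b < pos c \<Longrightarrow> pos c < pos d \<Longrightarrow> False"
  shows "noncrossing \<sigma>"
  unfolding noncrossing_def using assms by blast

lemma noncrossingD:
  assumes "noncrossing \<sigma>" "B \<in> \<sigma>" "C \<in> \<sigma>" "a \<in> B" "b \<in> C" "c \<in> B" "d \<in> C"
    "pos a < pos b" "pos b < pos c" "pos c < pos d"
  shows "B = C"
proof (rule ccontr)
  assume "B \<noteq> C"
  with assms(2-) have "\<exists>B\<in>\<sigma>. \<exists>C\<in>\<sigma>. B \<noteq> C \<and> (\<exists>a\<in>B. \<exists>b\<in>C. \<exists>c\<in>B. \<exists>d\<in>C.
      pos a < pos b \<and> pos b < pos c \<and> pos c < pos d)"
    by (intro bexI conjI)
  with assms(1) show False unfolding noncrossing_def by contradiction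
qed

lemma block_unique:
  "partition_on A \<sigma> \<Longrightarrow> B \<in> \<sigma> \<Longrightarrow> C \<in> \<sigma> \<Longrightarrow> z \<in> B \<Longrightarrow> z \<in> C \<Longrightarrow> B = C"
  unfolding partition_on_def disjoint_def by blast

lemma block_subset: "partition_on A \<sigma> \<Longrightarrow> B \<in> \<sigma> \<Longrightarrow> z \<in> B \<Longrightarrow> z \<in> A"
  unfolding partition_on_def by blast

lemma block_exists:
  assumes "partition_on A \<sigma>" "z \<in> A"
  obtains B where "B \<in> \<sigma>" "z \<in> B"
  using assms unfolding partition_on_def by blast

lemma partition_onI':
  assumes "\<And>B z. B \<in> \<sigma> \<Longrightarrow> z \<in> B \<Longrightarrow> z \<in> A" "\<And>z. z \<in> A \<Longrightarrow> \<exists>B\<in>\<sigma>. z \<in> B"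
    "\<And>B C z. B \<in> \<sigma> \<Longrightarrow> C \<in> \<sigma> \<Longrightarrow> z \<in> B \<Longrightarrow> z \<in> C \<Longrightarrow> B = C" "{} \<notin> \<sigma>"
  shows "partition_on A \<sigma>"
  unfolding partition_on_def disjoint_def
proof (intro conjI ballI impI)
  show "\<Union>\<sigma> = A" using assms(1,2) by blast
  show "B \<inter> C = {}" if "B \<in> \<sigma>" "C \<in> \<sigma>" "B \<noteq> C" for B C using assms(3) that by blast
qed (rule assms(4))

lemma stackedD:
  assumes "stacked st ls \<sigma>"
  shows "partition_on (set st \<union> set ls) \<sigma>" "noncrossing \<sigma>"
    "B \<in> \<sigma> \<Longrightarrow> u \<in> set st \<Longrightarrow> u' \<in> set st \<Longrightarrow> u \<in> B \<Longrightarrow> u' \<in> B \<Longrightarrow> u' = u"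
    "B \<in> \<sigma> \<Longrightarrow> u \<in> set st \<Longrightarrow> u \<in> B \<Longrightarrow> \<exists>y\<in>set ls. y \<in> B"
  using assms unfolding stacked_def by blast+

lemma incD:
  assumes "inc (rev st @ x # ls)"
  shows "u \<in> set st \<Longrightarrow> pos u < pos x" "y \<in> set ls \<Longrightarrow> pos x < pos y"
    "u \<in> set st \<Longrightarrow> y \<in> set ls \<Longrightarrow> pos u < pos y" "inc (rev (x # st) @ ls)" "inc (rev st @ ls)"
  using assms by (auto simp: inc_def sorted_wrt_append)

lemma incD_top:
  assumes "inc (rev (u # st) @ ls)"
  shows "z \<in> set st \<Longrightarrow> pos z < pos u" "inc (rev st @ ls)"
  using assms by (auto simp: inc_def sorted_wrt_append)

lemma letter_eq_iff:
  "letter \<sigma> x = Op \<longleftrightarrow> \<not> lower \<sigma> x \<and> upper \<sigma> x" "letter \<sigma> x = Cl \<longleftrightarrow> lower \<sigma> x \<and> \<not> upper \<sigma> x"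
  "letter \<sigma> x = Si \<longleftrightarrow> \<not> lower \<sigma> x \<and> \<not> upper \<sigma> x" "letter \<sigma> x = Mi \<longleftrightarrow> lower \<sigma> x \<and> upper \<sigma> x"
  by (auto simp: letter_def)

lemma stacked_Nil: "stacked st [] \<sigma> \<longleftrightarrow> st = [] \<and> \<sigma> = {}"
proof
  assume s: "stacked st [] \<sigma>"
  have "st = []"
  proof (rule ccontr)
    assume "st \<noteq> []"
    then obtain u where u: "u \<in> set st" by (cases st) auto
    then obtain B where "B \<in> \<sigma>" "u \<in> B" using block_exists[OF stackedD(1)[OF s]] by blast
    then show False using stackedD(4)[OF s] u by auto
  qed
  then show "st = [] \<and> \<sigma> = {}" using s by (auto simp: stacked_def partition_on_def)
qed (auto simp: stacked_def partition_on_def disjoint_def noncrossing_def)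

text \<open>The next lemmas describe how the first point \<open>x\<close> of the row is removed, according to its letter: it
  joins the stack if it opens a block, it disappears if it is a singleton or in the middle of a block,
  and it disappears together with the top of the stack if it closes a block.\<close>

lemma stacked_Op:
  assumes "inc (rev st @ x # ls)"
  shows "stacked st (x # ls) \<sigma> \<and> letter \<sigma> x = Op \<longleftrightarrow> stacked (x # st) ls \<sigma>"
proof
  assume *: "stacked st (x # ls) \<sigma> \<and> letter \<sigma> x = Op"
  then have s: "stacked st (x # ls) \<sigma>" and l: "\<not> lower \<sigma> x" "upper \<sigma> x" by (auto simp: letter_eq_iff)
  have nl: "u \<notin> B" if "B \<in> \<sigma>" "x \<in> B" "u \<in> set st" for B u
    using l(1) that incD(1)[OF assms] unfolding lower_def by blast
  show "stacked (x # st) ls \<sigma>"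
    unfolding stacked_def
  proof (intro conjI ballI impI)
    show "partition_on (set (x # st) \<union> set ls) \<sigma>" using stackedD(1)[OF s] by simp
    show "noncrossing \<sigma>" by (rule stackedD(2)[OF s])
    fix B u assume B: "B \<in> \<sigma>" "u \<in> set (x # st)" "u \<in> B"
    show "u' = u" if "u' \<in> set (x # st)" "u' \<in> B" for u'
      using B that nl stackedD(3)[OF s B(1)] by auto
    show "\<exists>y\<in>set ls. y \<in> B"
    proof (cases "u = x")
      case True
      obtain C z where C: "C \<in> \<sigma>" "x \<in> C" "z \<in> C" "pos x < pos z" using l(2) unfolding upper_def by blast
      then have "C = B" using block_unique[OF stackedD(1)[OF s]] B True by blast
      moreover have "z \<in> set ls"
        using block_subset[OF stackedD(1)[OF s] C(1,3)] C(4) incD(1)[OF assms, of z] by auto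
      ultimately show ?thesis using C by blast
    next
      case False
      then have u: "u \<in> set st" using B by auto
      then have "x \<notin> B" using nl B by blast
      then show ?thesis using stackedD(4)[OF s B(1) u B(3)] by auto
    qed
  qed
next
  assume s: "stacked (x # st) ls \<sigma>"
  have x: "x \<notin> set st" using incD(1)[OF assms] by force
  have nl: "u \<notin> B" if "B \<in> \<sigma>" "x \<in> B" "u \<in> set st" for B u
    using stackedD(3)[OF s that(1), of x u] that x by auto
  obtain B where B: "B \<in> \<sigma>" "x \<in> B" using block_exists[OF stackedD(1)[OF s], of x] by auto
  obtain y where y: "y \<in> set ls" "y \<in> B" using stackedD(4)[OF s B(1), of x] B by auto
  have "upper \<sigma> x" unfolding upper_def using B y incD(2)[OF assms] by blast
  moreover have "\<not> lower \<sigma> x"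
  proof
    assume "lower \<sigma> x"
    then obtain C z where C: "C \<in> \<sigma>" "x \<in> C" "z \<in> C" "pos z < pos x" unfolding lower_def by blast
    then have "z \<in> set (x # st) \<union> set ls" using block_subset[OF stackedD(1)[OF s]] by blast
    then show False using C nl incD(2)[OF assms, of z] by auto
  qed
  moreover have "stacked st (x # ls) \<sigma>"
    unfolding stacked_def
  proof (intro conjI ballI impI)
    show "partition_on (set st \<union> set (x # ls)) \<sigma>" using stackedD(1)[OF s] by simp
    show "noncrossing \<sigma>" by (rule stackedD(2)[OF s])
    fix B u assume B: "B \<in> \<sigma>" "u \<in> set st" "u \<in> B"
    show "u' = u" if "u' \<in> set st" "u' \<in> B" for u'
      using B that stackedD(3)[OF s B(1), of u u'] by auto
    show "\<exists>y\<in>set (x # ls). y \<in> B" using stackedD(4)[OF s B(1) _ B(3)] B by auto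
  qed
  ultimately show "stacked st (x # ls) \<sigma> \<and> letter \<sigma> x = Op" by (simp add: letter_eq_iff)
qed

lemma stacked_Si_intro:
  assumes i: "inc (rev st @ x # ls)" and s: "stacked st ls \<sigma>"
  shows "stacked st (x # ls) (insert {x} \<sigma>)" "letter (insert {x} \<sigma>) x = Si"
    "y \<in> set ls \<Longrightarrow> letter (insert {x} \<sigma>) y = letter \<sigma> y"
proof -
  have x: "x \<notin> set st \<union> set ls" using incD(1,2)[OF i] by force
  have nx: "x \<notin> B" if "B \<in> \<sigma>" for B using block_subset[OF stackedD(1)[OF s] that] x by blast
  show "letter (insert {x} \<sigma>) x = Si"
    unfolding letter_eq_iff lower_def upper_def using nx by auto
  show "letter (insert {x} \<sigma>) y = letter \<sigma> y" if "y \<in> set ls"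
  proof -
    have "y \<noteq> x" using that x by auto
    then show ?thesis unfolding letter_def lower_def upper_def by auto
  qed
  show "stacked st (x # ls) (insert {x} \<sigma>)"
    unfolding stacked_def
  proof (intro conjI ballI impI)
    show "partition_on (set st \<union> set (x # ls)) (insert {x} \<sigma>)"
    proof (rule partition_onI')
      show "{} \<notin> insert {x} \<sigma>" using stackedD(1)[OF s] by (auto simp: partition_on_def)
      show "\<exists>B\<in>insert {x} \<sigma>. z \<in> B" if "z \<in> set st \<union> set (x # ls)" for z
        using that block_exists[OF stackedD(1)[OF s], of z] by auto
      show "z \<in> set st \<union> set (x # ls)" if "B \<in> insert {x} \<sigma>" "z \<in> B" for B z
        using that block_subset[OF stackedD(1)[OF s], of B z] by auto
      show "B = C" if "B \<in> insert {x} \<sigma>" "C \<in> insert {x} \<sigma>" "z \<in> B" "z \<in> C" for B C z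
        using that nx block_unique[OF stackedD(1)[OF s], of B C z] by auto
    qed
    show "noncrossing (insert {x} \<sigma>)"
    proof (rule noncrossingI)
      fix B C a b c d
      assume *: "B \<in> insert {x} \<sigma>" "C \<in> insert {x} \<sigma>" "B \<noteq> C" "a \<in> B" "b \<in> C" "c \<in> B" "d \<in> C"
        "pos a < pos b" "pos b < pos c" "pos c < pos d"
      then have "B \<noteq> {x}" "C \<noteq> {x}" by auto
      then show False using * noncrossingD[OF stackedD(2)[OF s], of B C a b c d] by auto
    qed
    fix B u assume B: "B \<in> insert {x} \<sigma>" "u \<in> set st" "u \<in> B"
    then have B': "B \<in> \<sigma>" using x by auto
    show "u' = u" if "u' \<in> set st" "u' \<in> B" for u'
      using B B' that stackedD(3)[OF s B', of u u'] by auto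
    show "\<exists>y\<in>set (x # ls). y \<in> B" using stackedD(4)[OF s B' B(2,3)] by auto
  qed
qed

lemma stacked_remove:
  assumes s: "stacked (us @ st) (x # ls) \<sigma>" and B: "insert x (set us) \<in> \<sigma>"
    and x: "x \<notin> set st \<union> set ls" "set us \<inter> (set st \<union> set ls) = {}"
  shows "stacked st ls (\<sigma> - {insert x (set us)})"
  unfolding stacked_def
proof (intro conjI ballI impI)
  let ?B = "insert x (set us)"
  have other: "z \<notin> ?B" if "C \<in> \<sigma> - {?B}" "z \<in> C" for C z
    using that block_unique[OF stackedD(1)[OF s] B, of C z] by auto
  show "partition_on (set st \<union> set ls) (\<sigma> - {?B})"
  proof (rule partition_onI')
    show "{} \<notin> \<sigma> - {?B}" using stackedD(1)[OF s] by (auto simp: partition_on_def)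
    show "\<exists>B\<in>\<sigma> - {?B}. z \<in> B" if z: "z \<in> set st \<union> set ls" for z
    proof -
      have "z \<in> set (us @ st) \<union> set (x # ls)" using z by auto
      then obtain C where C: "C \<in> \<sigma>" "z \<in> C" using block_exists[OF stackedD(1)[OF s], of z] by blast
      moreover have "z \<notin> ?B" using z x by auto
      ultimately show ?thesis by auto
    qed
    show "z \<in> set st \<union> set ls" if "C \<in> \<sigma> - {?B}" "z \<in> C" for C z
      using that block_subset[OF stackedD(1)[OF s], of C z] other[OF that] by auto
    show "C = D" if "C \<in> \<sigma> - {?B}" "D \<in> \<sigma> - {?B}" "z \<in> C" "z \<in> D" for C D z
      using that block_unique[OF stackedD(1)[OF s], of C D z] by auto
  qed
  show "noncrossing (\<sigma> - {?B})" using stackedD(2)[OF s] by (auto simp: noncrossing_def)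
  fix C u assume C: "C \<in> \<sigma> - {?B}" "u \<in> set st" "u \<in> C"
  show "u' = u" if "u' \<in> set st" "u' \<in> C" for u'
    using C that stackedD(3)[OF s, of C u u'] by auto
  show "\<exists>y\<in>set ls. y \<in> C" using stackedD(4)[OF s, of C u] C other[OF C(1), of x] by auto
qed

lemma stacked_Si_elim:
  assumes i: "inc (rev st @ x # ls)" and s: "stacked st (x # ls) \<sigma>" and l: "letter \<sigma> x = Si"
  obtains \<sigma>' where "stacked st ls \<sigma>'" "\<sigma> = insert {x} \<sigma>'"
proof -
  obtain B where B: "B \<in> \<sigma>" "x \<in> B" using block_exists[OF stackedD(1)[OF s], of x] by auto
  have "z = x" if "z \<in> B" for z
  proof -
    have "\<not> pos z < pos x" "\<not> pos x < pos z"
      using l B that unfolding letter_eq_iff lower_def upper_def by blast+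
    then show ?thesis using pos_inject[of z x] by auto
  qed
  then have "{x} \<in> \<sigma>" using B by (metis is_singletonI' is_singleton_def empty_iff singletonD)
  moreover have "x \<notin> set st \<union> set ls" using incD(1,2)[OF i] by force
  ultimately have "stacked st ls (\<sigma> - {{x}})" using stacked_remove[of "[]" st x ls \<sigma>] s by auto
  then show ?thesis using that \<open>{x} \<in> \<sigma>\<close> by blast
qed

lemma stacked_Cl_intro:
  assumes i: "inc (rev (u # st) @ x # ls)" and s: "stacked st ls \<sigma>"
  shows "stacked (u # st) (x # ls) (insert {u, x} \<sigma>)" "letter (insert {u, x} \<sigma>) x = Cl"
    "y \<in> set ls \<Longrightarrow> letter (insert {u, x} \<sigma>) y = letter \<sigma> y" "{u, x} \<notin> \<sigma>"
proof -
  have x: "x \<notin> set st \<union> set ls" "u \<notin> set st \<union> set ls" "pos u < pos x"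
    using incD[OF i] incD_top(1)[OF i] by force+
  have nx: "x \<notin> B" "u \<notin> B" if "B \<in> \<sigma>" for B
    using block_subset[OF stackedD(1)[OF s] that] x by blast+
  show "{u, x} \<notin> \<sigma>" using nx by blast
  show "letter (insert {u, x} \<sigma>) x = Cl"
    unfolding letter_eq_iff lower_def upper_def using nx x by auto
  show "letter (insert {u, x} \<sigma>) y = letter \<sigma> y" if "y \<in> set ls"
  proof -
    have "y \<noteq> x" "y \<noteq> u" using that x by auto
    then show ?thesis unfolding letter_def lower_def upper_def by auto
  qed
  have nobetween: "\<not> (pos u < pos z \<and> pos z < pos x)" if "z \<in> set (u # st) \<union> set (x # ls)" for z
    using that incD[OF i] incD_top(1)[OF i, of z] by (auto dest: order_less_asym)
  show "stacked (u # st) (x # ls) (insert {u, x} \<sigma>)"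
    unfolding stacked_def
  proof (intro conjI ballI impI)
    show p: "partition_on (set (u # st) \<union> set (x # ls)) (insert {u, x} \<sigma>)"
    proof (rule partition_onI')
      show "{} \<notin> insert {u, x} \<sigma>" using stackedD(1)[OF s] by (auto simp: partition_on_def)
      show "\<exists>B\<in>insert {u, x} \<sigma>. z \<in> B" if "z \<in> set (u # st) \<union> set (x # ls)" for z
        using that block_exists[OF stackedD(1)[OF s], of z] by auto
      show "z \<in> set (u # st) \<union> set (x # ls)" if "B \<in> insert {u, x} \<sigma>" "z \<in> B" for B z
        using that block_subset[OF stackedD(1)[OF s], of B z] by auto
      show "B = C" if "B \<in> insert {u, x} \<sigma>" "C \<in> insert {u, x} \<sigma>" "z \<in> B" "z \<in> C" for B C z
        using that nx block_unique[OF stackedD(1)[OF s], of B C z] by auto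
    qed
    show "noncrossing (insert {u, x} \<sigma>)"
    proof (rule noncrossingI)
      fix B C a b c d
      assume *: "B \<in> insert {u, x} \<sigma>" "C \<in> insert {u, x} \<sigma>" "B \<noteq> C" "a \<in> B" "b \<in> C" "c \<in> B" "d \<in> C"
        "pos a < pos b" "pos b < pos c" "pos c < pos d"
      have "B \<noteq> {u, x}"
        using * x(3) nobetween[OF block_subset[OF p *(2,5)]] by auto
      moreover have "C \<noteq> {u, x}"
        using * x(3) nobetween[OF block_subset[OF p *(1,6)]] by auto
      ultimately show False using * noncrossingD[OF stackedD(2)[OF s], of B C a b c d] by auto
    qed
    fix B u' assume B: "B \<in> insert {u, x} \<sigma>" "u' \<in> set (u # st)" "u' \<in> B"
    show "u'' = u'" if "u'' \<in> set (u # st)" "u'' \<in> B" for u''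
      using B that x nx stackedD(3)[OF s, of B u' u''] by auto
    show "\<exists>y\<in>set (x # ls). y \<in> B" using stackedD(4)[OF s, of B u'] B x nx by auto
  qed
qed

text \<open>If \<open>x\<close> were connected to a deeper point of the stack, then the block of the top point \<open>u\<close> would have
  to cross this connection, since it continues to the right of \<open>x\<close>.\<close>

lemma lower_top:
  assumes i: "inc (rev st @ x # ls)" and s: "stacked st (x # ls) \<sigma>" and l: "lower \<sigma> x"
  obtains u st' B where "st = u # st'" "B \<in> \<sigma>" "u \<in> B" "x \<in> B"
proof -
  obtain B z where B: "B \<in> \<sigma>" "x \<in> B" "z \<in> B" "pos z < pos x" using l unfolding lower_def by blast
  then have z: "z \<in> set st"
    using block_subset[OF stackedD(1)[OF s] B(1,3)] incD(2)[OF i, of z] by auto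
  then obtain u st' where st: "st = u # st'" by (cases st) auto
  obtain C where C: "C \<in> \<sigma>" "u \<in> C" using block_exists[OF stackedD(1)[OF s], of u] st by auto
  have "u \<in> B"
  proof (rule ccontr)
    assume u: "u \<notin> B"
    then have BC: "B \<noteq> C" using C by auto
    have "z \<noteq> u" using u B by auto
    then have "pos z < pos u" using z st incD_top(1)[of u st' "x # ls" z] i by auto
    moreover have "pos u < pos x" using incD(1)[OF i] st by auto
    moreover obtain d where d: "d \<in> set (x # ls)" "d \<in> C" using stackedD(4)[OF s C(1) _ C(2)] st by auto
    have "d \<noteq> x" using block_unique[OF stackedD(1)[OF s] B(1) C(1), of x] B d BC by auto
    then have "pos x < pos d" using d incD(2)[OF i] by auto
    ultimately show False
      using noncrossingD[OF stackedD(2)[OF s] B(1) C(1), of z u x d] B C d BC by auto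
  qed
  then show ?thesis using that st B by blast
qed

lemma stacked_Cl_elim:
  assumes i: "inc (rev st @ x # ls)" and s: "stacked st (x # ls) \<sigma>" and l: "letter \<sigma> x = Cl"
  obtains u st' \<sigma>' where "st = u # st'" "stacked st' ls \<sigma>'" "\<sigma> = insert {u, x} \<sigma>'"
proof -
  obtain u st' B where B: "st = u # st'" "B \<in> \<sigma>" "u \<in> B" "x \<in> B"
    using lower_top[OF i s] l unfolding letter_eq_iff by blast
  have x: "x \<notin> set st' \<union> set ls" "u \<notin> set st' \<union> set ls"
    using incD[OF i] incD_top(1)[of u st' "x # ls"] i B by force+
  have "z = u \<or> z = x" if "z \<in> B" for z
  proof -
    have "\<not> pos x < pos z" using l B that unfolding letter_eq_iff upper_def by blast
    then have "z = x \<or> z \<in> set st"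
      using block_subset[OF stackedD(1)[OF s] B(2) that] incD(2)[OF i, of z] by auto
    then show ?thesis using stackedD(3)[OF s B(2), of u z] B that by auto
  qed
  then have Beq: "B = {u, x}" using B by auto
  have "stacked st' ls (\<sigma> - {{u, x}})"
    using stacked_remove[of "[u]" st' x ls \<sigma>] s B x Beq by (auto simp: insert_commute)
  then show ?thesis using that[of u st' "\<sigma> - {{u, x}}"] B Beq by auto
qed

text \<open>There is no point between the top \<open>u\<close> and \<open>x\<close>. So replacing \<open>x\<close> by \<open>u\<close> keeps the order of points
  from different blocks, and turns a crossing that involves \<open>x\<close> into one that does not.\<close>

lemma stacked_Mi_intro:
  fixes \<sigma> u x
  defines "\<tau> \<equiv> (\<lambda>B. if u \<in> B then insert x B else B) ` \<sigma>"
  assumes i: "inc (rev (u # st) @ x # ls)" and s: "stacked (u # st) ls \<sigma>"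
  shows "stacked (u # st) (x # ls) \<tau>" "letter \<tau> x = Mi"
    "y \<in> set ls \<Longrightarrow> letter \<tau> y = letter \<sigma> y"
    "inj_on (\<lambda>B. if u \<in> B then insert x B else B) \<sigma>"
proof -
  define g where "g = (\<lambda>B. if u \<in> B then insert x B else B)"
  note P = stackedD(1)[OF s]
  have x: "x \<notin> set st \<union> set ls" "u \<notin> set st \<union> set ls" "u \<noteq> x" "pos u < pos x"
    using incD[OF i] incD_top(1)[OF i] by force+
  have nx: "x \<notin> B" if "B \<in> \<sigma>" for B
    using block_subset[OF P that] x by auto
  have g_minus: "g B - {x} = B" if "B \<in> \<sigma>" for B using nx[OF that] by (auto simp: g_def)
  show inj: "inj_on (\<lambda>B. if u \<in> B then insert x B else B) \<sigma>"
    unfolding g_def[symmetric] by (rule inj_on_inverseI[of _ "\<lambda>B. B - {x}"]) (rule g_minus)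
  have tau: "\<tau> = g ` \<sigma>" by (simp add: \<tau>_def g_def)
  have ing: "z \<in> g B \<longleftrightarrow> z \<in> B \<or> (z = x \<and> u \<in> B)" for z B by (auto simp: g_def)
  obtain U where U: "U \<in> \<sigma>" "u \<in> U" using block_exists[OF P, of u] by auto
  obtain y0 where y0: "y0 \<in> set ls" "y0 \<in> U" using stackedD(4)[OF s U(1), of u] U by auto
  show "letter \<tau> x = Mi"
  proof -
    have "g U \<in> \<tau>" "x \<in> g U" "u \<in> g U" "y0 \<in> g U" using U y0 by (auto simp: tau ing)
    then show ?thesis
      unfolding letter_eq_iff lower_def upper_def using incD(2)[OF i y0(1)] x(4) by blast
  qed
  show "letter \<tau> y = letter \<sigma> y" if y: "y \<in> set ls"
  proof -
    have yx: "pos x < pos y" "y \<noteq> x" "pos u < pos y"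
      using incD(2)[OF i y] incD(1)[OF i, of u] by auto
    have "lower \<tau> y = lower \<sigma> y" unfolding lower_def tau using yx by (auto simp: ing Bex_def)
    moreover have "upper \<tau> y = upper \<sigma> y" unfolding upper_def tau using yx by (auto simp: ing Bex_def)
    ultimately show ?thesis by (simp add: letter_def)
  qed
  define r where "r z = (if z = x then u else z)" for z
  have r_in: "r z \<in> B" if "B \<in> \<sigma>" "z \<in> g B" for z B
    using that nx[OF that(1)] by (auto simp: r_def ing)
  have r_mono: "pos (r a) < pos (r b)"
    if "B \<in> \<sigma>" "C \<in> \<sigma>" "B \<noteq> C" "a \<in> g B" "b \<in> g C" "pos a < pos b" for a b B C
  proof -
    have a: "r a \<in> B" "r b \<in> C" using r_in that by auto
    then have "r a \<noteq> r b" using block_unique[OF P that(1,2), of "r a"] that(3) by auto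
    moreover have "pos b < pos u" if "b \<noteq> x" "pos b < pos x" "b \<in> C" "C \<in> \<sigma>" "b \<noteq> u" for b C
      using block_subset[OF P that(4,3)] that incD(2)[OF i, of b] incD_top(1)[OF i, of b] by auto
    ultimately show ?thesis using that x(4) a unfolding r_def ing by (auto split: if_splits)
  qed
  show "stacked (u # st) (x # ls) \<tau>"
    unfolding stacked_def
  proof (intro conjI ballI impI)
    show p: "partition_on (set (u # st) \<union> set (x # ls)) \<tau>"
    proof (rule partition_onI')
      show "{} \<notin> \<tau>" using P by (auto simp: partition_on_def tau g_def)
      show "\<exists>B\<in>\<tau>. z \<in> B" if "z \<in> set (u # st) \<union> set (x # ls)" for z
        using that block_exists[OF P, of z] U unfolding tau by (auto simp: ing)
      show "z \<in> set (u # st) \<union> set (x # ls)" if h: "B \<in> \<tau>" "z \<in> B" for B z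
      proof -
        obtain B' where "B' \<in> \<sigma>" "B = g B'" using h by (auto simp: tau)
        then show ?thesis using h block_subset[OF P, of B' z] by (auto simp: ing)
      qed
      show "B = C" if BC: "B \<in> \<tau>" "C \<in> \<tau>" "z \<in> B" "z \<in> C" for B C z
      proof -
        obtain B' C' where "B' \<in> \<sigma>" "C' \<in> \<sigma>" "B = g B'" "C = g C'" using BC by (auto simp: tau)
        then show ?thesis using block_unique[OF P, of B' C' "r z"] r_in[of _ z] BC by blast
      qed
    qed
    show "noncrossing \<tau>"
    proof (rule noncrossingI)
      fix B C a b c d
      assume *: "B \<in> \<tau>" "C \<in> \<tau>" "B \<noteq> C" "a \<in> B" "b \<in> C" "c \<in> B" "d \<in> C"
        "pos a < pos b" "pos b < pos c" "pos c < pos d"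
      then obtain B' C' where B': "B' \<in> \<sigma>" "C' \<in> \<sigma>" "B = g B'" "C = g C'" by (auto simp: tau)
      then have "B' \<noteq> C'" using * by auto
      then show False
        using noncrossingD[OF stackedD(2)[OF s] B'(1,2), of "r a" "r b" "r c" "r d"]
          r_in[OF B'(1)] r_in[OF B'(2)] r_mono[OF B'(1,2)] r_mono[OF B'(2,1)] * B' by auto
    qed
    fix B u' assume B: "B \<in> \<tau>" "u' \<in> set (u # st)" "u' \<in> B"
    then obtain B' where B': "B' \<in> \<sigma>" "B = g B'" by (auto simp: tau)
    show "u'' = u'" if "u'' \<in> set (u # st)" "u'' \<in> B" for u''
      using B B' that x stackedD(3)[OF s B'(1), of u' u''] by (auto simp: ing)
    show "\<exists>y\<in>set (x # ls). y \<in> B" using stackedD(4)[OF s B'(1), of u'] B B' x by (auto simp: ing)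
  qed
qed

lemma stacked_Mi_elim:
  assumes i: "inc (rev st @ x # ls)" and s: "stacked st (x # ls) \<sigma>" and l: "letter \<sigma> x = Mi"
  obtains u st' \<sigma>' where "st = u # st'" "stacked st ls \<sigma>'"
    "\<sigma> = (\<lambda>B. if u \<in> B then insert x B else B) ` \<sigma>'"
proof -
  obtain u st' B where B: "st = u # st'" "B \<in> \<sigma>" "u \<in> B" "x \<in> B"
    using lower_top[OF i s] l unfolding letter_eq_iff by blast
  note P = stackedD(1)[OF s]
  have x: "x \<notin> set st \<union> set ls" using incD[OF i] by force
  have ux: "u \<in> C \<longleftrightarrow> x \<in> C" if "C \<in> \<sigma>" for C
    using block_unique[OF P that B(2)] B by blast
  have xB: "C = B" if "C \<in> \<sigma>" "x \<in> C" for C using block_unique[OF P that(1) B(2) that(2) B(4)] .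
  have ne: "u \<noteq> x" using x B by auto
  define \<sigma>' where "\<sigma>' = (\<lambda>C. C - {x}) ` \<sigma>"
  have "(\<lambda>B. if u \<in> B then insert x B else B) ` \<sigma>' = (\<lambda>C. C) ` \<sigma>"
    unfolding \<sigma>'_def image_image using ux ne by (intro image_cong) auto
  then have eq: "\<sigma> = (\<lambda>B. if u \<in> B then insert x B else B) ` \<sigma>'" by simp
  have "stacked st ls \<sigma>'"
    unfolding stacked_def
  proof (intro conjI ballI impI)
    show "partition_on (set st \<union> set ls) \<sigma>'"
    proof (rule partition_onI')
      have "{x} \<notin> \<sigma>" using ux ne by blast
      moreover have "{} \<notin> \<sigma>" using P by (simp add: partition_on_def)
      ultimately have "\<not> C \<subseteq> {x}" if "C \<in> \<sigma>" for C
        using that by (metis subset_singleton_iff)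
      then show "{} \<notin> \<sigma>'" by (auto simp: \<sigma>'_def)
      show "\<exists>B\<in>\<sigma>'. z \<in> B" if "z \<in> set st \<union> set ls" for z
        using that block_exists[OF P, of z] x unfolding \<sigma>'_def by auto
      show "z \<in> set st \<union> set ls" if h: "C \<in> \<sigma>'" "z \<in> C" for C z
      proof -
        obtain C' where "C' \<in> \<sigma>" "C = C' - {x}" using h by (auto simp: \<sigma>'_def)
        then show ?thesis using h block_subset[OF P, of C' z] by auto
      qed
      show "C = D" if CD: "C \<in> \<sigma>'" "D \<in> \<sigma>'" "z \<in> C" "z \<in> D" for C D z
      proof -
        obtain C' D' where "C' \<in> \<sigma>" "D' \<in> \<sigma>" "C = C' - {x}" "D = D' - {x}" using CD by (auto simp: \<sigma>'_def)
        then show ?thesis using block_unique[OF P, of C' D' z] CD by auto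
      qed
    qed
    show "noncrossing \<sigma>'"
    proof (rule noncrossingI)
      fix C D a b c d
      assume *: "C \<in> \<sigma>'" "D \<in> \<sigma>'" "C \<noteq> D" "a \<in> C" "b \<in> D" "c \<in> C" "d \<in> D"
        "pos a < pos b" "pos b < pos c" "pos c < pos d"
      then obtain C' D' where "C' \<in> \<sigma>" "D' \<in> \<sigma>" "C = C' - {x}" "D = D' - {x}" by (auto simp: \<sigma>'_def)
      then show False using noncrossingD[OF stackedD(2)[OF s], of C' D' a b c d] * by auto
    qed
    fix C v assume C: "C \<in> \<sigma>'" "v \<in> set st" "v \<in> C"
    then obtain C' where C': "C' \<in> \<sigma>" "C = C' - {x}" by (auto simp: \<sigma>'_def)
    show "v' = v" if "v' \<in> set st" "v' \<in> C" for v'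
      using C C' that stackedD(3)[OF s C'(1), of v v'] by auto
    show "\<exists>y\<in>set ls. y \<in> C"
    proof (cases "x \<in> C'")
      case True
      obtain z where "z \<in> B" "pos x < pos z"
        using l xB unfolding letter_eq_iff upper_def by blast
      moreover have "C' = B" using xB C' True by blast
      moreover have "z \<in> set ls"
        using block_subset[OF P B(2), of z] \<open>z \<in> B\<close> \<open>pos x < pos z\<close> incD(1)[OF i, of z] by auto
      ultimately show ?thesis using C' by auto
    next
      case False
      then show ?thesis using stackedD(4)[OF s C'(1) C(2)] C C' by auto
    qed
  qed
  then show ?thesis using that B eq by blast
qed

theorem build_correct:
  assumes "inc (rev st @ ls)" and "length w = length ls" and "lpath UNIV (length st) w"
  shows "stacked st ls (build st ls w) \<and> map (letter (build st ls w)) ls = w"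
  using assms
proof (induction w arbitrary: st ls)
  case Nil
  then show ?case by (simp add: stacked_Nil)
next
  case (Cons l w)
  then obtain x ls' where ls: "ls = x # ls'" by (cases ls) auto
  have i: "inc (rev st @ x # ls')" using Cons ls by simp
  show ?case
  proof (cases l)
    case Op
    then have "stacked (x # st) ls' (build (x # st) ls' w) \<and> map (letter (build (x # st) ls' w)) ls' = w"
      using Cons ls incD(4)[OF i] by (intro Cons.IH) auto
    then show ?thesis using Op stacked_Op[OF i] ls by auto
  next
    case Si
    then have "stacked st ls' (build st ls' w) \<and> map (letter (build st ls' w)) ls' = w"
      using Cons ls incD(5)[OF i] by (intro Cons.IH) auto
    then show ?thesis using Si stacked_Si_intro[OF i] ls by (auto cong: map_cong)
  next
    case Cl
    then obtain u st' where st: "st = u # st'" using Cons by (cases st) auto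
    have i': "inc (rev (u # st') @ x # ls')" using i st by simp
    have "stacked st' ls' (build st' ls' w) \<and> map (letter (build st' ls' w)) ls' = w"
      using Cons ls st Cl incD_top(2)[OF incD(5)[OF i']] by (intro Cons.IH) auto
    then show ?thesis using Cl stacked_Cl_intro[OF i'] ls st by (auto cong: map_cong)
  next
    case Mi
    then obtain u st' where st: "st = u # st'" using Cons by (cases st) auto
    have i': "inc (rev (u # st') @ x # ls')" using i st by simp
    have "stacked st ls' (build st ls' w) \<and> map (letter (build st ls' w)) ls' = w"
      using Cons ls Mi incD(5)[OF i] by (intro Cons.IH) auto
    then show ?thesis using Mi stacked_Mi_intro[OF i'] ls st by (auto cong: map_cong)
  qed
qed

theorem word_correct:
  assumes "inc (rev st @ ls)" and "stacked st ls \<sigma>"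
  shows "lpath UNIV (length st) (map (letter \<sigma>) ls) \<and> build st ls (map (letter \<sigma>) ls) = \<sigma>"
  using assms
proof (induction ls arbitrary: st \<sigma>)
  case Nil
  then show ?case by (simp add: stacked_Nil)
next
  case (Cons x ls)
  note i = Cons.prems(1) and s = Cons.prems(2)
  show ?case
  proof (cases "letter \<sigma> x")
    case Op
    then have "stacked (x # st) ls \<sigma>" using stacked_Op[OF i] s by auto
    from Cons.IH[OF incD(4)[OF i] this] show ?thesis using Op by auto
  next
    case Si
    then obtain \<sigma>' where \<sigma>': "stacked st ls \<sigma>'" "\<sigma> = insert {x} \<sigma>'" using stacked_Si_elim[OF i s] by auto
    have eq: "map (letter \<sigma>) (x # ls) = Si # map (letter \<sigma>') ls"
      using stacked_Si_intro(3)[OF i \<sigma>'(1)] \<sigma>'(2) Si by simp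
    show ?thesis unfolding eq using Cons.IH[OF incD(5)[OF i] \<sigma>'(1)] by (simp add: \<sigma>'(2)[symmetric])
  next
    case Cl
    then obtain u st' \<sigma>' where \<sigma>': "st = u # st'" "stacked st' ls \<sigma>'" "\<sigma> = insert {u, x} \<sigma>'"
      using stacked_Cl_elim[OF i s] by auto
    have i': "inc (rev (u # st') @ x # ls)" using i \<sigma>' by simp
    have eq: "map (letter \<sigma>) (x # ls) = Cl # map (letter \<sigma>') ls"
      using stacked_Cl_intro(3)[OF i' \<sigma>'(2)] \<sigma>'(3) Cl by simp
    show ?thesis unfolding eq using Cons.IH[OF incD_top(2)[OF incD(5)[OF i']] \<sigma>'(2)]
      by (simp add: \<sigma>'(1) \<sigma>'(3)[symmetric])
  next
    case Mi
    then obtain u st' \<sigma>' where \<sigma>': "st = u # st'" "stacked st ls \<sigma>'"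
      "\<sigma> = (\<lambda>B. if u \<in> B then insert x B else B) ` \<sigma>'"
      using stacked_Mi_elim[OF i s] by auto
    have i': "inc (rev (u # st') @ x # ls)" using i \<sigma>' by simp
    have eq: "map (letter \<sigma>) (x # ls) = Mi # map (letter \<sigma>') ls"
      using stacked_Mi_intro(3)[OF i', of \<sigma>'] \<sigma>' Mi by simp
    show ?thesis unfolding eq using Cons.IH[OF incD(5)[OF i] \<sigma>'(2)]
      by (simp add: \<sigma>'(1) \<sigma>'(3)[symmetric] del: if_image_distrib)
  qed
qed

lemma bij_betw_word:
  assumes "inc (rev st @ ls)"
  shows "bij_betw (\<lambda>\<sigma>. map (letter \<sigma>) ls) {\<sigma>. stacked st ls \<sigma>}
    {w. length w = length ls \<and> lpath UNIV (length st) w}"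
  using word_correct[OF assms] build_correct[OF assms]
  by (intro bij_betwI[where g = "build st ls"]) auto

lemma card_build:
  assumes "inc (rev st @ ls)" and "length w = length ls" and "lpath UNIV (length st) w"
  shows "card (build st ls w) = length st + count_list w Op + count_list w Si"
  using assms
proof (induction w arbitrary: st ls)
  case (Cons l w)
  then obtain x ls' where ls: "ls = x # ls'" by (cases ls) auto
  have i: "inc (rev st @ x # ls')" using Cons ls by simp
  have fin: "finite (build st' ls' w)" if "stacked st' ls' (build st' ls' w)" for st'
    using finite_elements[OF _ stackedD(1)[OF that]] by simp
  show ?case
  proof (cases l)
    case Op
    have "card (build (x # st) ls' w) = length (x # st) + count_list w Op + count_list w Si"
      using Cons ls Op incD(4)[OF i] by (intro Cons.IH) auto
    then show ?thesis using Op ls by simp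
  next
    case Si
    have "stacked st ls' (build st ls' w)"
      using build_correct[OF incD(5)[OF i], of w] Cons.prems ls Si by auto
    moreover have "x \<notin> set st \<union> set ls'" using incD(1,2)[OF i] by force
    ultimately have "{x} \<notin> build st ls' w" "finite (build st ls' w)"
      using block_subset[OF stackedD(1)] fin by blast+
    moreover have "card (build st ls' w) = length st + count_list w Op + count_list w Si"
      using Cons ls Si incD(5)[OF i] by (intro Cons.IH) auto
    ultimately show ?thesis using Si ls by simp
  next
    case Cl
    then obtain u st' where st: "st = u # st'" using Cons by (cases st) auto
    have i': "inc (rev (u # st') @ x # ls')" using i st by simp
    have i'': "inc (rev st' @ ls')" by (rule incD_top(2)[OF incD(5)[OF i']])
    have s: "stacked st' ls' (build st' ls' w)"
      using build_correct[OF i'', of w] Cons.prems ls Cl st by auto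
    have "card (build st' ls' w) = length st' + count_list w Op + count_list w Si"
      using Cons ls Cl st i'' by (intro Cons.IH) auto
    then show ?thesis using Cl ls st fin[OF s] stacked_Cl_intro(4)[OF i' s] by simp
  next
    case Mi
    then obtain u st' where st: "st = u # st'" using Cons by (cases st) auto
    have i': "inc (rev (u # st') @ x # ls')" using i st by simp
    have s: "stacked st ls' (build st ls' w)"
      using build_correct[OF incD(5)[OF i], of w] Cons.prems ls Mi by auto
    have "card (build st ls' w) = length st + count_list w Op + count_list w Si"
      using Cons ls Mi incD(5)[OF i] by (intro Cons.IH) auto
    then show ?thesis using Mi ls st stacked_Mi_intro(4)[OF i'] s
      by (simp add: card_image del: if_image_distrib)
  qed
qed auto

text \<open>Whether a colouring is constant on blocks can be decided while reading the word: \<open>st\<close> contains the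
  colours of the open blocks.\<close>

fun coherent :: "'c list \<Rightarrow> letter list \<Rightarrow> 'c list \<Rightarrow> bool" where
  "coherent st [] [] \<longleftrightarrow> st = []"
| "coherent st (Op # w) (a # zs) \<longleftrightarrow> coherent (a # st) w zs"
| "coherent st (Si # w) (a # zs) \<longleftrightarrow> coherent st w zs"
| "coherent (b # st) (Cl # w) (a # zs) \<longleftrightarrow> a = b \<and> coherent st w zs"
| "coherent (b # st) (Mi # w) (a # zs) \<longleftrightarrow> a = b \<and> coherent (b # st) w zs"
| "coherent _ _ _ \<longleftrightarrow> False"

lemma coherent_iff_constant:
  assumes "inc (rev st @ ls)" and "length w = length ls" and "lpath UNIV (length st) w"
  shows "coherent (map \<phi> st) w (map \<phi> ls) \<longleftrightarrow> (\<forall>B\<in>build st ls w. \<forall>a\<in>B. \<forall>b\<in>B. \<phi> a = \<phi> b)"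
  using assms
proof (induction w arbitrary: st ls)
  case (Cons l w)
  then obtain x ls' where ls: "ls = x # ls'" by (cases ls) auto
  have i: "inc (rev st @ x # ls')" using Cons ls by simp
  show ?case
  proof (cases l)
    case Op
    then show ?thesis using Cons.prems(2,3) ls Cons.IH[OF incD(4)[OF i]] by simp
  next
    case Si
    then show ?thesis using Cons.prems(2,3) ls Cons.IH[OF incD(5)[OF i]] by simp
  next
    case Cl
    then obtain u st' where st: "st = u # st'" using Cons by (cases st) auto
    have i': "inc (rev (u # st') @ x # ls')" using i st by simp
    have i'': "inc (rev st' @ ls')" by (rule incD_top(2)[OF incD(5)[OF i']])
    have "(\<forall>B\<in>build st ls (l # w). \<forall>a\<in>B. \<forall>b\<in>B. \<phi> a = \<phi> b) \<longleftrightarrow>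
      \<phi> x = \<phi> u \<and> (\<forall>B\<in>build st' ls' w. \<forall>a\<in>B. \<forall>b\<in>B. \<phi> a = \<phi> b)"
      by (simp only: ls Cl st build.simps ball_simps bex_simps) metis
    also have "\<dots> \<longleftrightarrow> \<phi> x = \<phi> u \<and> coherent (map \<phi> st') w (map \<phi> ls')"
      using Cons.IH[OF i''] Cons.prems(2,3) ls Cl st by simp
    also have "\<dots> \<longleftrightarrow> coherent (map \<phi> st) (l # w) (map \<phi> ls)"
      by (simp add: ls Cl st)
    finally show ?thesis ..
  next
    case Mi
    then obtain u st' where st: "st = u # st'" using Cons by (cases st) auto
    have s: "stacked st ls' (build st ls' w)"
      using build_correct[OF incD(5)[OF i], of w] Cons.prems ls Mi by auto
    obtain U where U: "U \<in> build st ls' w" "u \<in> U"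
      using block_exists[OF stackedD(1)[OF s], of u] st by auto
    have "(\<forall>B\<in>build st ls (l # w). \<forall>a\<in>B. \<forall>b\<in>B. \<phi> a = \<phi> b) \<longleftrightarrow>
      (\<forall>B\<in>build st ls' w. \<forall>a\<in>if u \<in> B then insert x B else B.
         \<forall>b\<in>if u \<in> B then insert x B else B. \<phi> a = \<phi> b)"
      by (simp add: ls Mi st del: if_image_distrib)
    also have "\<dots> \<longleftrightarrow> (\<forall>B\<in>build st ls' w. (\<forall>a\<in>B. \<forall>b\<in>B. \<phi> a = \<phi> b) \<and> (u \<in> B \<longrightarrow> \<phi> x = \<phi> u))"
    proof (rule ball_cong[OF refl])
      fix B
      show "(\<forall>a\<in>if u \<in> B then insert x B else B. \<forall>b\<in>if u \<in> B then insert x B else B. \<phi> a = \<phi> b) \<longleftrightarrow>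
        (\<forall>a\<in>B. \<forall>b\<in>B. \<phi> a = \<phi> b) \<and> (u \<in> B \<longrightarrow> \<phi> x = \<phi> u)"
      proof (cases "u \<in> B")
        case True
        then show ?thesis by (simp only: if_True) (metis insert_iff)
      qed simp
    qed
    also have "\<dots> \<longleftrightarrow> (\<forall>B\<in>build st ls' w. \<forall>a\<in>B. \<forall>b\<in>B. \<phi> a = \<phi> b) \<and> \<phi> x = \<phi> u"
      using U by blast
    also have "\<dots> \<longleftrightarrow> coherent (map \<phi> st) w (map \<phi> ls') \<and> \<phi> x = \<phi> u"
      using Cons.IH[OF incD(5)[OF i]] Cons.prems(2,3) ls Mi by simp
    also have "\<dots> \<longleftrightarrow> coherent (map \<phi> st) (l # w) (map \<phi> ls)"
      by (auto simp: ls Mi st)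
    finally show ?thesis ..
  qed
qed auto


section \<open>Epi as words\<close>

definition ups :: "nat \<Rightarrow> point list" where
  "ups r = map Inl [0..<r]"

definition lows :: "nat \<Rightarrow> point list" where
  "lows k = map Inr [0..<k]"

abbreviation word :: "nat \<Rightarrow> point set set \<Rightarrow> letter list" where
  "word k \<sigma> \<equiv> map (letter \<sigma>) (lows k)"

lemma length_ups_lows [simp]: "length (ups r) = r" "length (lows k) = k"
  by (simp_all add: ups_def lows_def)

lemma set_ups_lows: "set (ups r) \<union> set (lows k) = points r k"
  by (auto simp: ups_def lows_def points_def)

lemma inc_ups_lows: "inc (rev (ups r) @ lows k)"
proof -
  have "sorted_wrt (\<lambda>x y. pos y < pos x) (ups r)"
    unfolding ups_def sorted_wrt_map by (rule sorted_wrt_mono_rel[OF _ sorted_wrt_upt]) auto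
  moreover have "sorted_wrt (\<lambda>x y. pos x < pos y) (lows k)"
    unfolding lows_def sorted_wrt_map by (rule sorted_wrt_mono_rel[OF _ sorted_wrt_upt]) auto
  ultimately show ?thesis
    by (auto simp: inc_def sorted_wrt_append sorted_wrt_rev) (auto simp: ups_def lows_def)
qed

lemma epi_rank_Ps_plus: "epi_rank Ps_plus r k = {\<sigma>. stacked (ups r) (lows k) \<sigma>}"
proof (intro equalityI subsetI)
  fix \<sigma> assume "\<sigma> \<in> epi_rank Ps_plus r k"
  then have s: "partition_on (points r k) \<sigma>" "noncrossing \<sigma>"
    "\<And>B i. B \<in> \<sigma> \<Longrightarrow> Inl i \<in> B \<Longrightarrow> (\<forall>i'. Inl i' \<in> B \<longrightarrow> i' = i) \<and> (\<exists>j. Inr j \<in> B)"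
    by (auto simp: epi_rank_def Ps_plus_def)
  have "stacked (ups r) (lows k) \<sigma>"
    unfolding stacked_def set_ups_lows
  proof (intro conjI ballI impI)
    fix B u assume B: "B \<in> \<sigma>" "u \<in> set (ups r)" "u \<in> B"
    then obtain i where u: "u = Inl i" by (auto simp: ups_def)
    have iB: "Inl i \<in> B" using B u by simp
    show "u' = u" if u': "u' \<in> set (ups r)" "u' \<in> B" for u'
    proof -
      obtain i' where "u' = Inl i'" using u' by (auto simp: ups_def)
      then show ?thesis using conjunct1[OF s(3)[OF B(1) iB], rule_format, of i'] u'(2) u by simp
    qed
    obtain j where j: "Inr j \<in> B" using conjunct2[OF s(3)[OF B(1) iB]] ..
    have "Inr j \<in> points r k" by (rule block_subset[OF s(1) B(1) j])
    then show "\<exists>y\<in>set (lows k). y \<in> B" using j by (auto simp: lows_def points_def)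
  qed (use s in auto)
  then show "\<sigma> \<in> {\<sigma>. stacked (ups r) (lows k) \<sigma>}" by simp
next
  fix \<sigma> assume "\<sigma> \<in> {\<sigma>. stacked (ups r) (lows k) \<sigma>}"
  then have s: "stacked (ups r) (lows k) \<sigma>" by simp
  have p: "partition_on (points r k) \<sigma>" using stackedD(1)[OF s] by (simp add: set_ups_lows)
  have up: "Inl i \<in> set (ups r)" if "B \<in> \<sigma>" "Inl i \<in> B" for B i
    using block_subset[OF p that] by (auto simp: points_def ups_def)
  have "(\<forall>i'. Inl i' \<in> B \<longrightarrow> i' = i) \<and> (\<exists>j. Inr j \<in> B)" if B: "B \<in> \<sigma>" "Inl i \<in> B" for B i
  proof
    show "\<forall>i'. Inl i' \<in> B \<longrightarrow> i' = i"
    proof (intro allI impI)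
      fix i' assume i': "Inl i' \<in> B"
      have "(Inl i' :: point) = Inl i"
        by (rule stackedD(3)[OF s B(1) up[OF B] up[OF B(1) i'] B(2) i'])
      then show "i' = i" by simp
    qed
    show "\<exists>j. Inr j \<in> B" using stackedD(4)[OF s B(1) up[OF B] B(2)] by (auto simp: lows_def)
  qed
  then show "\<sigma> \<in> epi_rank Ps_plus r k"
    using p stackedD(2)[OF s] by (auto simp: epi_rank_def Ps_plus_def)
qed

text \<open>A block with more than two elements has an element between its least and greatest one. This element
  lies in \<open>ls\<close>, because a point of the stack is the least element of its block.\<close>

lemma Mi_iff_large_block:
  assumes i: "inc (rev st @ ls)" and s: "stacked st ls \<sigma>"
  shows "Mi \<in> letter \<sigma> ` set ls \<longleftrightarrow> (\<exists>B\<in>\<sigma>. card B > 2)"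
proof -
  note P = stackedD(1)[OF s]
  have fin: "finite B" if "B \<in> \<sigma>" for B
    by (rule finite_subset[of _ "set st \<union> set ls"]) (use block_subset[OF P that] in auto)
  show ?thesis
  proof
    assume "Mi \<in> letter \<sigma> ` set ls"
    then obtain y where "lower \<sigma> y" "upper \<sigma> y" by (metis imageE letter_eq_iff(4))
    then obtain B C z z' where *: "B \<in> \<sigma>" "y \<in> B" "z \<in> B" "pos z < pos y" "C \<in> \<sigma>" "y \<in> C" "z' \<in> C" "pos y < pos z'"
      unfolding lower_def upper_def by blast
    then have "C = B" using block_unique[OF P] by blast
    then have "{z, y, z'} \<subseteq> B" using * by auto
    moreover have "card {z, y, z'} = 3" using * by (auto simp: card_insert_if)
    ultimately have "card B > 2" using card_mono[OF fin[OF *(1)], of "{z, y, z'}"] by auto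
    then show "\<exists>B\<in>\<sigma>. card B > 2" using * by blast
  next
    assume "\<exists>B\<in>\<sigma>. card B > 2"
    then obtain B where B: "B \<in> \<sigma>" "card B > 2" by auto
    then have ne: "B \<noteq> {}" by auto
    have "Min (pos ` B) \<in> pos ` B" "Max (pos ` B) \<in> pos ` B" using fin[OF B(1)] ne by auto
    then obtain m M where m: "m \<in> B" "pos m = Min (pos ` B)" "M \<in> B" "pos M = Max (pos ` B)" by force
    have "\<not> B \<subseteq> {m, M}" using B(2) card_mono[of "{m, M}" B] card_insert_le_m1[of 2 "{M}" m] by auto
    then obtain b where b: "b \<in> B" "b \<noteq> m" "b \<noteq> M" by auto
    have "pos m \<le> pos b" "pos b \<le> pos M" using m b fin[OF B(1)] by auto
    then have lt: "pos m < pos b" "pos b < pos M" using b pos_inject[of m b] pos_inject[of b M] by force+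
    then have "lower \<sigma> b" "upper \<sigma> b" using B m b unfolding lower_def upper_def by blast+
    then have l: "letter \<sigma> b = Mi" by (simp add: letter_eq_iff)
    have "b \<in> set ls"
    proof (rule ccontr)
      assume "b \<notin> set ls"
      then have bs: "b \<in> set st" using block_subset[OF P B(1) b(1)] by auto
      then have "m \<notin> set st" using stackedD(3)[OF s B(1) bs _ b(1) m(1)] b(2) by blast
      then have "m \<in> set ls" using block_subset[OF P B(1) m(1)] by auto
      then have "pos b < pos m" using i bs by (auto simp: inc_def sorted_wrt_append)
      then show False using lt by simp
    qed
    then show "Mi \<in> letter \<sigma> ` set ls" using l by (metis imageI)
  qed
qed

lemma Si_iff_singleton_block:
  assumes i: "inc (rev st @ ls)" and s: "stacked st ls \<sigma>"
  shows "Si \<in> letter \<sigma> ` set ls \<longleftrightarrow> (\<exists>B\<in>\<sigma>. card B = 1)"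
proof
  note P = stackedD(1)[OF s]
  assume "Si \<in> letter \<sigma> ` set ls"
  then obtain y where y: "y \<in> set ls" "\<not> lower \<sigma> y" "\<not> upper \<sigma> y" by (metis imageE letter_eq_iff(3))
  obtain B where B: "B \<in> \<sigma>" "y \<in> B" using block_exists[OF P, of y] y by auto
  have "z = y" if "z \<in> B" for z
  proof -
    have "\<not> pos z < pos y" "\<not> pos y < pos z"
      using y(2,3) B that unfolding lower_def upper_def by blast+
    then show ?thesis using pos_inject[of z y] by auto
  qed
  then have "B = {y}" using B(2) by blast
  then show "\<exists>B\<in>\<sigma>. card B = 1" using B(1) by (intro bexI[of _ B]) simp_all
next
  note P = stackedD(1)[OF s]
  assume "\<exists>B\<in>\<sigma>. card B = 1"
  then obtain y where y: "{y} \<in> \<sigma>" by (auto simp: card_1_singleton_iff)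
  have "\<not> lower \<sigma> y" "\<not> upper \<sigma> y"
    using block_unique[OF P y] unfolding lower_def upper_def by fastforce+
  then have l: "letter \<sigma> y = Si" by (simp add: letter_eq_iff)
  have "y \<in> set ls"
  proof (rule ccontr)
    assume "y \<notin> set ls"
    then show False using block_subset[OF P y, of y] stackedD(4)[OF s y, of y] by auto
  qed
  then show "Si \<in> letter \<sigma> ` set ls" using l by (metis imageI)
qed

lemma epi_rank_by_letters:
  "epi_rank Ps_plus r k = {\<sigma>. stacked (ups r) (lows k) \<sigma> \<and> set (word k \<sigma>) \<subseteq> UNIV}"
  "epi_rank Pb_plus r k = {\<sigma>. stacked (ups r) (lows k) \<sigma> \<and> set (word k \<sigma>) \<subseteq> {Op, Cl, Si}}"
  "epi_rank Po_plus r k = {\<sigma>. stacked (ups r) (lows k) \<sigma> \<and> set (word k \<sigma>) \<subseteq> {Op, Cl}}"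
proof -
  show "epi_rank Ps_plus r k = {\<sigma>. stacked (ups r) (lows k) \<sigma> \<and> set (word k \<sigma>) \<subseteq> UNIV}"
    by (simp add: epi_rank_Ps_plus)
  have "l \<in> {Op, Cl, Si} \<longleftrightarrow> l \<in> - {Mi}" "l \<in> {Op, Cl} \<longleftrightarrow> l \<in> - {Mi, Si}" for l by (cases l; simp)+
  then have compl: "{Op, Cl, Si} = - {Mi}" "{Op, Cl} = - {Mi, Si}" by blast+
  have b: "set (word k \<sigma>) \<subseteq> {Op, Cl, Si} \<longleftrightarrow> Mi \<notin> letter \<sigma> ` set (lows k)" for \<sigma>
    unfolding compl(1) set_map by blast
  have o: "set (word k \<sigma>) \<subseteq> {Op, Cl} \<longleftrightarrow> Mi \<notin> letter \<sigma> ` set (lows k) \<and> Si \<notin> letter \<sigma> ` set (lows k)" for \<sigma>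
    unfolding compl(2) set_map by blast
  have pos: "card B > 0" if "stacked (ups r) (lows k) \<sigma>" "B \<in> \<sigma>" for \<sigma> B
  proof -
    have "finite B"
      by (rule finite_subset[of _ "set (ups r) \<union> set (lows k)"])
        (use block_subset[OF stackedD(1)[OF that(1)] that(2)] in auto)
    moreover have "B \<noteq> {}" using stackedD(1)[OF that(1)] that(2) by (auto simp: partition_on_def)
    ultimately show ?thesis by (simp add: card_gt_0_iff)
  qed
  have "epi_rank Pb_plus r k = {\<sigma> \<in> epi_rank Ps_plus r k. \<forall>B\<in>\<sigma>. card B = 1 \<or> card B = 2}"
    by (auto simp: epi_rank_def Pb_plus_def)
  also have "\<dots> = {\<sigma>. stacked (ups r) (lows k) \<sigma> \<and> set (word k \<sigma>) \<subseteq> {Op, Cl, Si}}"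
    unfolding epi_rank_Ps_plus b
  proof (intro Collect_eqI)
    fix \<sigma>
    show "\<sigma> \<in> {\<sigma>. stacked (ups r) (lows k) \<sigma>} \<and> (\<forall>B\<in>\<sigma>. card B = 1 \<or> card B = 2) \<longleftrightarrow>
      stacked (ups r) (lows k) \<sigma> \<and> Mi \<notin> letter \<sigma> ` set (lows k)"
    proof (cases "stacked (ups r) (lows k) \<sigma>")
      case True
      have "(\<forall>B\<in>\<sigma>. card B = 1 \<or> card B = 2) \<longleftrightarrow> (\<forall>B\<in>\<sigma>. \<not> card B > 2)"
        by (rule ball_cong[OF refl]) (use pos[OF True] in force)
      then show ?thesis using True Mi_iff_large_block[OF inc_ups_lows True] by simp
    qed simp
  qed
  finally show "epi_rank Pb_plus r k = {\<sigma>. stacked (ups r) (lows k) \<sigma> \<and> set (word k \<sigma>) \<subseteq> {Op, Cl, Si}}" .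
  have "epi_rank Po_plus r k = {\<sigma> \<in> epi_rank Ps_plus r k. \<forall>B\<in>\<sigma>. card B = 2}"
    by (auto simp: epi_rank_def Po_plus_def)
  also have "\<dots> = {\<sigma>. stacked (ups r) (lows k) \<sigma> \<and> set (word k \<sigma>) \<subseteq> {Op, Cl}}"
    unfolding epi_rank_Ps_plus o
  proof (intro Collect_eqI)
    fix \<sigma>
    show "\<sigma> \<in> {\<sigma>. stacked (ups r) (lows k) \<sigma>} \<and> (\<forall>B\<in>\<sigma>. card B = 2) \<longleftrightarrow>
      stacked (ups r) (lows k) \<sigma> \<and> Mi \<notin> letter \<sigma> ` set (lows k) \<and> Si \<notin> letter \<sigma> ` set (lows k)"
    proof (cases "stacked (ups r) (lows k) \<sigma>")
      case True
      have "(\<forall>B\<in>\<sigma>. card B = 2) \<longleftrightarrow> (\<forall>B\<in>\<sigma>. \<not> card B > 2 \<and> card B \<noteq> 1)"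
        by (rule ball_cong[OF refl]) (use pos[OF True] in force)
      then show ?thesis
        using True Mi_iff_large_block[OF inc_ups_lows True] Si_iff_singleton_block[OF inc_ups_lows True]
        by auto
    qed simp
  qed
  finally show "epi_rank Po_plus r k = {\<sigma>. stacked (ups r) (lows k) \<sigma> \<and> set (word k \<sigma>) \<subseteq> {Op, Cl}}" .
qed

lemma epi_rank_0: "epi_rank Ps_plus 0 k = Ps_plus 0 k" "epi_rank Pb_plus 0 k = Pb_plus 0 k"
  "epi_rank Po_plus 0 k = Po_plus 0 k"
proof -
  have "Inl i \<notin> B" if "partition_on (points 0 k) \<sigma>" "B \<in> \<sigma>" for \<sigma> :: "point set set" and B and i :: nat
    using block_subset[OF that, of "Inl i"] by (auto simp: points_def)
  then show "epi_rank Ps_plus 0 k = Ps_plus 0 k" "epi_rank Pb_plus 0 k = Pb_plus 0 k"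
    "epi_rank Po_plus 0 k = Po_plus 0 k"
    unfolding epi_rank_def Ps_plus_def Pb_plus_def Po_plus_def by blast+
qed

definition words :: "letter set \<Rightarrow> nat \<Rightarrow> nat \<Rightarrow> letter list set" where
  "words L k r = {w. length w = k \<and> lpath L r w}"

text \<open>For each of the three families: epi of rank \<open>r\<close> correspond to the words from height \<open>r\<close> to \<open>0\<close>
  in the letters of the family.\<close>

lemma bij_betw_words:
  assumes "epi_rank P r k = {\<sigma>. stacked (ups r) (lows k) \<sigma> \<and> set (word k \<sigma>) \<subseteq> L}"
  shows "bij_betw (word k) (epi_rank P r k) (words L k r)"
proof -
  note bij = bij_betw_word[OF inc_ups_lows, of k r]
  have img: "word k ` {\<sigma>. stacked (ups r) (lows k) \<sigma>} = {w. length w = k \<and> lpath UNIV r w}"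
    using bij_betw_imp_surj_on[OF bij] by simp
  have "words L k r = {w \<in> word k ` {\<sigma>. stacked (ups r) (lows k) \<sigma>}. set w \<subseteq> L}"
    unfolding img words_def by (subst lpath_restrict) auto
  also have "\<dots> = word k ` epi_rank P r k"
    unfolding assms by blast
  finally show ?thesis
    using bij_betw_imp_inj_on[OF bij] unfolding bij_betw_def assms by (auto simp: inj_on_def)
qed

section \<open>Joins and two-colourings\<close>

text \<open>A set that contains or avoids each block of \<open>\<pi>\<close> and \<open>\<sigma>\<close> is a union of blocks of the join: the
  partition into the set and its complement is coarser than \<open>\<pi>\<close> and \<open>\<sigma>\<close>, hence coarser than the join.\<close>

lemma two_power_card_join:
  assumes p: "partition_on A \<pi>" "partition_on A \<sigma>" and fin: "finite A"
  shows "2 ^ card (part_join A \<pi> \<sigma>) =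
    card {X. X \<subseteq> A \<and> (\<forall>B\<in>\<pi> \<union> \<sigma>. B \<subseteq> X \<or> B \<inter> X = {})}"
proof -
  define \<tau> where "\<tau> = part_join A \<pi> \<sigma>"
  have j: "is_join A \<pi> \<sigma> \<tau>" unfolding \<tau>_def by (rule is_join_part_join[OF p])
  then have ref\<tau>: "refines A \<pi> \<tau>" "refines A \<sigma> \<tau>"
    and least: "\<And>\<rho>. refines A \<pi> \<rho> \<Longrightarrow> refines A \<sigma> \<rho> \<Longrightarrow> refines A \<tau> \<rho>"
    unfolding is_join_def by blast+
  from ref\<tau>(1) have t: "partition_on A \<tau>" unfolding refines_def by blast
  have "2 ^ card \<tau> = card (Pow \<tau>)"
    using finite_elements[OF fin t] by (simp add: card_Pow)
  also have "bij_betw \<Union> (Pow \<tau>) {X. X \<subseteq> A \<and> (\<forall>B\<in>\<pi> \<union> \<sigma>. B \<subseteq> X \<or> B \<inter> X = {})}"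
  proof (rule bij_betwI[where g = "\<lambda>X. {B \<in> \<tau>. B \<subseteq> X}"])
    show "\<Union> \<in> Pow \<tau> \<rightarrow> {X. X \<subseteq> A \<and> (\<forall>B\<in>\<pi> \<union> \<sigma>. B \<subseteq> X \<or> B \<inter> X = {})}"
    proof (intro Pi_I CollectI conjI ballI)
      fix \<C> assume "\<C> \<in> Pow \<tau>"
      then have C: "\<C> \<subseteq> \<tau>" by simp
      show "\<Union>\<C> \<subseteq> A" using C partition_onD1[OF t] by auto
      fix B assume "B \<in> \<pi> \<union> \<sigma>"
      then obtain T where T: "T \<in> \<tau>" "B \<subseteq> T" using ref\<tau> unfolding refines_def by blast
      show "B \<subseteq> \<Union>\<C> \<or> B \<inter> \<Union>\<C> = {}"
      proof (cases "T \<in> \<C>")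
        case False
        then have "B \<inter> S = {}" if "S \<in> \<C>" for S
          using block_unique[OF t T(1), of S] that C T(2) by blast
        then show ?thesis by blast
      qed (use T in blast)
    qed
    show "(\<lambda>X. {B \<in> \<tau>. B \<subseteq> X}) \<in> {X. X \<subseteq> A \<and> (\<forall>B\<in>\<pi> \<union> \<sigma>. B \<subseteq> X \<or> B \<inter> X = {})} \<rightarrow> Pow \<tau>"
      by auto
    show "{B \<in> \<tau>. B \<subseteq> \<Union>\<C>} = \<C>" if C: "\<C> \<in> Pow \<tau>" for \<C>
    proof (intro equalityI subsetI)
      fix B assume B: "B \<in> {B \<in> \<tau>. B \<subseteq> \<Union>\<C>}"
      then obtain z where "z \<in> B" using partition_onD3[OF t] by fastforce
      then obtain S where "S \<in> \<C>" "z \<in> S" using B by auto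
      then show "B \<in> \<C>" using block_unique[OF t, of B S z] B C \<open>z \<in> B\<close> by auto
    qed (use C in auto)
  next
    fix X assume "X \<in> {X. X \<subseteq> A \<and> (\<forall>B\<in>\<pi> \<union> \<sigma>. B \<subseteq> X \<or> B \<inter> X = {})}"
    then have X: "X \<subseteq> A" "\<And>B. B \<in> \<pi> \<union> \<sigma> \<Longrightarrow> B \<subseteq> X \<or> B \<inter> X = {}" by auto
    define \<rho> where "\<rho> = {X, A - X} - {{}}"
    have r: "partition_on A \<rho>"
      using X(1) by (intro partition_onI') (auto simp: \<rho>_def)
    have "refines A \<pi>' \<rho>" if "\<pi>' \<in> {\<pi>, \<sigma>}" for \<pi>'
      unfolding refines_def
    proof (intro conjI ballI)
      show p': "partition_on A \<pi>'" using that p by auto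
      show "partition_on A \<rho>" by (rule r)
      fix B assume B: "B \<in> \<pi>'"
      then have "B \<noteq> {}" "B \<subseteq> A" using p' by (auto simp: partition_on_def)
      moreover have "B \<subseteq> X \<or> B \<inter> X = {}" using X(2)[of B] that B by auto
      ultimately show "\<exists>Y\<in>\<rho>. B \<subseteq> Y" unfolding \<rho>_def by blast
    qed
    then have ref: "refines A \<tau> \<rho>" by (intro least) simp_all
    show "\<Union>{B \<in> \<tau>. B \<subseteq> X} = X"
    proof (intro equalityI subsetI)
      fix z assume z: "z \<in> X"
      then obtain T where T: "T \<in> \<tau>" "z \<in> T" using block_exists[OF t, of z] X(1) by blast
      then obtain Y where "Y \<in> \<rho>" "T \<subseteq> Y" using ref by (auto simp: refines_def)
      then have "T \<subseteq> X" using T z by (auto simp: \<rho>_def)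
      then show "z \<in> \<Union>{B \<in> \<tau>. B \<subseteq> X}" using T by auto
    qed auto
  qed
  then have "card (Pow \<tau>) = card {X. X \<subseteq> A \<and> (\<forall>B\<in>\<pi> \<union> \<sigma>. B \<subseteq> X \<or> B \<inter> X = {})}"
    by (rule bij_betw_same_card)
  finally show ?thesis by (simp add: \<tau>_def)
qed

lemma two_power_card_join_words:
  assumes "stacked [] (lows k) \<pi>" "stacked [] (lows k) \<sigma>"
  shows "2 ^ card (part_join (points 0 k) \<pi> \<sigma>) =
    card {zs \<in> tuples (UNIV :: bool set) k. coherent [] (word k \<pi>) zs \<and> coherent [] (word k \<sigma>) zs}"
proof -
  let ?S = "{X. X \<subseteq> points 0 k \<and> (\<forall>B\<in>\<pi> \<union> \<sigma>. B \<subseteq> X \<or> B \<inter> X = {})}"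
  have pts: "points 0 k = set (lows k)" using set_ups_lows[of 0 k] by (simp add: ups_def)
  have inc: "inc (rev [] @ lows k)" using inc_ups_lows[of 0 k] by (simp add: ups_def)
  have p: "partition_on (points 0 k) \<pi>" "partition_on (points 0 k) \<sigma>"
    using assms stackedD(1) pts by fastforce+
  have co: "coherent [] (word k \<rho>) (map (\<lambda>p. p \<in> X) (lows k)) \<longleftrightarrow> (\<forall>B\<in>\<rho>. B \<subseteq> X \<or> B \<inter> X = {})"
    if "stacked [] (lows k) \<rho>" for \<rho> X
  proof -
    have w: "lpath UNIV (length ([] :: point list)) (word k \<rho>)" "build [] (lows k) (word k \<rho>) = \<rho>"
      using word_correct[OF inc that] by auto
    have "coherent (map (\<lambda>p. p \<in> X) []) (word k \<rho>) (map (\<lambda>p. p \<in> X) (lows k)) \<longleftrightarrow>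
      (\<forall>B\<in>\<rho>. \<forall>a\<in>B. \<forall>b\<in>B. (a \<in> X) = (b \<in> X))"
      using coherent_iff_constant[OF inc _ w(1), of "\<lambda>p. p \<in> X"] w(2) by simp
    then show ?thesis by auto
  qed
  have "bij_betw (\<lambda>X. map (\<lambda>p. p \<in> X) (lows k)) ?S
    {zs \<in> tuples UNIV k. coherent [] (word k \<pi>) zs \<and> coherent [] (word k \<sigma>) zs}"
  proof (rule bij_betwI[where g = "\<lambda>zs. {Inr j |j. j < k \<and> zs ! j}"])
    have eq: "map (\<lambda>p. p \<in> {Inr j |j. j < k \<and> zs ! j}) (lows k) = zs" if "zs \<in> tuples UNIV k" for zs
      using that by (intro nth_equalityI) (auto simp: lows_def tuples_def)
    show "(\<lambda>X. map (\<lambda>p. p \<in> X) (lows k)) \<in> ?S \<rightarrow>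
      {zs \<in> tuples UNIV k. coherent [] (word k \<pi>) zs \<and> coherent [] (word k \<sigma>) zs}"
      using co assms by (auto simp: tuples_def)
    show "(\<lambda>zs. {Inr j |j. j < k \<and> zs ! j}) \<in>
      {zs \<in> tuples UNIV k. coherent [] (word k \<pi>) zs \<and> coherent [] (word k \<sigma>) zs} \<rightarrow> ?S"
    proof
      fix zs :: "bool list" assume zs: "zs \<in> {zs \<in> tuples UNIV k. coherent [] (word k \<pi>) zs \<and> coherent [] (word k \<sigma>) zs}"
      then show "{Inr j |j. j < k \<and> zs ! j} \<in> ?S"
        using co[OF assms(1), of "{Inr j |j. j < k \<and> zs ! j}"] co[OF assms(2), of "{Inr j |j. j < k \<and> zs ! j}"] eq[of zs]
        by (auto simp: points_def)
    qed
    show "{Inr j |j. j < k \<and> map (\<lambda>p. p \<in> X) (lows k) ! j} = X" if "X \<in> ?S" for X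
      using that by (auto simp: lows_def points_def)
    show "map (\<lambda>p. p \<in> {Inr j |j. j < k \<and> zs ! j}) (lows k) = zs"
      if "zs \<in> {zs \<in> tuples UNIV k. coherent [] (word k \<pi>) zs \<and> coherent [] (word k \<sigma>) zs}" for zs
      using that eq by auto
  qed
  then show ?thesis
    using two_power_card_join[OF p] bij_betw_same_card by (simp add: pts)
qed


section \<open>Colour models\<close>

text \<open>For blocks of size at most two the letters are the steps. The letter \<open>Mi\<close> does not occur there; its value is a
  default.\<close>

fun step_of :: "letter \<Rightarrow> step" where
  "step_of Op = Up" | "step_of Cl = Down" | "step_of Si = Flat" | "step_of Mi = Flat"

fun letter_of :: "step \<Rightarrow> letter" where
  "letter_of Up = Op" | "letter_of Down = Cl" | "letter_of Flat = Si"

text \<open>A point is replaced by two strands, which run along the boundary of its block to the neighbouring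
  points of the block: a noncrossing partition of \<open>k\<close> points becomes a noncrossing pairing of \<open>2k\<close>
  points. This exhausts the noncrossing pairings, with words of steps read two at a time.\<close>

fun fatten :: "letter list \<Rightarrow> step list" where
  "fatten [] = []"
| "fatten (Op # w) = Up # Up # fatten w"
| "fatten (Cl # w) = Down # Down # fatten w"
| "fatten (Si # w) = Up # Down # fatten w"
| "fatten (Mi # w) = Down # Up # fatten w"

fun unfatten :: "step list \<Rightarrow> letter list" where
  "unfatten (Up # Up # p) = Op # unfatten p"
| "unfatten (Down # Down # p) = Cl # unfatten p"
| "unfatten (Up # Down # p) = Si # unfatten p"
| "unfatten (Down # Up # p) = Mi # unfatten p"
| "unfatten _ = []"

lemma length_fatten [simp]: "length (fatten w) = 2 * length w"
  by (induction w rule: fatten.induct) auto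

lemma fatten_eq_Nil [simp]: "fatten w = [] \<longleftrightarrow> w = []"
  using length_fatten[of w] by (metis length_0_conv mult_eq_0_iff zero_neq_numeral)

lemma unfatten_fatten: "unfatten (fatten w) = w"
  by (induction w rule: fatten.induct) auto

lemma fatten_path: "lpath L h w \<Longrightarrow> path False (2 * h) (fatten w)"
proof (induction L h w rule: lpath.induct)
  case (3 L h w)
  then show ?case by (cases h) auto
next
  case (5 L h w)
  then show ?case by (cases h) auto
qed auto

lemma unfatten_path:
  "path False (2 * h) p \<Longrightarrow> even (length p) \<Longrightarrow>
    lpath UNIV h (unfatten p) \<and> fatten (unfatten p) = p"
proof (induction p arbitrary: h rule: unfatten.induct)
  case (1 p)
  then show ?case using "1.IH"[of "Suc h"] by simp
next
  case (2 p)
  then show ?case using "2.IH"[of "h - 1"] by (cases h) auto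
next
  case (3 p)
  then show ?case using "3.IH"[of h] by simp
next
  case (4 p)
  then show ?case using "4.IH"[of h] by (cases h) auto
qed (auto dest!: path_steps simp: steps_def)

lemma bij_betw_fatten: "bij_betw fatten (words UNIV k r) (paths False (2 * k) (2 * r))"
proof (rule bij_betwI[where g = unfatten])
  show "fatten \<in> words UNIV k r \<rightarrow> paths False (2 * k) (2 * r)"
    using fatten_path by (auto simp: words_def paths_def)
  show "unfatten \<in> paths False (2 * k) (2 * r) \<rightarrow> words UNIV k r"
  proof
    fix p assume "p \<in> paths False (2 * k) (2 * r)"
    then have p: "length p = 2 * k" "path False (2 * r) p" by (auto simp: paths_def)
    from unfatten_path[OF p(2)] p(1) have *: "lpath UNIV r (unfatten p)" "fatten (unfatten p) = p" by auto
    have "2 * length (unfatten p) = length p" using *(2) length_fatten[of "unfatten p"] by simp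
    then show "unfatten p \<in> words UNIV k r" using * p by (simp add: words_def)
  qed
  show "unfatten (fatten w) = w" for w by (rule unfatten_fatten)
  show "fatten (unfatten p) = p" if "p \<in> paths False (2 * k) (2 * r)" for p
    using that unfatten_path[of r p] by (auto simp: paths_def)
qed

definition small_letters :: "bool \<Rightarrow> letter set" where
  "small_letters fl = (if fl then {Op, Cl, Si} else {Op, Cl})"

lemma step_of_path: "lpath L h w \<Longrightarrow> L = small_letters fl \<Longrightarrow> path fl h (map step_of w)"
  by (induction L h w rule: lpath.induct) (auto simp: small_letters_def split: if_splits)

lemma letter_of_path: "path fl h p \<Longrightarrow> lpath (small_letters fl) h (map letter_of p)"
  by (induction fl h p rule: path.induct) (auto simp: small_letters_def)

lemma bij_betw_step_of: "bij_betw (map step_of) (words (small_letters fl) k r) (paths fl k r)"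
proof (rule bij_betwI[where g = "map letter_of"])
  show "map step_of \<in> words (small_letters fl) k r \<rightarrow> paths fl k r"
    using step_of_path by (auto simp: words_def paths_def)
  show "map letter_of \<in> paths fl k r \<rightarrow> words (small_letters fl) k r"
    using letter_of_path by (auto simp: words_def paths_def)
  show "map letter_of (map step_of w) = w" if "w \<in> words (small_letters fl) k r" for w
  proof -
    have "set w \<subseteq> small_letters fl"
      using that unfolding words_def by (subst (asm) lpath_restrict) auto
    then have "letter_of (step_of l) = l" if "l \<in> set w" for l
      using that by (cases l) (auto simp: small_letters_def split: if_splits)
    then show ?thesis by (simp add: map_idI)
  qed
  show "map step_of (map letter_of p) = p" for p
  proof -
    have "step_of (letter_of a) = a" for a by (cases a) auto
    then show ?thesis by (simp add: map_idI)
  qed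
qed

lemma lpath_balance: "lpath L h w \<Longrightarrow> h + count_list w Op = count_list w Cl"
  by (induction L h w rule: lpath.induct) auto

lemma length_by_letters:
  "length w = count_list w Op + count_list w Cl + count_list w Si + count_list w Mi"
proof (induction w)
  case (Cons l w)
  then show ?case by (cases l) auto
qed simp

lemma tilt_step_of:
  "lpath L h w \<Longrightarrow> Mi \<notin> L \<Longrightarrow> tilt (\<lambda>_. 0) h (map step_of w) = int (count_list w Si) - int (count_list w Mi)"
  by (induction L h w rule: lpath.induct) auto

text \<open>In the fattened path a singleton contains a rise from an even height and a middle point a
  rise from an odd height; an opening point contains one of each.\<close>

lemma tilt_fatten:
  "lpath L h w \<Longrightarrow> tilt (\<lambda>h. if even h then 1 else -1) (2 * h) (fatten w) =
    int (count_list w Si) - int (count_list w Mi)"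
proof (induction L h w rule: lpath.induct)
  case (3 L h w)
  then show ?case by (cases h) auto
next
  case (5 L h w)
  then show ?case by (cases h) auto
qed auto

lemma sum_of_bool_product:
  assumes "finite A"
  shows "(\<Sum>z\<in>A. of_bool (P z) * of_bool (Q z)) = int (card {z \<in> A. P z \<and> Q z})"
proof -
  have "(\<Sum>z\<in>A. of_bool (P z) * of_bool (Q z)) = (\<Sum>z\<in>A. of_bool (P z \<and> Q z) :: int)"
    by (intro sum.cong) auto
  then show ?thesis using assms by (simp add: sum_of_bool_eq Int_def)
qed

text \<open>Both ends of a pair have the same colour, and every loop and every singleton can be coloured in two ways.\<close>

lemma colour_model: "pairing_model (UNIV :: bool set) (\<lambda>a. a) (\<lambda>_ _. ()) ()
    (\<lambda>_ _. 1) (\<lambda>_ _. 1) (\<lambda>_ _. 1) (2 :: int) (\<lambda>_. 1) fl (\<lambda>_. UNIV)"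
  by unfold_locales auto

lemma count_colourings:
  assumes "pairs fl (\<lambda>_. 1) (map step_of w) (map step_of w') m"
    and "length w = k" and "length w' = k" and "Mi \<notin> set w" and "Mi \<notin> set w'"
  shows "card {zs \<in> tuples (UNIV :: bool set) k. coherent [] w zs \<and> coherent [] w' zs} = 2 ^ m"
proof -
  interpret M: pairing_model "UNIV :: bool set" "\<lambda>a. a" "\<lambda>_ _. ()" "()"
    "\<lambda>_ _. 1" "\<lambda>_ _. 1" "\<lambda>_ _. 1" "2 :: int" "\<lambda>_. 1" fl "\<lambda>_. UNIV"
    by (rule colour_model)
  have vec: "M.vec () st (map step_of w) zs = of_bool (coherent st w zs)" if "Mi \<notin> set w" for st w zs
    using that by (induction st w zs rule: coherent.induct) auto
  have om: "M.om_list () zs = 1" for zs by (induction zs) auto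
  have "2 ^ m = M.form (map step_of w) (map step_of w')" by (rule M.form_eq_power[OF assms(1), symmetric])
  also have "\<dots> = (\<Sum>zs\<in>tuples (UNIV :: bool set) k. of_bool (coherent [] w zs) * of_bool (coherent [] w' zs))"
    using assms by (simp add: M.form_def M.weight_def om vec)
  also have "\<dots> = int (card {zs \<in> tuples (UNIV :: bool set) k. coherent [] w zs \<and> coherent [] w' zs})"
    by (rule sum_of_bool_product[OF finite_tuples]) simp
  finally have "int (card {zs \<in> tuples (UNIV :: bool set) k. coherent [] w zs \<and> coherent [] w' zs}) = int (2 ^ m)"
    by simp
  then show ?thesis by (simp only: of_nat_eq_iff)
qed

text \<open>For fattened words the two strands of a point have the same colour. Labels at even positions are free, and
  labels at odd positions repeat the preceding one, which the state remembers. A loop inserted at an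
  even position is a new block and has two colourings; a loop inserted at an odd position lies
  between the two strands of a point and has to take the colour of this point. So the loop value is
  \<open>2\<close> or \<open>1\<close>, according to the parity of the position.\<close>

fun spin_move :: "bool option \<Rightarrow> bool \<Rightarrow> bool option" where
  "spin_move None a = Some a" | "spin_move (Some b) a = None"

fun spin_weight :: "bool option \<Rightarrow> bool \<Rightarrow> int" where
  "spin_weight None a = 1" | "spin_weight (Some b) a = of_bool (a = b)"

fun double :: "'a list \<Rightarrow> 'a list" where
  "double [] = []" | "double (a # zs) = a # a # double zs"

lemma spin_model: "pairing_model (UNIV :: bool set) (\<lambda>a. a) spin_move None
    spin_weight spin_weight (\<lambda>_ _. 0) (2 :: int) (\<lambda>i. if even i then 1 else 0) False
    (\<lambda>i. if even i then {None} else range Some)"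
proof
  show "spin_move s a \<in> (if even (Suc i) then {None} else range Some)"
    if "s \<in> (if even i then {None} else range Some)" for s a i
    using that by (cases s) (auto split: if_splits)
  show "spin_move (spin_move s a) a = s" if "spin_weight s a \<noteq> 0" for s a
    using that by (cases s) auto
  show "(\<Sum>a\<in>UNIV. spin_weight s a * spin_weight s a * spin_weight s a *
      spin_weight (spin_move s a) a) = 2 ^ (if even i then 1 else 0)"
    if "s \<in> (if even i then {None} else range Some)" for s i
    using that by (cases s) (auto simp: UNIV_bool split: if_splits)
  show "spin_weight s a * spin_weight (spin_move s a) a * spin_weight s a *
      spin_weight (spin_move s a) a = 1" if "spin_weight s a \<noteq> 0" for s a
    using that by (cases s) auto
qed auto

lemma length_double [simp]: "length (double zs) = 2 * length zs"
  by (induction zs) auto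

lemma double_eq_Nil [simp]: "double zs = [] \<longleftrightarrow> zs = []"
  by (cases zs) auto

lemma inj_double: "inj double"
proof (rule injI)
  fix xs ys :: "'a list" assume "double xs = double ys"
  then show "xs = ys"
  proof (induction xs arbitrary: ys)
    case Nil
    then show ?case by (cases ys) auto
  next
    case (Cons a xs)
    then show ?case by (cases ys) auto
  qed
qed

lemma count_spins:
  assumes "pairs False (\<lambda>i. if even i then 1 else 0) (fatten w) (fatten w') m"
    and "length w = k" and "length w' = k"
  shows "card {zs \<in> tuples (UNIV :: bool set) k. coherent [] w zs \<and> coherent [] w' zs} = 2 ^ m"
proof -
  interpret M: pairing_model "UNIV :: bool set" "\<lambda>a. a" spin_move None
    spin_weight spin_weight "\<lambda>_ _. 0" "2 :: int" "\<lambda>i. if even i then 1 else 0" False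
    "\<lambda>i. if even i then {None} else range Some"
    by (rule spin_model)
  have vec: "M.vec None (double st) (fatten w) (double zs) = of_bool (coherent st w zs)" for st w zs
    by (induction st w zs rule: coherent.induct) (auto simp: M.vec_no_values)
  have om: "M.weight (double zs) = 1" for zs
    unfolding M.weight_def by (induction zs) auto
  \<comment> \<open>The tuples of nonzero weight are those in which both strands of every point agree.\<close>
  have doubled: "zs \<in> double ` tuples UNIV k"
    if "length zs = 2 * k" "M.om_list None zs \<noteq> 0" for zs k
    using that
  proof (induction k arbitrary: zs)
    case (Suc k)
    then obtain a b zs' where zs: "zs = a # b # zs'" "length zs' = 2 * k"
      by (auto simp: length_Suc_conv)
    with Suc.prems have "b = a" "M.om_list None zs' \<noteq> 0" by auto
    moreover obtain ys where "ys \<in> tuples UNIV k" "zs' = double ys" using Suc.IH[OF zs(2) calculation(2)] by auto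
    ultimately have "zs = double (a # ys)" "a # ys \<in> tuples UNIV (Suc k)" using zs by (auto simp: tuples_def)
    then show ?case by blast
  qed auto
  have "2 ^ m = M.form (fatten w) (fatten w')" by (rule M.form_eq_power[OF assms(1), symmetric])
  also have "\<dots> = (\<Sum>zs\<in>double ` tuples UNIV k. M.weight zs * M.vec None [] (fatten w) zs * M.vec None [] (fatten w') zs)"
    unfolding M.form_def length_fatten assms(2)
  proof (rule sum.mono_neutral_right)
    show "\<forall>zs\<in>tuples UNIV (2 * k) - double ` tuples UNIV k.
      M.weight zs * M.vec None [] (fatten w) zs * M.vec None [] (fatten w') zs = 0"
      using doubled[of _ k] by (auto simp: tuples_def M.weight_def)
  qed (auto simp: finite_tuples, auto simp: tuples_def)
  also have "\<dots> = (\<Sum>zs\<in>tuples (UNIV :: bool set) k. M.weight (double zs) *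
      M.vec None (double []) (fatten w) (double zs) * M.vec None (double []) (fatten w') (double zs))"
    by (subst sum.reindex) (use inj_double in \<open>auto intro: inj_on_subset\<close>)
  also have "\<dots> = (\<Sum>zs\<in>tuples (UNIV :: bool set) k. of_bool (coherent [] w zs) * of_bool (coherent [] w' zs))"
    unfolding om vec by simp
  also have "\<dots> = int (card {zs \<in> tuples (UNIV :: bool set) k. coherent [] w zs \<and> coherent [] w' zs})"
    by (rule sum_of_bool_product[OF finite_tuples]) simp
  finally have "int (card {zs \<in> tuples (UNIV :: bool set) k. coherent [] w zs \<and> coherent [] w' zs}) = int (2 ^ m)"
    by simp
  then show ?thesis by (simp only: of_nat_eq_iff)
qed

section \<open>The Gram determinant as a product over paths\<close>

text \<open>The number of blocks is the number of letters \<open>Op\<close> and \<open>Si\<close>, and there are as many \<open>Cl\<close> as \<open>Op\<close>.\<close>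

lemma card_by_word:
  assumes "stacked [] (lows k) \<pi>"
  shows "2 * int (card \<pi>) - int k = int (count_list (word k \<pi>) Si) - int (count_list (word k \<pi>) Mi)"
proof -
  have inc: "inc (rev [] @ lows k)" using inc_ups_lows[of 0 k] by (simp add: ups_def)
  have w: "lpath UNIV 0 (word k \<pi>)" "build [] (lows k) (word k \<pi>) = \<pi>"
    using word_correct[OF inc assms] by auto
  have "card \<pi> = count_list (word k \<pi>) Op + count_list (word k \<pi>) Si"
    using card_build[OF inc, of "word k \<pi>"] w by simp
  moreover have "k = count_list (word k \<pi>) Op + count_list (word k \<pi>) Cl +
      count_list (word k \<pi>) Si + count_list (word k \<pi>) Mi"
    using length_by_letters[of "word k \<pi>"] by simp
  ultimately show ?thesis using lpath_balance[OF w(1)] by simp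
qed

text \<open>The encoding \<open>enc\<close> is \<open>map step_of\<close> or \<open>fatten\<close>. The assumption \<open>colours\<close> is the evaluation of a
  colour model, by which the exponent in \<open>form_eq_power\<close> is recognised as the number of blocks of the join.\<close>

theorem det_gram:
  fixes n :: "'f::field"
  assumes model: "path_model \<nu> n e fl reach"
    and \<nu>: "\<And>h. \<nu> h = \<rho> h * n powi \<epsilon> h"
    and rank: "epi_rank P 0 k = {\<sigma>. stacked (ups 0) (lows k) \<sigma> \<and> set (word k \<sigma>) \<subseteq> L}"
    and P0: "epi_rank P 0 k = P 0 k"
    and enc: "bij_betw enc (words L k 0) (paths fl N 0)"
    and colours: "\<And>w w' m. w \<in> words L k 0 \<Longrightarrow> w' \<in> words L k 0 \<Longrightarrow> pairs fl e (enc w) (enc w') m \<Longrightarrow>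
      card {zs \<in> tuples (UNIV :: bool set) k. coherent [] w zs \<and> coherent [] w' zs} = 2 ^ m"
    and tilt: "\<And>w. w \<in> words L k 0 \<Longrightarrow>
      tilt \<epsilon> 0 (enc w) = int (count_list w Si) - int (count_list w Mi)"
    and enum: "enumerates \<pi>s (P 0 k)"
  shows "det (gram k n \<pi>s) = n powi expo P k * (\<Prod>i<N. \<rho> i ^ num_paths fl N (2 * i + 2))"
proof -
  interpret path_model \<nu> n e fl reach by (rule model)
  note bij = bij_betw_words[OF rank, unfolded P0]
  have st: "stacked [] (lows k) \<pi>" if "\<pi> \<in> P 0 k" for \<pi>
    using that rank P0 by (auto simp: ups_def)
  have wd: "word k \<pi> \<in> words L k 0" if "\<pi> \<in> P 0 k" for \<pi> using bij that by (auto simp: bij_betw_def)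
  define f where "f = (\<lambda>\<pi>. enc (word k \<pi>))"
  have f_bij: "bij_betw f (P 0 k) (paths fl N 0)"
    using bij_betw_trans[OF bij enc] by (simp add: f_def comp_def)
  have form: "form (f \<pi>) (f \<sigma>) = n ^ card (part_join (points 0 k) \<pi> \<sigma>)"
    if \<pi>\<sigma>: "\<pi> \<in> P 0 k" "\<sigma> \<in> P 0 k" for \<pi> \<sigma>
  proof -
    have "f \<pi> \<in> paths fl N 0" "f \<sigma> \<in> paths fl N 0" using f_bij \<pi>\<sigma> by (auto simp: bij_betw_def)
    then have p: "path fl 0 (f \<pi>)" "path fl 0 (f \<sigma>)" "length (f \<pi>) = length (f \<sigma>)"
      by (auto simp: paths_def)
    have "built fl (f \<pi>)" "built fl (f \<sigma>)"
      using path_imp_built[OF p(1)] path_imp_built[OF p(2)] by simp_all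
    then obtain m where m: "pairs fl e (f \<pi>) (f \<sigma>) m" using pairs_exists p(3) by blast
    have "(2::nat) ^ m = 2 ^ card (part_join (points 0 k) \<pi> \<sigma>)"
      using colours[OF wd[OF \<pi>\<sigma>(1)] wd[OF \<pi>\<sigma>(2)]] m
        two_power_card_join_words[OF st[OF \<pi>\<sigma>(1)] st[OF \<pi>\<sigma>(2)]] by (simp add: f_def)
    then have "m = card (part_join (points 0 k) \<pi> \<sigma>)" by simp
    then show ?thesis using form_eq_power[OF m] by simp
  qed
  define ws where "ws = map f \<pi>s"
  have set_\<pi>s: "set \<pi>s = P 0 k" and dist: "distinct \<pi>s" using enum by (auto simp: enumerates_def)
  have "gram k n \<pi>s = mat (length ws) (length ws) (\<lambda>(i, j). form (ws ! i) (ws ! j))"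
  proof (rule eq_matI)
    fix i j
    assume "i < dim_row (mat (length ws) (length ws) (\<lambda>(i, j). form (ws ! i) (ws ! j)))"
      "j < dim_col (mat (length ws) (length ws) (\<lambda>(i, j). form (ws ! i) (ws ! j)))"
    then have ij: "i < length \<pi>s" "j < length \<pi>s" by (simp_all add: ws_def)
    then have "\<pi>s ! i \<in> P 0 k" "\<pi>s ! j \<in> P 0 k" using set_\<pi>s nth_mem by blast+
    from form[OF this] show "gram k n \<pi>s $$ (i, j) =
        mat (length ws) (length ws) (\<lambda>(i, j). form (ws ! i) (ws ! j)) $$ (i, j)"
      using ij by (simp add: gram_def ws_def)
  qed (simp_all add: gram_def ws_def)
  moreover have "distinct ws" "set ws = paths fl N 0"
    using f_bij dist set_\<pi>s by (auto simp: ws_def distinct_map bij_betw_def)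
  ultimately have "det (gram k n \<pi>s) = (\<Prod>p\<in>paths fl N 0. om_list 0 p)"
    using det_form by simp
  also have "\<dots> = n powi (\<Sum>p\<in>paths fl N 0. tilt \<epsilon> 0 p) * (\<Prod>i<N. \<rho> i ^ num_paths fl N (2 * i + 2))"
    by (rule prod_om_list[OF \<nu>])
  also have "(\<Sum>p\<in>paths fl N 0. tilt \<epsilon> 0 p) = (\<Sum>\<pi>\<in>P 0 k. tilt \<epsilon> 0 (f \<pi>))"
    by (rule sum.reindex_bij_betw[OF f_bij, symmetric])
  also have "\<dots> = expo P k"
    unfolding expo_def
  proof (intro sum.cong refl)
    fix \<pi> assume \<pi>: "\<pi> \<in> P 0 k"
    show "tilt \<epsilon> 0 (f \<pi>) = 2 * int (card \<pi>) - int k"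
      unfolding f_def tilt[OF wd[OF \<pi>]] card_by_word[OF st[OF \<pi>]] ..
  qed
  finally show ?thesis .
qed

lemma prod_epis:
  fixes g :: "nat \<Rightarrow> 'a::comm_monoid_mult"
  assumes "\<And>r. epi_rank P r k \<subseteq> Ps_plus r k"
  shows "(\<Prod>\<sigma> | \<sigma> \<in> epis P k \<and> Q (num_upper \<sigma>). g (num_upper \<sigma>)) =
    (\<Prod>r | r \<le> k \<and> Q r. g r ^ card (epi_rank P r k))"
proof -
  have num: "num_upper \<sigma> = r" if "\<sigma> \<in> epi_rank P r k" for \<sigma> r
    using assms[of r] that num_upper_eq[of r k \<sigma>] by (auto simp: Ps_plus_def)
  have fin: "finite (epi_rank P r k)" for r using finite_subset[OF assms finite_Ps_plus] .
  have "{\<sigma>. \<sigma> \<in> epis P k \<and> Q (num_upper \<sigma>)} = (\<Union>r\<in>{r. r \<le> k \<and> Q r}. epi_rank P r k)"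
    using num by (auto simp: epis_def)
  also have "(\<Prod>\<sigma>\<in>\<dots>. g (num_upper \<sigma>)) =
      (\<Prod>r | r \<le> k \<and> Q r. \<Prod>\<sigma>\<in>epi_rank P r k. g (num_upper \<sigma>))"
    using fin num by (intro prod.UNION_disjoint) (auto, metis)
  also have "\<dots> = (\<Prod>r | r \<le> k \<and> Q r. g r ^ card (epi_rank P r k))"
    using num by (intro prod.cong refl) simp
  finally show ?thesis .
qed

text \<open>Only paths that start at a height of at most their length exist, so the index ranges of the two products agree up to
  factors \<open>1\<close>. The same holds below for doubled paths.\<close>

lemma prod_even_index:
  fixes \<rho> :: "nat \<Rightarrow> 'a::field"
  assumes "g 0 = 1" and "\<And>i. g (Suc i) = \<rho> i"
  shows "(\<Prod>r | r \<le> k \<and> even r. g (r div 2) ^ num_paths fl k r) = (\<Prod>i<k. \<rho> i ^ num_paths fl k (2 * i + 2))"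
proof -
  have "(\<Prod>r | r \<le> k \<and> even r. g (r div 2) ^ num_paths fl k r) =
    (\<Prod>r\<in>insert 0 ((\<lambda>i. 2 * i + 2) ` {..<k}). g (r div 2) ^ num_paths fl k r)"
  proof (rule prod.mono_neutral_left)
    show "{r. r \<le> k \<and> even r} \<subseteq> insert 0 ((\<lambda>i. 2 * i + 2) ` {..<k})"
    proof
      fix r assume "r \<in> {r. r \<le> k \<and> even r}"
      then obtain i where i: "r = 2 * i" "r \<le> k" by (auto elim: evenE)
      then show "r \<in> insert 0 ((\<lambda>i. 2 * i + 2) ` {..<k})" by (cases i) auto
    qed
    show "\<forall>r\<in>insert 0 ((\<lambda>i. 2 * i + 2) ` {..<k}) - {r. r \<le> k \<and> even r}.
      g (r div 2) ^ num_paths fl k r = 1"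
    proof
      fix r assume "r \<in> insert 0 ((\<lambda>i. 2 * i + 2) ` {..<k}) - {r. r \<le> k \<and> even r}"
      then have "k < r" by auto
      then show "g (r div 2) ^ num_paths fl k r = 1" by (simp add: num_paths_eq_0)
    qed
  qed simp
  also have "\<dots> = (\<Prod>r\<in>(\<lambda>i. 2 * i + 2) ` {..<k}. g (r div 2) ^ num_paths fl k r)"
    using assms by (subst prod.insert) auto
  also have "\<dots> = (\<Prod>i<k. \<rho> i ^ num_paths fl k (2 * i + 2))"
    using assms by (subst prod.reindex) (auto simp: inj_on_def)
  finally show ?thesis .
qed

lemma prod_index:
  fixes \<rho> :: "nat \<Rightarrow> 'a::field"
  assumes "g 0 = 1" and "\<And>i. g (Suc i) = \<rho> i"
  shows "(\<Prod>r\<le>k. g r ^ num_paths fl (2 * k) (2 * r)) = (\<Prod>i<2 * k. \<rho> i ^ num_paths fl (2 * k) (2 * i + 2))"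
proof -
  have "(\<Prod>r\<le>k. g r ^ num_paths fl (2 * k) (2 * r)) = (\<Prod>r\<le>2 * k. g r ^ num_paths fl (2 * k) (2 * r))"
    by (intro prod.mono_neutral_left) (auto simp: num_paths_eq_0)
  also have "\<dots> = (\<Prod>i<2 * k. \<rho> i ^ num_paths fl (2 * k) (2 * i + 2))"
    using assms by (simp add: prod.atMost_shift)
  finally show ?thesis .
qed

section \<open>The three recurrences\<close>

text \<open>The polynomials \<open>P\<close> are Chebyshev polynomials, with zeros between \<open>-2\<close> and \<open>2\<close>. Up to a power of
  \<open>sqrt n\<close>, the polynomial \<open>R\<^sub>r\<close> is \<open>P\<^sub>r\<close> at \<open>sqrt n\<close>. This explains the points \<open>2\<close>, \<open>3\<close>
  and \<open>4\<close> at which \<open>P\<close>, \<open>Q\<close> and \<open>R\<close> are seen not to vanish.\<close>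

lemma polyP_at_2: "polyP r (2 :: 'a::comm_ring_1) = of_nat r + 1"
  by (induction r "2 :: 'a" rule: polyP.induct) (auto simp: algebra_simps)

lemma polyQ_eq_polyP: "polyQ r n = polyP r (n - 1)"
  by (induction r n rule: polyQ.induct) auto

lemma polyR_at_4: "1 \<le> polyR m (4 :: rat) \<and> polyR m (4 :: rat) \<le> polyR (Suc (Suc m)) 4"
  by (induction m "4 :: rat" rule: polyR.induct) auto

lemma polyP_to_fract: "polyP r (to_fract p) = to_fract (polyP r p)"
  by (induction r p rule: polyP.induct) auto

lemma polyR_to_fract: "polyR r (to_fract p) = to_fract (polyR r p)"
proof (induction r p rule: polyR.induct)
  case (4 n)
  have "(2 :: 'a fract) = to_fract 2" by (metis one_add_one to_fract_1 to_fract_add)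
  then show ?case by simp
next
  case (5 m n)
  have "(2 :: 'a fract) = to_fract 2" by (metis one_add_one to_fract_1 to_fract_add)
  with 5 show ?case by simp
qed auto

lemma poly_polyP: "poly (polyP r p) a = polyP r (poly p a)"
  by (induction r p rule: polyP.induct) auto

lemma poly_polyR: "poly (polyR r p) a = polyR r (poly p a)"
  by (induction r p rule: polyR.induct) auto

lemma indet_eq: "indet = to_fract [:0, 1:]"
  by (simp add: indet_def to_fract_def)

lemma polyP_indet_nonzero: "polyP r indet \<noteq> 0"
proof -
  have "poly (polyP r [:0, 1:]) (2 :: rat) \<noteq> 0"
    unfolding poly_polyP using polyP_at_2[of r, where 'a = rat] by (simp add: add_eq_0_iff)
  then have "polyP r [:0, 1 :: rat:] \<noteq> 0" by (metis poly_0)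
  then show ?thesis by (simp add: indet_eq polyP_to_fract)
qed

lemma polyQ_indet_nonzero: "polyQ r indet \<noteq> 0"
proof -
  have "[:-1, 1:] = [:0, 1:] - (1 :: rat poly)" by (simp add: one_pCons)
  then have eq: "indet - 1 = to_fract [:-1, 1:]" by (simp add: indet_eq)
  have "poly (polyP r [:-1, 1:]) (3 :: rat) \<noteq> 0"
    unfolding poly_polyP using polyP_at_2[of r, where 'a = rat] by (simp add: add_eq_0_iff)
  then have "polyP r [:-1, 1 :: rat:] \<noteq> 0" by (metis poly_0)
  then show ?thesis unfolding polyQ_eq_polyP eq by (simp add: polyP_to_fract)
qed

lemma polyR_indet_nonzero: "polyR r indet \<noteq> 0"
proof -
  have "poly (polyR r [:0, 1:]) (4 :: rat) \<noteq> 0"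
    unfolding poly_polyR using polyR_at_4[of r] by auto
  then have "polyR r [:0, 1 :: rat:] \<noteq> 0" by (metis poly_0)
  then show ?thesis by (simp add: indet_eq polyR_to_fract)
qed

lemma path_model_chebyshev:
  fixes F :: "nat \<Rightarrow> 'f::field"
  assumes "F 0 = 1" and "F 1 = y" and "\<And>r. F (Suc (Suc r)) = y * F (Suc r) - F r"
    and nz: "\<And>r. F r \<noteq> 0" and n: "n \<noteq> 0" "n = y + (if fl then 1 else 0)"
  shows "path_model (\<lambda>h. F (Suc h) / F h) n (\<lambda>_. 1) fl (\<lambda>_. UNIV)"
proof
  show "F (Suc h) / F h + (if h = 0 then 0 else 1 / (F (Suc (h - 1)) / F (h - 1))) + (if fl then 1 else 0) = n ^ 1"
    for h
  proof (cases h)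
    case 0
    then show ?thesis using assms by simp
  next
    case (Suc h')
    have "F (Suc (Suc h')) / F (Suc h') + F h' / F (Suc h') = y"
      using assms(3)[of h'] nz by (simp add: field_simps)
    then show ?thesis using Suc n by simp
  qed
qed (use assms in auto)

text \<open>The step-two recursions of \<open>R\<close> combine into a three-term recursion whose coefficient alternates
  between \<open>n\<close> and \<open>1\<close>, like the loop values of fattened diagrams.\<close>

lemma polyR_recurrence:
  "polyR (Suc (Suc h)) n + polyR h n = (if even h then n else 1) * polyR (Suc h) n"
proof (induction h n rule: polyR.induct)
  case (5 m n)
  have "polyR (Suc (Suc (Suc (Suc (Suc (Suc m)))))) n + polyR (Suc (Suc (Suc (Suc m)))) n =
    (n - 2) * (polyR (Suc (Suc (Suc (Suc m)))) n + polyR (Suc (Suc m)) n) -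
    (polyR (Suc (Suc m)) n + polyR m n)"
    by (simp add: algebra_simps)
  also have "\<dots> = (if even m then n else 1) * polyR (Suc (Suc (Suc (Suc (Suc m))))) n"
    unfolding 5 by (simp add: algebra_simps)
  finally show ?case by simp
qed (auto simp: algebra_simps)

text \<open>The factor \<open>n powi (\<plusminus>1)\<close> turns the alternating three-term recursion into the recurrence for
  \<open>\<nu>\<close>: the loop value is \<open>n\<close> at even heights and \<open>1\<close> at odd heights.\<close>

lemma path_model_polyR:
  fixes n :: "'f::field"
  assumes nz: "\<And>r. polyR r n \<noteq> 0" and n: "n \<noteq> 0"
  shows "path_model (\<lambda>h. polyR (Suc h) n / polyR h n * n powi (if even h then 1 else -1)) n
    (\<lambda>i. if even i then 1 else 0) False (\<lambda>i. {h. even h \<longleftrightarrow> even i})"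
proof
  fix h i :: nat assume "h \<in> {h. even h \<longleftrightarrow> even i}"
  then have hi: "even h \<longleftrightarrow> even i" by simp
  let ?\<nu> = "\<lambda>h. polyR (Suc h) n / polyR h n * n powi (if even h then 1 else -1)"
  show "?\<nu> h + (if h = 0 then 0 else 1 / ?\<nu> (h - 1)) + (if False then 1 else 0) =
    n ^ (if even i then 1 else 0)"
  proof (cases h)
    case 0
    then show ?thesis using hi by simp
  next
    case (Suc h')
    have "?\<nu> h + 1 / ?\<nu> h' = (polyR (Suc (Suc h')) n + polyR h' n) / polyR (Suc h') n *
        n powi (if even h then 1 else -1)"
      using Suc nz n by (auto simp: field_simps power_int_minus)
    also have "\<dots> = (if even h then n else 1)"
      unfolding polyR_recurrence using Suc nz n by (auto simp: power_int_minus)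
    finally show ?thesis using Suc hi by (simp split: if_splits)
  qed
qed (use assms in auto)

lemma num_epis:
  assumes "epi_rank P r k = {\<sigma>. stacked (ups r) (lows k) \<sigma> \<and> set (word k \<sigma>) \<subseteq> L}"
    and "bij_betw enc (words L k r) (paths fl N h)"
  shows "card (epi_rank P r k) = num_paths fl N h"
  using bij_betw_same_card[OF bij_betw_trans[OF bij_betw_words[OF assms(1)] assms(2)]]
  by (simp add: num_paths_def)

section \<open>The determinant formulas\<close>

text \<open>Pairings, and partitions into pairs and singletons: without flat steps the loop value is \<open>n = y\<close>; a
  flat pair of steps contributes \<open>1\<close> to it, which leaves \<open>y = n - 1\<close> for the recurrence of the \<open>F r\<close>.\<close>

lemma det_gram_small_blocks:
  fixes n :: "'f::field" and F :: "nat \<Rightarrow> 'f \<Rightarrow> 'f"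
  assumes rank: "\<And>r. epi_rank P r k = {\<sigma>. stacked (ups r) (lows k) \<sigma> \<and> set (word k \<sigma>) \<subseteq> small_letters fl}"
    and P0: "epi_rank P 0 k = P 0 k" and enum: "enumerates \<pi>s (P 0 k)"
    and F: "F 0 n = 1" "F 1 n = y" "\<And>r. F (Suc (Suc r)) n = y * F (Suc r) n - F r n"
    and nz: "\<And>r. F r n \<noteq> 0" and n: "n \<noteq> 0" "n = y + (if fl then 1 else 0)"
  shows "det (gram k n \<pi>s) = n powi expo P k *
    (\<Prod>\<sigma> | \<sigma> \<in> epis P k \<and> even (num_upper \<sigma>).
       F (num_upper \<sigma> div 2) n / (if num_upper \<sigma> div 2 = 0 then 1 else F (num_upper \<sigma> div 2 - 1) n))"
proof -
  define g where "g r = F r n / (if r = 0 then 1 else F (r - 1) n)" for r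
  have sub: "epi_rank P r k \<subseteq> Ps_plus r k" for r
  proof -
    have "epi_rank P r k \<subseteq> epi_rank Ps_plus r k" unfolding rank epi_rank_Ps_plus by blast
    also have "\<dots> \<subseteq> Ps_plus r k" by (auto simp: epi_rank_def)
    finally show ?thesis .
  qed
  have noMi: "Mi \<notin> small_letters fl" by (simp add: small_letters_def)
  then have noMi': "Mi \<notin> set w" if "w \<in> words (small_letters fl) k 0" for w
    using that unfolding words_def by (subst (asm) lpath_restrict) auto
  have "det (gram k n \<pi>s) = n powi expo P k *
      (\<Prod>i<k. (F (Suc i) n / F i n) ^ num_paths fl k (2 * i + 2))"
  proof (rule det_gram[OF path_model_chebyshev[of "\<lambda>r. F r n" y n fl]])
    show "F (Suc h) n / F h n = F (Suc h) n / F h n * n powi (\<lambda>_. 0) h" for h by simp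
    show "card {zs \<in> tuples (UNIV :: bool set) k. coherent [] w zs \<and> coherent [] w' zs} = 2 ^ m"
      if "w \<in> words (small_letters fl) k 0" "w' \<in> words (small_letters fl) k 0"
        "pairs fl (\<lambda>_. 1) (map step_of w) (map step_of w') m" for w w' m
      using that noMi' by (intro count_colourings[OF that(3)]) (auto simp: words_def)
    show "tilt (\<lambda>_. 0) 0 (map step_of w) = int (count_list w Si) - int (count_list w Mi)"
      if "w \<in> words (small_letters fl) k 0" for w
      using that tilt_step_of[OF _ noMi] by (auto simp: words_def)
  qed (use assms bij_betw_step_of in auto)
  also have "(\<Prod>i<k. (F (Suc i) n / F i n) ^ num_paths fl k (2 * i + 2)) =
      (\<Prod>r | r \<le> k \<and> even r. g (r div 2) ^ num_paths fl k r)"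
    by (rule prod_even_index[symmetric]) (simp_all add: g_def F)
  also have "\<dots> = (\<Prod>r | r \<le> k \<and> even r. g (r div 2) ^ card (epi_rank P r k))"
    using num_epis[OF rank bij_betw_step_of] by simp
  also have "\<dots> = (\<Prod>\<sigma> | \<sigma> \<in> epis P k \<and> even (num_upper \<sigma>). g (num_upper \<sigma> div 2))"
    by (rule prod_epis[OF sub, symmetric])
  finally show ?thesis by (simp add: g_def)
qed

theorem theorem8p2:
  fixes k :: nat and n :: "rat poly fract"
  assumes "n = indet"
  shows
    "(\<forall>\<pi>s. enumerates \<pi>s (Po_plus 0 k) \<longrightarrow>
        det (gram k n \<pi>s) = n powi expo Po_plus k *
          (\<Prod>\<sigma> | \<sigma> \<in> epis Po_plus k \<and> even (num_upper \<sigma>).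
             polyP (num_upper \<sigma> div 2) n / pred_poly polyP (num_upper \<sigma> div 2) n)) \<and>
     (\<forall>\<pi>s. enumerates \<pi>s (Pb_plus 0 k) \<longrightarrow>
        det (gram k n \<pi>s) = n powi expo Pb_plus k *
          (\<Prod>\<sigma> | \<sigma> \<in> epis Pb_plus k \<and> even (num_upper \<sigma>).
             polyQ (num_upper \<sigma> div 2) n / pred_poly polyQ (num_upper \<sigma> div 2) n)) \<and>
     (\<forall>\<pi>s. enumerates \<pi>s (Ps_plus 0 k) \<longrightarrow>
        det (gram k n \<pi>s) = n powi expo Ps_plus k *
          (\<Prod>\<sigma>\<in>epis Ps_plus k.
             polyR (num_upper \<sigma>) n / pred_poly polyR (num_upper \<sigma>) n))"
proof (intro conjI allI impI)
  have n0: "n \<noteq> 0" using polyP_indet_nonzero[of 1] assms by simp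
  show "det (gram k n \<pi>s) = n powi expo Po_plus k *
          (\<Prod>\<sigma> | \<sigma> \<in> epis Po_plus k \<and> even (num_upper \<sigma>).
             polyP (num_upper \<sigma> div 2) n / pred_poly polyP (num_upper \<sigma> div 2) n)"
    if "enumerates \<pi>s (Po_plus 0 k)" for \<pi>s
    unfolding pred_poly_def
    by (rule det_gram_small_blocks[OF _ epi_rank_0(3) that, where fl = False and y = n])
      (use n0 polyP_indet_nonzero in \<open>simp_all add: epi_rank_by_letters small_letters_def assms\<close>)
  show "det (gram k n \<pi>s) = n powi expo Pb_plus k *
          (\<Prod>\<sigma> | \<sigma> \<in> epis Pb_plus k \<and> even (num_upper \<sigma>).
             polyQ (num_upper \<sigma> div 2) n / pred_poly polyQ (num_upper \<sigma> div 2) n)"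
    if "enumerates \<pi>s (Pb_plus 0 k)" for \<pi>s
    unfolding pred_poly_def
    by (rule det_gram_small_blocks[OF _ epi_rank_0(2) that, where fl = True and y = "n - 1"])
      (use n0 polyQ_indet_nonzero in \<open>simp_all add: epi_rank_by_letters small_letters_def assms\<close>)
  show "det (gram k n \<pi>s) = n powi expo Ps_plus k *
          (\<Prod>\<sigma>\<in>epis Ps_plus k. polyR (num_upper \<sigma>) n / pred_poly polyR (num_upper \<sigma>) n)"
    if enum: "enumerates \<pi>s (Ps_plus 0 k)" for \<pi>s
  proof -
    define g where "g r = polyR r n / pred_poly polyR r n" for r
    have "det (gram k n \<pi>s) = n powi expo Ps_plus k *
        (\<Prod>i<2 * k. (polyR (Suc i) n / polyR i n) ^ num_paths False (2 * k) (2 * i + 2))"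
    proof (rule det_gram[OF path_model_polyR])
      show "card {zs \<in> tuples (UNIV :: bool set) k. coherent [] w zs \<and> coherent [] w' zs} = 2 ^ m"
        if "w \<in> words UNIV k 0" "w' \<in> words UNIV k 0"
          "pairs False (\<lambda>i. if even i then 1 else 0) (fatten w) (fatten w') m" for w w' m
        using that by (intro count_spins[OF that(3)]) (auto simp: words_def)
      show "tilt (\<lambda>h. if even h then 1 else -1) 0 (fatten w) =
          int (count_list w Si) - int (count_list w Mi)" if "w \<in> words UNIV k 0" for w
        using that tilt_fatten[of UNIV 0 w] by (simp add: words_def)
      show "bij_betw fatten (words UNIV k 0) (paths False (2 * k) 0)"
        using bij_betw_fatten[of k 0] by simp
    qed (use enum n0 polyR_indet_nonzero epi_rank_by_letters(1)[of 0 k] epi_rank_0(1) assms in auto)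
    also have "(\<Prod>i<2 * k. (polyR (Suc i) n / polyR i n) ^ num_paths False (2 * k) (2 * i + 2)) =
        (\<Prod>r\<le>k. g r ^ num_paths False (2 * k) (2 * r))"
      by (rule prod_index[symmetric]) (simp_all add: g_def pred_poly_def)
    also have "\<dots> = (\<Prod>r | r \<le> k \<and> True. g r ^ card (epi_rank Ps_plus r k))"
      using num_epis[OF epi_rank_by_letters(1) bij_betw_fatten] by (simp add: atMost_def)
    also have "\<dots> = (\<Prod>\<sigma> | \<sigma> \<in> epis Ps_plus k \<and> True. g (num_upper \<sigma>))"
      by (rule prod_epis[symmetric]) (auto simp: epi_rank_def)
    finally show ?thesis by (simp add: g_def)
  qed
qed

end
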